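(* Let $n\ge 1$ and $k\ge 0$ be integers and let $\mathbf{x}=(x_1,x_2,\ldots)$. Then the symmetric function $\mathcal{A}_{n+1,k}(\mathbf{x};r,u,v,w)$ (defined in the context) is equal to each of the following four determinants: \begin{align*} &\det_{1 \leq i,j \leq n} \left((-1)^{j-i}v^j\binom{i-1}{j-1}+ r u^i w^{j-i}s_{(i-1|j+k-1)}(\mathbf{x})\right)\\ =& \det_{1 \leq i,j \leq n} \left( r u^i e_{n+k+i-j}(\mathbf{x}) +(-1)^{i-1}v^{i}\sum_{m}\binom{m-1}{m-i}e_{n+1-j-m}(\mathbf{x}) \left(\frac{w}{u}\right)^{m-i}\right)\\ =& \det_{1 \leq i,j \leq n+k}\big(M_{i,j}\big)\\ =& \det_{1 \leq i,j \leq n} \left(\delta_{i,j}v^{i}+r u^{j} \sum_{m} \binom{i-1}{i-m}\left(\frac{w}{u}\right)^{i-m} s_{(m-1|j+k-1)}(\mathbf{x})\right), \end{align*} where the $(n+k)\times(n+k)$ matrix $M$ has entries \[ M_{i,j}= v^{n-i+1} h_{i-j}(\mathbf{x}) +(-1)^{k+n-i}\,r\,u^{n-i+1}\sum_{m}\binom{n-i}{m-i} h_{k+1+2n-m-j}(\mathbf{x}) \left(\frac{w}{u}\right)^{m-i}\quad\text{for } 1\le i\le n, \] and $M_{i,j}=h_{i-j}(\mathbf{x})$ for $n+1\le i\le n+k$.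
   Context: $r,u,v,w$ are indeterminates; identities are in symmetric functions in $\mathbf{x}=(x_1,x_2,\dots)$ with coefficients rational in $r,u,v,w$. $h_m$ and $e_m$ are the complete homogeneous and elementary symmetric functions, with $h_0=e_0=1$ and $h_m=e_m=0$ for $m<0$. $s_\lambda$ is the Schur function. All sums over $m$ range over all integers, with $\binom{p}{q}=0$ unless $0\le q\le p$. $\delta_{i,j}$ is the Kronecker delta. Frobenius notation: for a partition $\lambda$ with conjugate $\lambda'$, let $d$ (the Durfee square size) be the largest $d$ with $\lambda_d\ge d$; its Frobenius notation is $(\lambda_1-1,\ldots,\lambda_d-d\,|\,\lambda'_1-1,\ldots,\lambda'_d-d)$, and conversely a symbol $(a_1,\dots,a_d|b_1,\dots,b_d)$ with $a_1>\dots>a_d\ge0$, $b_1>\dots>b_d\ge 0$ denotes the corresponding partition. In particular $s_{(a|b)}$ for $a,b\ge 0$ is the Schur function of the hook $(a+1,1^b)$. A plane partition in an $(n,n,n)$-box is an array $T=(T_{i,j})_{1\le i,j\le n}$ of integers in $[0,n]$ weakly decreasing along rows and columns. It is totally symmetric if it is symmetric ($T_{i,j}=T_{j,i}$) and cyclically symmetric (the set of unit cubes $\{(i,j,l): 1\le l\le T_{i,j}\}$ is invariant under $(i,j,l)\mapsto(j,l,i)$). Let $\mathrm{TSPP}_n$ be the set of these. For $T\in\mathrm{TSPP}_n$ let $\mathrm{diag}(T)$ be the conjugate of the partition with parts $T_{1,1}\ge T_{2,2}\ge\dots\ge T_{n,n}$ (zeros omitted), let $(a_1,\dots,a_d|b_1,\dots,b_d)$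 be its Frobenius notation, and let $\pi_k(T)$ be the partition with Frobenius notation $(a_1,\dots,a_d|b_1+k,\dots,b_d+k)$. For $N\ge1$ and $T\in \mathrm{TSPP}_{N-1}$ put \[\omega(T)=r^d u^{\sum_{i=1}^d (a_i+1)} v^{\binom{N}{2}-\sum_{i=1}^d (b_i+1)} w^{\sum_{i=1}^d (b_i-a_i)},\] and define \[\mathcal{A}_{N,k}(\mathbf{x};r,u,v,w)=\sum_{T\in\mathrm{TSPP}_{N-1}}\omega(T)\,s_{\pi_k(T)}(\mathbf{x}).\] *)

theory Defs
  imports
    "Jordan_Normal_Form.Determinant"
    "HOL-Computational_Algebra.Fraction_Field"
    "HOL-Library.Groups_Big_Fun"
    "HOL-Library.Multiset"
begin

text \<open>
  A monomial in the variables \<open>x\<^sub>0, x\<^sub>1, x\<^sub>2, \<dots>\<close> is the multiset of the indices of its factors, and a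
  series is its coefficient function.  Each monomial has only finitely many divisors, so the product
  needs no convergence or finite-support condition.  Symmetric functions live in this ring.
\<close>

typedef 'a mvps = "UNIV :: (nat multiset \<Rightarrow> 'a) set"
  morphisms mvps_coeff Abs_mvps
  by simp

setup_lifting type_definition_mvps

lemma mvps_eq_iff: "f = g \<longleftrightarrow> (\<forall>M. mvps_coeff f M = mvps_coeff g M)"
  by transfer auto

lemma finite_submultisets: "finite {N. N \<subseteq># (M :: 'a multiset)}"
proof (induction M)
  case empty
  then show ?case by simp
next
  case (add x M)
  have "{N. N \<subseteq># add_mset x M} \<subseteq> {N. N \<subseteq># M} \<union> add_mset x ` {N. N \<subseteq># M}"
  proof
    fix N assume "N \<in> {N. N \<subseteq># add_mset x M}"
    then have N: "N \<subseteq># add_mset x M" by simp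
    show "N \<in> {N. N \<subseteq># M} \<union> add_mset x ` {N. N \<subseteq># M}"
    proof (cases "x \<in># N")
      case True
      then obtain K where K: "N = add_mset x K" by (meson multi_member_split)
      with N have "K \<subseteq># M" by simp
      with K show ?thesis by blast
    next
      case False
      then have "N \<subseteq># M" using N by (metis add_mset_add_single diff_single_trivial subset_eq_diff_conv)
      then show ?thesis by blast
    qed
  qed
  then show ?case using add by (meson finite_UnI finite_imageI finite_subset)
qed

instantiation mvps :: (comm_ring_1) comm_ring_1
begin

lift_definition zero_mvps :: "'a mvps" is "\<lambda>_. 0" .

lift_definition one_mvps :: "'a mvps" is "\<lambda>M. if M = {#} then 1 else 0" .

lift_definition plus_mvps :: "'a mvps \<Rightarrow> 'a mvps \<Rightarrow> 'a mvps" is "\<lambda>f g M. f M + g M" .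

lift_definition minus_mvps :: "'a mvps \<Rightarrow> 'a mvps \<Rightarrow> 'a mvps" is "\<lambda>f g M. f M - g M" .

lift_definition uminus_mvps :: "'a mvps \<Rightarrow> 'a mvps" is "\<lambda>f M. - f M" .

lift_definition times_mvps :: "'a mvps \<Rightarrow> 'a mvps \<Rightarrow> 'a mvps"
  is "\<lambda>f g M. \<Sum>N | N \<subseteq># M. f N * g (M - N)" .

instance
proof
  fix a b c :: "'a mvps"
  show "a * b * c = a * (b * c)"
  proof (transfer, rule ext)
    fix a b c :: "nat multiset \<Rightarrow> 'a" and M
    have "(\<Sum>N | N \<subseteq># M. (\<Sum>P | P \<subseteq># N. a P * b (N - P)) * c (M - N)) =
          (\<Sum>(N, P) \<in> (SIGMA N:{N. N \<subseteq># M}. {P. P \<subseteq># N}). a P * b (N - P) * c (M - N))"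
      by (simp add: sum_distrib_right sum.Sigma finite_submultisets)
    also have "\<dots> = (\<Sum>(P, Q) \<in> (SIGMA P:{P. P \<subseteq># M}. {Q. Q \<subseteq># M - P}).
                      a P * (b Q * c (M - P - Q)))"
      by (rule sum.reindex_bij_witness[where i = "\<lambda>(P, Q). (P + Q, P)" and j = "\<lambda>(N, P). (P, N - P)"])
         (auto simp: mult.assoc subset_eq_diff_conv subset_mset.le_diff_conv2 add.commute
               intro: subset_mset.order_trans mset_subset_eq_add_left)
    also have "\<dots> = (\<Sum>P | P \<subseteq># M. a P * (\<Sum>Q | Q \<subseteq># M - P. b Q * c (M - P - Q)))"
      by (simp add: sum_distrib_left sum.Sigma finite_submultisets)
    finally show "(\<Sum>N | N \<subseteq># M. (\<Sum>P | P \<subseteq># N. a P * b (N - P)) * c (M - N)) =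
                  (\<Sum>P | P \<subseteq># M. a P * (\<Sum>Q | Q \<subseteq># M - P. b Q * c (M - P - Q)))" .
  qed
  show "a * b = b * a"
  proof (transfer, rule ext)
    fix a b :: "nat multiset \<Rightarrow> 'a" and M
    show "(\<Sum>N | N \<subseteq># M. a N * b (M - N)) = (\<Sum>N | N \<subseteq># M. b N * a (M - N))"
      by (rule sum.reindex_bij_witness[where i = "\<lambda>N. M - N" and j = "\<lambda>N. M - N"])
         (auto simp: mult.commute subset_mset.diff_diff_right)
  qed
  show "1 * a = a"
  proof (transfer, rule ext)
    fix a :: "nat multiset \<Rightarrow> 'a" and M
    have "(\<Sum>N | N \<subseteq># M. (if N = {#} then 1 else 0) * a (M - N)) =
          (\<Sum>N | N \<subseteq># M. if N = {#} then a M else 0)"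
      by (rule sum.cong) auto
    also have "\<dots> = a M"
      by (simp add: sum.delta finite_submultisets)
    finally show "(\<Sum>N | N \<subseteq># M. (if N = {#} then 1 else 0) * a (M - N)) = a M" .
  qed
  show "(a + b) * c = a * c + b * c"
    by transfer (simp add: distrib_right sum.distrib)
  show "(0 :: 'a mvps) \<noteq> 1"
    by transfer (metis zero_neq_one)
qed (transfer; simp add: add_ac)+

end

lift_definition mvps_const :: "'a::comm_ring_1 \<Rightarrow> 'a mvps"
  is "\<lambda>c M. if M = {#} then c else 0" .

definition is_partition :: "nat list \<Rightarrow> bool" where
  "is_partition \<mu> \<longleftrightarrow> sorted_wrt (\<ge>) \<mu> \<and> 0 \<notin> set \<mu>"

text \<open>Parts are numbered from 1; \<open>part \<mu> 0 = 0\<close> is a dummy value.\<close>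

definition part :: "nat list \<Rightarrow> nat \<Rightarrow> nat" where
  "part \<mu> i = (if 1 \<le> i \<and> i \<le> length \<mu> then \<mu> ! (i - 1) else 0)"

definition conj_partition :: "nat list \<Rightarrow> nat list" where
  "conj_partition \<mu> = map (\<lambda>j. card {i. 1 \<le> i \<and> i \<le> length \<mu> \<and> j \<le> part \<mu> i}) [1..<part \<mu> 1 + 1]"

definition diagram :: "nat list \<Rightarrow> (nat \<times> nat) set" where
  "diagram \<mu> = {(i, j). 1 \<le> i \<and> i \<le> length \<mu> \<and> 1 \<le> j \<and> j \<le> part \<mu> i}"

definition ssyt :: "nat list \<Rightarrow> (nat \<times> nat \<Rightarrow> nat) set" where
  "ssyt \<mu> = {T \<in> extensional (diagram \<mu>).
     (\<forall>i j. (i, j) \<in> diagram \<mu> \<and> (i, j + 1) \<in> diagram \<mu> \<longrightarrow> T (i, j) \<le> T (i, j + 1)) \<and>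
     (\<forall>i j. (i, j) \<in> diagram \<mu> \<and> (i + 1, j) \<in> diagram \<mu> \<longrightarrow> T (i, j) < T (i + 1, j))}"

definition ssyt_content :: "nat list \<Rightarrow> (nat \<times> nat \<Rightarrow> nat) \<Rightarrow> nat multiset" where
  "ssyt_content \<mu> T = image_mset T (mset_set (diagram \<mu>))"

definition schur :: "nat list \<Rightarrow> 'a::comm_ring_1 mvps" where
  "schur \<mu> = Abs_mvps (\<lambda>M. of_nat (card {T \<in> ssyt \<mu>. ssyt_content \<mu> T = M}))"

definition hsym :: "int \<Rightarrow> 'a::comm_ring_1 mvps" where
  "hsym m = Abs_mvps (\<lambda>M. if int (size M) = m then 1 else 0)"

definition esym :: "int \<Rightarrow> 'a::comm_ring_1 mvps" where
  "esym m = Abs_mvps (\<lambda>M. if int (size M) = m \<and> (\<forall>i. count M i \<le> 1) then 1 else 0)"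

text \<open>The dummy \<open>part \<mu> 0 = 0\<close> makes the Durfee size of the empty partition 0.\<close>

definition durfee :: "nat list \<Rightarrow> nat" where
  "durfee \<mu> = Max {d. d \<le> length \<mu> \<and> d \<le> part \<mu> d}"

definition frobenius :: "nat list \<Rightarrow> nat list \<times> nat list" where
  "frobenius \<mu> =
     (map (\<lambda>i. part \<mu> i - i) [1..<durfee \<mu> + 1],
      map (\<lambda>i. part (conj_partition \<mu>) i - i) [1..<durfee \<mu> + 1])"

definition of_frobenius :: "nat list \<Rightarrow> nat list \<Rightarrow> nat list" where
  "of_frobenius as bs = (THE \<mu>. is_partition \<mu> \<and> frobenius \<mu> = (as, bs))"

text \<open>\<open>s\<^bsub>(a|b)\<^esub>\<close>, only meant for \<open>a, b \<ge> 0\<close>.\<close>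

definition schur_hook :: "int \<Rightarrow> int \<Rightarrow> 'a::comm_ring_1 mvps" where
  "schur_hook a b = schur (of_frobenius [nat a] [nat b])"

text \<open>An array indexed by \<open>{1..n} \<times> {1..n}\<close> is a function vanishing off these indices.\<close>

definition plane_partitions :: "nat \<Rightarrow> (nat \<Rightarrow> nat \<Rightarrow> nat) set" where
  "plane_partitions n = {T.
     (\<forall>i j. \<not> (i \<in> {1..n} \<and> j \<in> {1..n}) \<longrightarrow> T i j = 0) \<and>
     (\<forall>i\<in>{1..n}. \<forall>j\<in>{1..n}. T i j \<le> n) \<and>
     (\<forall>i\<in>{1..n}. \<forall>j\<in>{1..<n}. T i (j + 1) \<le> T i j) \<and>
     (\<forall>i\<in>{1..<n}. \<forall>j\<in>{1..n}. T (i + 1) j \<le> T i j)}"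

definition cubes :: "nat \<Rightarrow> (nat \<Rightarrow> nat \<Rightarrow> nat) \<Rightarrow> (nat \<times> nat \<times> nat) set" where
  "cubes n T = {(i, j, l). i \<in> {1..n} \<and> j \<in> {1..n} \<and> 1 \<le> l \<and> l \<le> T i j}"

definition tspp :: "nat \<Rightarrow> (nat \<Rightarrow> nat \<Rightarrow> nat) set" where
  "tspp n = {T \<in> plane_partitions n.
     (\<forall>i\<in>{1..n}. \<forall>j\<in>{1..n}. T i j = T j i) \<and>
     (\<lambda>(i, j, l). (j, l, i)) ` cubes n T = cubes n T}"

definition tspp_diag :: "nat \<Rightarrow> (nat \<Rightarrow> nat \<Rightarrow> nat) \<Rightarrow> nat list" where
  "tspp_diag n T = conj_partition (filter (\<lambda>p. p \<noteq> 0) (map (\<lambda>i. T i i) [1..<n + 1]))"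

definition tspp_pi :: "nat \<Rightarrow> nat \<Rightarrow> (nat \<Rightarrow> nat \<Rightarrow> nat) \<Rightarrow> nat list" where
  "tspp_pi n k T = (case frobenius (tspp_diag n T) of (as, bs) \<Rightarrow> of_frobenius as (map (\<lambda>b. b + k) bs))"

definition tspp_weight ::
  "nat \<Rightarrow> 'a::field \<Rightarrow> 'a \<Rightarrow> 'a \<Rightarrow> 'a \<Rightarrow> (nat \<Rightarrow> nat \<Rightarrow> nat) \<Rightarrow> 'a" where
  "tspp_weight N r u v w T = (case frobenius (tspp_diag (N - 1) T) of (as, bs) \<Rightarrow>
     let d = length as in
       r ^ d * u ^ (\<Sum>i<d. as ! i + 1) *
       v powi (int (N choose 2) - (\<Sum>i<d. int (bs ! i) + 1)) *
       w powi (\<Sum>i<d. int (bs ! i) - int (as ! i)))"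

definition tspp_fun :: "nat \<Rightarrow> nat \<Rightarrow> 'a::field \<Rightarrow> 'a \<Rightarrow> 'a \<Rightarrow> 'a \<Rightarrow> 'a mvps" where
  "tspp_fun N k r u v w =
     (\<Sum>T\<in>tspp (N - 1). mvps_const (tspp_weight N r u v w T) * schur (tspp_pi (N - 1) k T))"

text \<open>The field of rational functions over the rationals in the indeterminates \<open>r, u, v, w\<close>; the
  outermost polynomial layer is the one in \<open>r\<close>, the innermost the one in \<open>w\<close>.\<close>

type_synonym ruvw = "rat poly poly poly poly fract"

definition indet_r :: ruvw where "indet_r = Fract [:0, 1:] 1"
definition indet_u :: ruvw where "indet_u = Fract [:[:0, 1:]:] 1"
definition indet_v :: ruvw where "indet_v = Fract [:[:[:0, 1:]:]:] 1"
definition indet_w :: ruvw where "indet_w = Fract [:[:[:[:0, 1:]:]:]:] 1"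

definition ibinom :: "int \<Rightarrow> int \<Rightarrow> 'a::comm_ring_1" where
  "ibinom p q = (if 0 \<le> q \<and> q \<le> p then of_nat (nat p choose nat q) else 0)"

text \<open>The determinant with rows and columns numbered from 1 to \<open>n\<close>.\<close>

definition det1 :: "nat \<Rightarrow> (int \<Rightarrow> int \<Rightarrow> 'a::comm_ring_1) \<Rightarrow> 'a" where
  "det1 n A = det (mat n n (\<lambda>(i, j). A (int i + 1) (int j + 1)))"

end

theory Submission
  imports Defs
begin

text \<open>
  Write the Frobenius coordinates of a partition as \<open>(cs\<^sub>1 - 1, \<dots>, cs\<^sub>d - 1 | es\<^sub>1 - 1, \<dots>, es\<^sub>d - 1)\<close>.

  Passing from \<open>m\<close> to \<open>m + 1\<close> variables adds a horizontal strip, which makes the \<open>cs\<close> interlace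
  and raises each of the \<open>es\<close> by at most 1.  Both relations are the supports of the minors of an
  explicit matrix, so Cauchy--Binet and induction on the number of variables give Giambelli's formula.
  In the same way, a totally symmetric plane partition is an order ideal of triples \<open>i \<le> j \<le> l\<close>;
  removing the cells with \<open>j = l\<close> again raises entries by at most 1, and Pascal's rule shows that
  \<open>det (binomial (es\<^sub>i - 1) (cs\<^sub>j - 1))\<close> counts those with a given diagonal.

  Expanding the fourth determinant into principal minors and applying Cauchy--Binet to
  \<open>(binomial matrix) * (hook Schur functions)\<close> therefore yields the generating function.  The other
  determinants arise from it by multiplication with matrices of determinant 1: the inverse binomial
  matrix, and antitriangular matrices of elementary or complete symmetric functions, which turn hooks
  into single functions because \<open>s (a | b)\<close> and \<open>s (a + 1 | b - 1)\<close> add up to \<open>h\<^bsub>a + 1\<^esub> * e\<^bsub>b\<^esub>\<close>.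
\<close>

section \<open>Minors and the Cauchy--Binet formula\<close>

text \<open>The coordinates are kept one larger than usual so that 0 is free to denote an absent
  hook. Removing a horizontal strip or peeling off a layer of cells can destroy the last diagonal
  cell, but no other. So the lists can keep their length \<open>d\<close> throughout a recursion,
  and a strictly decreasing list has room for just the one final 0 that may arise. Constant length
  is what allows Cauchy--Binet, which relates minors of one size, to drive both inductions; on the
  side of matrices, the final 0 becomes an additional row and column.

  Schur functions in infinitely many variables have no last variable to split off. The recursions
  therefore take place after setting almost all variables to 0, which is a ring homomorphism, and an
  identity is recovered from all its truncations.

  The weights reach the determinants through \<open>t = w / u\<close>: scaling the binomial matrix
  by powers of \<open>t\<close> multiplies its minor by \<open>t\<close> to the power
  \<open>sum_list es - sum_list cs\<close>, and together with \<open>u ^ sum_list es\<close> from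
  the columns this is the \<open>u\<close>- and \<open>w\<close>-part of the weight.\<close>

definition minor :: "('i \<Rightarrow> 'j \<Rightarrow> 'a::comm_ring_1) \<Rightarrow> 'i list \<Rightarrow> 'j list \<Rightarrow> 'a" where
  "minor A xs ys = det (mat (length xs) (length xs) (\<lambda>(i, j). A (xs ! i) (ys ! j)))"

text \<open>Subsets of size \<open>d\<close>, written in the order of Frobenius coordinates, so that
  the lists summed over in Cauchy--Binet are themselves possible coordinates.\<close>

definition dec_lists :: "nat set \<Rightarrow> nat \<Rightarrow> nat list set" where
  "dec_lists Z d = {zs. sorted_wrt (>) zs \<and> set zs \<subseteq> Z \<and> length zs = d}"

lemma minor_Nil [simp]: "minor A [] ys = 1"
  by (simp add: minor_def)

lemma minor_leibniz:
  assumes "length xs = d"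
  shows "minor A xs ys =
    (\<Sum>p | p permutes {0..<d}. signof p * (\<Prod>i = 0..<d. A (xs ! i) (ys ! p i)))"
proof -
  have "(\<Prod>i = 0..<d. mat d d (\<lambda>(i, j). A (xs ! i) (ys ! j)) $$ (i, p i)) =
        (\<Prod>i = 0..<d. A (xs ! i) (ys ! p i))" if "p permutes {0..<d}" for p
    using permutes_in_image[OF that] by (intro prod.cong) auto
  then show ?thesis
    using assms by (simp add: minor_def det_def'[of _ d])
qed

lemma minor_cong:
  assumes "length xs = length ys" "\<And>x y. x \<in> set xs \<Longrightarrow> y \<in> set ys \<Longrightarrow> A x y = B x y"
  shows "minor A xs ys = minor B xs ys"
  using assms unfolding minor_def by (intro arg_cong[of _ _ det] eq_matI) auto

lemma minor_map:
  assumes "length xs = length ys"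
  shows "minor A (map f xs) (map g ys) = minor (\<lambda>x y. A (f x) (g y)) xs ys"
  using assms unfolding minor_def by (intro arg_cong[of _ _ det] eq_matI) auto

lemma minor_transpose:
  assumes "length xs = length ys"
  shows "minor A xs ys = minor (\<lambda>y x. A x y) ys xs"
proof -
  have "minor A xs ys = det (transpose_mat (mat (length xs) (length xs) (\<lambda>(i, j). A (xs ! i) (ys ! j))))"
    unfolding minor_def by (subst det_transpose[of _ "length xs"]) auto
  also have "\<dots> = minor (\<lambda>y x. A x y) ys xs"
    using assms unfolding minor_def by (intro arg_cong[of _ _ det] eq_matI) auto
  finally show ?thesis .
qed

text \<open>In the Leibniz expansion each term meets every row and every column exactly
  once.\<close>

lemma minor_scale:
  assumes len: "length xs = length ys"
  shows "minor (\<lambda>x y. f x * A x y * g y) xs ys = (\<Prod>x\<leftarrow>xs. f x) * (\<Prod>y\<leftarrow>ys. g y) * minor A xs ys"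
proof -
  define d where "d = length xs"
  have pl: "(\<Prod>x\<leftarrow>zs. h x) = (\<Prod>i = 0..<d. h (zs ! i))" if "length zs = d" for zs and h :: "'d \<Rightarrow> 'c"
    using that by (simp add: prod.list_conv_set_nth)
  have "(\<Prod>i = 0..<d. f (xs ! i) * A (xs ! i) (ys ! p i) * g (ys ! p i)) =
        (\<Prod>x\<leftarrow>xs. f x) * (\<Prod>y\<leftarrow>ys. g y) * (\<Prod>i = 0..<d. A (xs ! i) (ys ! p i))"
    if "p permutes {0..<d}" for p
  proof -
    have "(\<Prod>i = 0..<d. g (ys ! p i)) = (\<Prod>i = 0..<d. g (ys ! i))"
      using prod.permute[OF that, of "\<lambda>i. g (ys ! i)"] by (simp add: o_def)
    then show ?thesis
      using len by (simp add: prod.distrib pl d_def[symmetric] mult_ac)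
  qed
  then show ?thesis
    using len by (simp add: minor_leibniz[of _ d] d_def[symmetric] sum_distrib_left mult_ac)
qed

lemma (in comm_ring_hom) hom_minor:
  assumes "length xs = length ys"
  shows "hom (minor A xs ys) = minor (\<lambda>x y. hom (A x y)) xs ys"
  unfolding minor_def hom_det[symmetric]
  by (intro arg_cong[of _ _ det] eq_matI) auto

lemma mat_delete_list:
  assumes "length xs = length ys" "length us = length vs"
  shows "mat_delete (mat (length (xs @ x # us)) (length (xs @ x # us))
            (\<lambda>(i, j). A ((xs @ x # us) ! i) ((ys @ y # vs) ! j))) (length xs) (length xs) =
         mat (length (xs @ us)) (length (xs @ us)) (\<lambda>(i, j). A ((xs @ us) ! i) ((ys @ vs) ! j))"
  using assms
  by (intro eq_matI) (auto simp: mat_delete_def nth_append)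

lemma minor_Cons_row:
  assumes len: "length xs = length ys" and z: "\<And>y'. y' \<in> set ys \<Longrightarrow> A x y' = 0"
  shows "minor A (x # xs) (y # ys) = A x y * minor A xs ys"
proof -
  let ?n = "Suc (length xs)"
  let ?M = "mat ?n ?n (\<lambda>(i, j). A ((x # xs) ! i) ((y # ys) ! j))"
  have "det ?M = (\<Sum>j<?n. ?M $$ (0, j) * cofactor ?M 0 j)"
    by (rule laplace_expansion_row) auto
  also have "\<dots> = A x y * cofactor ?M 0 0"
    using z len by (subst sum.lessThan_Suc_shift) simp
  also have "cofactor ?M 0 0 = minor A xs ys"
    using mat_delete_list[of "[]" "[]" xs ys x A y] len by (simp add: cofactor_def minor_def)
  finally show ?thesis by (simp add: minor_def)
qed

lemma minor_Cons_col:
  assumes len: "length xs = length ys" and z: "\<And>x'. x' \<in> set xs \<Longrightarrow> A x' y = 0"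
  shows "minor A (x # xs) (y # ys) = A x y * minor A xs ys"
proof -
  have "minor A (x # xs) (y # ys) = minor (\<lambda>y x. A x y) (y # ys) (x # xs)"
    by (rule minor_transpose) (simp add: len)
  also have "\<dots> = A x y * minor (\<lambda>y x. A x y) ys xs"
    by (rule minor_Cons_row) (use len z in auto)
  also have "minor (\<lambda>y x. A x y) ys xs = minor A xs ys"
    by (rule minor_transpose) (simp add: len)
  finally show ?thesis .
qed

lemma minor_zero_row:
  assumes "x \<in> set xs" "\<And>y. y \<in> set ys \<Longrightarrow> A x y = 0" and len: "length xs = length ys"
  shows "minor A xs ys = 0"
proof -
  obtain k where k: "k < length xs" "xs ! k = x" using assms(1) by (auto simp: in_set_conv_nth)
  have "(\<Prod>i = 0..<length xs. A (xs ! i) (ys ! p i)) = 0" if "p permutes {0..<length xs}" for p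
    using k assms(2) len permutes_in_image[OF that, of k] by (intro prod_zero) (auto intro!: bexI[of _ k])
  then show ?thesis by (simp add: minor_leibniz)
qed

lemma minor_zero_col:
  assumes "y \<in> set ys" "\<And>x. x \<in> set xs \<Longrightarrow> A x y = 0" and len: "length xs = length ys"
  shows "minor A xs ys = 0"
  using minor_zero_row[of y ys xs "\<lambda>y x. A x y"] assms minor_transpose[OF len, of A] by simp

lemma minor_nondistinct:
  assumes "\<not> distinct xs"
  shows "minor A xs ys = 0"
proof -
  obtain i j where "i < length xs" "j < length xs" "i \<noteq> j" "xs ! i = xs ! j"
    using assms by (auto simp: distinct_conv_nth)
  then show ?thesis unfolding minor_def
    by (intro det_identical_rows[where i = i and j = j]) auto
qed

lemma minor_proportional_rows:
  assumes "length ys = Suc (Suc (length xs))" and g: "\<And>y. y \<in> set ys \<Longrightarrow> A x1 y = g * A x2 y"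
  shows "minor A (x1 # x2 # xs) ys = 0"
proof -
  let ?n = "Suc (Suc (length xs))"
  have "minor A (x1 # x2 # xs) ys = g * minor A (x2 # x2 # xs) ys"
  proof -
    have "(\<Prod>i = 0..<?n. A ((x1 # x2 # xs) ! i) (ys ! p i)) =
          g * (\<Prod>i = 0..<?n. A ((x2 # x2 # xs) ! i) (ys ! p i))" if "p permutes {0..<?n}" for p
      using assms permutes_in_image[OF that, of 0]
      by (simp add: prod.atLeast0_lessThan_Suc_shift mult.assoc del: prod.op_ivl_Suc)
    then show ?thesis by (simp add: minor_leibniz[of _ ?n] sum_distrib_left mult_ac del: prod.op_ivl_Suc)
  qed
  also have "minor A (x2 # x2 # xs) ys = 0"
    by (rule minor_nondistinct) simp
  finally show ?thesis by simp
qed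

lemma minor_permute_rows:
  assumes "length xs = d" "length ys = d" "p permutes {0..<d}"
  shows "minor A (map (\<lambda>i. xs ! p i) [0..<d]) ys = signof p * minor A xs ys"
proof -
  let ?M = "mat d d (\<lambda>(i, j). A (xs ! i) (ys ! j))"
  have "minor A (map (\<lambda>i. xs ! p i) [0..<d]) ys = det (mat d d (\<lambda>(i, j). ?M $$ (p i, j)))"
    unfolding minor_def using assms permutes_in_image[OF assms(3)]
    by (intro arg_cong[of _ _ det] eq_matI) auto
  also have "\<dots> = signof p * det ?M"
    by (rule det_permute_rows) (use assms in auto)
  finally show ?thesis using assms by (simp add: minor_def)
qed

lemma finite_dec_lists [intro]: "finite Z \<Longrightarrow> finite (dec_lists Z d)"
  by (rule finite_subset[OF _ finite_lists_length_eq[of Z d]]) (auto simp: dec_lists_def)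

lemma dec_list_unique:
  assumes "sorted_wrt (>) (xs :: nat list)" "sorted_wrt (>) ys" "set xs = set ys"
  shows "xs = ys"
proof -
  have "sorted_wrt (<) (rev xs)" "sorted_wrt (<) (rev ys)" using assms by (auto simp: sorted_wrt_rev)
  then show ?thesis using assms(3) strict_sorted_equal by fastforce
qed

lemma dec_list_distinct: "sorted_wrt (>) (xs :: nat list) \<Longrightarrow> distinct xs"
  by (induction xs) auto

lemma ex_dec_list:
  assumes "finite (Z :: nat set)"
  shows "\<exists>zs. sorted_wrt (>) zs \<and> set zs = Z"
  using assms by (intro exI[of _ "rev (sorted_list_of_set Z)"]) (auto simp: sorted_wrt_rev)

text \<open>An injective map from the positions to \<open>Z\<close> is the same as its image, listed
  decreasingly, together with the permutation of that list which it realizes.\<close>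

lemma bij_betw_dec_lists_permutes:
  "bij_betw (\<lambda>(zs, p). restrict (\<lambda>i. zs ! p i) {0..<d})
     (dec_lists Z d \<times> {p. p permutes {0..<d}}) {f \<in> {0..<d} \<rightarrow>\<^sub>E Z. inj_on f {0..<d}}"
  (is "bij_betw ?h ?A ?B")
proof (rule bij_betw_imageI[OF inj_onI equalityI[OF subsetI subsetI]], goal_cases)
  case (1 a b)
  obtain zs p zs' p' where ab: "a = (zs, p)" "b = (zs', p')" by (cases a, cases b)
  have z: "sorted_wrt (>) zs" "length zs = d" "sorted_wrt (>) zs'" "length zs' = d"
    and p: "p permutes {0..<d}" "p' permutes {0..<d}"
    using 1 unfolding ab dec_lists_def by auto
  have eq: "zs ! p i = zs' ! p' i" if "i < d" for i
    using 1(3) that unfolding ab by (auto dest!: fun_cong[where x = i])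
  have im: "set us = (\<lambda>i. us ! q i) ` {0..<d}" if "length us = d" "q permutes {0..<d}"
    for us :: "nat list" and q
  proof -
    have "(\<lambda>i. us ! q i) ` {0..<d} = (!) us ` (q ` {0..<d})" by auto
    also have "\<dots> = set us" using that permutes_image[OF that(2)] by (auto simp: set_conv_nth)
    finally show ?thesis by simp
  qed
  have "set zs = set zs'" using im[OF z(2) p(1)] im[OF z(4) p(2)] eq by auto
  then have zz: "zs = zs'" using dec_list_unique z by blast
  have "p i = p' i" for i
  proof (cases "i < d")
    case True
    then have "p i < d" "p' i < d" using permutes_in_image[OF p(1), of i] permutes_in_image[OF p(2), of i] by auto
    then show ?thesis
      using eq[OF True] dec_list_distinct[OF z(1)] z unfolding zz by (simp add: nth_eq_iff_index_eq)
  next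
    case False
    then show ?thesis using p by (simp add: permutes_def)
  qed
  then show ?case using ab zz by auto
next
  case (2 f)
  then obtain zs p where zp: "zs \<in> dec_lists Z d" "p permutes {0..<d}"
    "f = restrict (\<lambda>i. zs ! p i) {0..<d}" by auto
  have "inj_on f {0..<d}"
  proof (rule inj_onI)
    fix i j assume ij: "i \<in> {0..<d}" "j \<in> {0..<d}" "f i = f j"
    then have "p i = p j" using zp permutes_in_image[OF zp(2)]
      by (auto simp: dec_lists_def nth_eq_iff_index_eq dest!: dec_list_distinct)
    then show "i = j" using permutes_inj[OF zp(2)] by (auto dest: injD)
  qed
  moreover have "f \<in> {0..<d} \<rightarrow>\<^sub>E Z"
    using zp permutes_in_image[OF zp(2)] by (fastforce simp: dec_lists_def)
  ultimately show ?case by simp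
next
  case (3 f)
  then have f: "f \<in> {0..<d} \<rightarrow>\<^sub>E Z" "inj_on f {0..<d}" by auto
  obtain zs where zs: "sorted_wrt (>) zs" "set zs = f ` {0..<d}"
    using ex_dec_list[of "f ` {0..<d}"] by auto
  have len: "length zs = d"
    using distinct_card[OF dec_list_distinct[OF zs(1)]] card_image[OF f(2)] unfolding zs(2) by simp
  have inj: "inj_on ((!) zs) {0..<d}" using dec_list_distinct[OF zs(1)] len by (simp add: inj_on_nth)
  have "(!) zs ` {0..<d} = set zs" using len by (auto simp: set_conv_nth)
  then have im: "(!) zs ` {0..<d} = f ` {0..<d}" using zs(2) by simp
  \<comment> \<open>\<open>p i\<close> is the position of \<open>f i\<close> in \<open>zs\<close>;
    beyond \<open>d\<close> it is the identity, as \<open>permutes\<close> demands.\<close>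
  define p where "p i = (if i < d then inv_into {0..<d} ((!) zs) (f i) else i)" for i
  have bij: "bij_betw (\<lambda>i. inv_into {0..<d} ((!) zs) (f i)) {0..<d} {0..<d}"
  proof -
    have "bij_betw f {0..<d} (f ` {0..<d})" using f(2) by (simp add: bij_betw_def)
    moreover have "bij_betw (inv_into {0..<d} ((!) zs)) (f ` {0..<d}) {0..<d}"
      by (rule bij_betw_inv_into) (simp add: bij_betw_def inj im)
    ultimately show ?thesis using bij_betw_trans by (fastforce simp: o_def)
  qed
  then have "bij_betw p {0..<d} {0..<d}" by (rule bij_betw_cong[THEN iffD1, rotated]) (simp add: p_def)
  then have p: "p permutes {0..<d}" by (rule bij_imp_permutes) (auto simp: p_def)
  have "zs ! p i = f i" if "i < d" for i
    using that im unfolding p_def by (simp add: f_inv_into_f)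
  then have "f = restrict (\<lambda>i. zs ! p i) {0..<d}" using f(1) by (auto simp: PiE_def extensional_def)
  moreover have "zs \<in> dec_lists Z d" using zs len f by (auto simp: dec_lists_def)
  ultimately show ?case using p by force
qed

text \<open>Multiplying out the product over the rows gives one term for each map \<open>f\<close>
  from the rows to \<open>Z\<close>, namely a product of entries of \<open>A\<close> times a minor
  of \<open>B\<close>. That minor has two equal rows unless \<open>f\<close> is injective. For
  injective \<open>f\<close> the permutation contributes its sign, and the signed sum over
  permutations rebuilds the minor of \<open>A\<close>.\<close>

lemma cauchy_binet:
  fixes A :: "'i \<Rightarrow> nat \<Rightarrow> 'a::comm_ring_1"
  assumes Z: "finite Z" and len: "length xs = length ys"
  shows "minor (\<lambda>x y. \<Sum>z\<in>Z. A x z * B z y) xs ys =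
    (\<Sum>zs\<in>dec_lists Z (length xs). minor A xs zs * minor B zs ys)"
proof -
  define d where "d = length xs"
  let ?P = "{p. p permutes {0..<d}}" and ?F = "{0..<d} \<rightarrow>\<^sub>E Z"
  let ?G = "\<lambda>f. (\<Prod>i = 0..<d. A (xs ! i) (f i)) * minor B (map f [0..<d]) ys"
  have fF: "finite ?F" using Z by (intro finite_PiE) auto
  have "minor (\<lambda>x y. \<Sum>z\<in>Z. A x z * B z y) xs ys =
    (\<Sum>p\<in>?P. signof p * (\<Sum>f\<in>?F. \<Prod>i = 0..<d. A (xs ! i) (f i) * B (f i) (ys ! p i)))"
    using Z by (simp add: minor_leibniz d_def prod_sum_PiE)
  also have "\<dots> = (\<Sum>f\<in>?F. \<Sum>p\<in>?P. signof p * (\<Prod>i = 0..<d. A (xs ! i) (f i) * B (f i) (ys ! p i)))"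
    unfolding sum_distrib_left by (rule sum.swap)
  also have "\<dots> = (\<Sum>f\<in>?F. ?G f)"
    by (intro sum.cong refl) (simp add: minor_leibniz[of _ d] prod.distrib sum_distrib_left mult_ac)
  also have "\<dots> = (\<Sum>f\<in>{f \<in> ?F. inj_on f {0..<d}}. ?G f)"
    using fF by (intro sum.mono_neutral_right) (auto simp: minor_nondistinct distinct_map)
  also have "\<dots> = (\<Sum>(zs, p)\<in>dec_lists Z d \<times> ?P. ?G (restrict (\<lambda>i. zs ! p i) {0..<d}))"
    by (subst sum.reindex_bij_betw[OF bij_betw_dec_lists_permutes, symmetric]) (simp add: case_prod_unfold)
  also have "\<dots> = (\<Sum>(zs, p)\<in>dec_lists Z d \<times> ?P.
      signof p * (\<Prod>i = 0..<d. A (xs ! i) (zs ! p i)) * minor B zs ys)"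
  proof (intro sum.cong refl, clarify)
    fix zs p assume zp: "zs \<in> dec_lists Z d" "p permutes {0..<d}"
    have "map (restrict (\<lambda>i. zs ! p i) {0..<d}) [0..<d] = map (\<lambda>i. zs ! p i) [0..<d]" by simp
    moreover have "minor B (map (\<lambda>i. zs ! p i) [0..<d]) ys = signof p * minor B zs ys"
      by (rule minor_permute_rows) (use zp len in \<open>auto simp: dec_lists_def d_def\<close>)
    moreover have "(\<Prod>i = 0..<d. A (xs ! i) (restrict (\<lambda>i. zs ! p i) {0..<d} i)) =
      (\<Prod>i = 0..<d. A (xs ! i) (zs ! p i))" by (rule prod.cong) auto
    ultimately show "?G (restrict (\<lambda>i. zs ! p i) {0..<d}) =
      signof p * (\<Prod>i = 0..<d. A (xs ! i) (zs ! p i)) * minor B zs ys"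
      by (simp only: mult_ac)
  qed
  also have "\<dots> = (\<Sum>zs\<in>dec_lists Z d. minor A xs zs * minor B zs ys)"
    using Z by (simp add: sum.cartesian_product[symmetric] minor_leibniz[of _ d] d_def sum_distrib_right)
  finally show ?thesis by (simp add: d_def)
qed

section \<open>Expansion of a determinant into principal minors\<close>

text \<open>Changing one entry by \<open>c\<close> changes a determinant by \<open>c\<close> times
  the cofactor; on the diagonal the cofactor has sign +1 and is again a principal minor.\<close>

lemma minor_add_diagonal_entry:
  assumes x: "x \<notin> set xs" "x \<notin> set us"
  shows "minor (\<lambda>i j. A i j + (if i = x \<and> j = x then c else 0)) (xs @ x # us) (xs @ x # us) =
    minor A (xs @ x # us) (xs @ x # us) + c * minor A (xs @ us) (xs @ us)"
proof -
  let ?B = "\<lambda>i j. A i j + (if i = x \<and> j = x then c else 0)"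
  let ?l = "xs @ x # us" and ?n = "length (xs @ x # us)" and ?k = "length xs"
  define M where "M C = mat ?n ?n (\<lambda>(i, j). C (?l ! i) (?l ! j))" for C :: "'a \<Rightarrow> 'a \<Rightarrow> 'b"
  have M: "M C \<in> carrier_mat ?n ?n" for C by (simp add: M_def)
  have k: "?k < ?n" by simp
  \<comment> \<open>As \<open>x\<close> occurs only once in the list, the two matrices differ in row
    \<open>?k\<close> alone, and this row is deleted.\<close>
  have del: "mat_delete (M ?B) ?k j = mat_delete (M A) ?k j" if "j < ?n" for j
  proof -
    have "?l ! i \<noteq> x" if "i < ?n" "i \<noteq> ?k" for i
      using that x nth_mem[of i xs] nth_mem[of "i - Suc ?k" us]
      by (auto simp: nth_append nth_Cons' split: if_splits)
    then show ?thesis using that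
      by (intro eq_matI) (auto simp: mat_delete_def M_def)
  qed
  have cof: "cofactor (M ?B) ?k j = cofactor (M A) ?k j" if "j < ?n" for j
    using del[OF that] by (simp add: cofactor_def)
  have ent: "M ?B $$ (?k, j) = M A $$ (?k, j) + (if j = ?k then c else 0)" if "j < ?n" for j
    using that x nth_mem[of j xs] nth_mem[of "j - Suc ?k" us]
    by (auto simp: M_def nth_append nth_Cons' split: if_splits)
  have "det (M ?B) = (\<Sum>j<?n. M ?B $$ (?k, j) * cofactor (M ?B) ?k j)"
    by (rule laplace_expansion_row[OF M k])
  also have "\<dots> = (\<Sum>j<?n. (M A $$ (?k, j) + (if j = ?k then c else 0)) * cofactor (M A) ?k j)"
    by (intro sum.cong refl) (simp only: lessThan_iff ent cof)
  also have "\<dots> = (\<Sum>j<?n. M A $$ (?k, j) * cofactor (M A) ?k j) +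
      (\<Sum>j<?n. if j = ?k then c * cofactor (M A) ?k j else 0)"
    unfolding sum.distrib[symmetric] by (intro sum.cong) (auto simp: algebra_simps)
  also have "(\<Sum>j<?n. M A $$ (?k, j) * cofactor (M A) ?k j) = det (M A)"
    by (rule laplace_expansion_row[OF M k, symmetric])
  also have "(\<Sum>j<?n. if j = ?k then c * cofactor (M A) ?k j else 0) = c * cofactor (M A) ?k ?k"
    by (subst sum.delta) auto
  also have "cofactor (M A) ?k ?k = minor A (xs @ us) (xs @ us)"
    using mat_delete_list[of xs xs us us x A x] by (simp add: cofactor_def minor_def M_def)
  finally show ?thesis by (simp add: minor_def M_def)
qed

lemma dec_lists_Suc_split:
  "{ys. sorted_wrt (>) ys \<and> set ys \<subseteq> {1..Suc n}} =
   {ys. sorted_wrt (>) ys \<and> set ys \<subseteq> {1..n}} \<union>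
   (#) (Suc n) ` {ys. sorted_wrt (>) ys \<and> set ys \<subseteq> {1..n}}" (is "?L = ?A \<union> ?B")
proof (intro equalityI subsetI)
  fix ys assume ys: "ys \<in> ?L"
  show "ys \<in> ?A \<union> ?B"
  proof (cases ys)
    case (Cons y zs)
    have zs: "set zs \<subseteq> {1..n}" using ys Cons by fastforce
    show ?thesis
    proof (cases "y = Suc n")
      case True
      then show ?thesis using zs ys Cons by auto
    next
      case False
      then show ?thesis using zs ys Cons by fastforce
    qed
  qed auto
next
  fix ys assume "ys \<in> ?A \<union> ?B"
  then show "ys \<in> ?L" by fastforce
qed

lemma finite_dec_lists_le: "finite {ys :: nat list. sorted_wrt (>) ys \<and> set ys \<subseteq> {1..n}}"
proof (induction n)
  case 0
  have "{ys :: nat list. sorted_wrt (>) ys \<and> set ys \<subseteq> {1..0}} \<subseteq> {[]}" by auto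
  then show ?case using finite_subset by blast
next
  case (Suc n)
  then show ?case unfolding dec_lists_Suc_split by simp
qed

text \<open>The diagonal terms are split off one at a time, starting with the largest index: either
  \<open>i\<close> is deleted from the minor at the price \<open>D i\<close>, or it stays. The
  prefix \<open>zs\<close> records the indices that were decided to stay, where only
  \<open>X\<close> is left.\<close>

lemma minor_add_diagonal_aux:
  fixes D :: "nat \<Rightarrow> 'a::comm_ring_1"
  assumes "\<And>z. z \<in> set zs \<Longrightarrow> z > n"
  shows "minor (\<lambda>i j. X i j + (if i = j \<and> i \<le> n then D i else 0)) (zs @ rev [1..<n + 1]) (zs @ rev [1..<n + 1]) =
    (\<Sum>ys | sorted_wrt (>) ys \<and> set ys \<subseteq> {1..n}. (\<Prod>i\<in>{1..n} - set ys. D i) * minor X (zs @ ys) (zs @ ys))"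
  using assms
proof (induction n arbitrary: zs)
  case 0
  have "{ys :: nat list. sorted_wrt (>) ys \<and> set ys \<subseteq> {1..0}} = {[]}" by auto
  moreover have "minor (\<lambda>i j. X i j + (if i = j \<and> i \<le> 0 then D i else 0)) zs zs = minor X zs zs"
    by (rule minor_cong) (use 0 in auto)
  ultimately show ?case by simp
next
  case (Suc n)
  let ?S = "\<lambda>n. {ys :: nat list. sorted_wrt (>) ys \<and> set ys \<subseteq> {1..n}}"
  let ?F = "\<lambda>n i j. X i j + (if i = j \<and> i \<le> n then D i else 0)"
  let ?G = "\<lambda>n zs ys. (\<Prod>i\<in>{1..n} - set ys. D i) * minor X (zs @ ys) (zs @ ys)"
  let ?r = "rev [1..<n + 1]"
  have eq: "?F (Suc n) = (\<lambda>i j. ?F n i j + (if i = Suc n \<and> j = Suc n then D (Suc n) else 0))"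
    by (intro ext) (auto simp: le_Suc_eq)
  have "minor (?F (Suc n)) (zs @ rev [1..<Suc n + 1]) (zs @ rev [1..<Suc n + 1]) =
        minor (?F (Suc n)) (zs @ Suc n # ?r) (zs @ Suc n # ?r)"
    by simp
  also have "\<dots> = minor (?F n) (zs @ Suc n # ?r) (zs @ Suc n # ?r) + D (Suc n) * minor (?F n) (zs @ ?r) (zs @ ?r)"
    unfolding eq by (rule minor_add_diagonal_entry) (use Suc.prems in auto)
  also have "minor (?F n) (zs @ ?r) (zs @ ?r) = (\<Sum>ys\<in>?S n. ?G n zs ys)"
    by (rule Suc.IH) (use Suc.prems in fastforce)
  also have "minor (?F n) (zs @ Suc n # ?r) (zs @ Suc n # ?r) = (\<Sum>ys\<in>?S n. ?G n (zs @ [Suc n]) ys)"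
    using Suc.IH[of "zs @ [Suc n]"] Suc.prems by fastforce
  also have "(\<Sum>ys\<in>?S n. ?G n (zs @ [Suc n]) ys) = (\<Sum>ys\<in>(#) (Suc n) ` ?S n. ?G (Suc n) zs ys)"
  proof -
    have "{1..Suc n} - set (Suc n # ys) = {1..n} - set ys" for ys by auto
    then show ?thesis by (subst sum.reindex) auto
  qed
  also have "D (Suc n) * (\<Sum>ys\<in>?S n. ?G n zs ys) = (\<Sum>ys\<in>?S n. ?G (Suc n) zs ys)"
    unfolding sum_distrib_left
  proof (intro sum.cong refl)
    fix ys assume "ys \<in> ?S n"
    then have "{1..Suc n} - set ys = insert (Suc n) ({1..n} - set ys)" by auto
    then show "D (Suc n) * ?G n zs ys = ?G (Suc n) zs ys" by (simp add: mult.assoc)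
  qed
  also have "(\<Sum>ys\<in>(#) (Suc n) ` ?S n. ?G (Suc n) zs ys) + (\<Sum>ys\<in>?S n. ?G (Suc n) zs ys) =
             (\<Sum>ys\<in>?S (Suc n). ?G (Suc n) zs ys)"
    unfolding dec_lists_Suc_split
    by (subst sum.union_disjoint) (auto simp: finite_dec_lists_le[unfolded One_nat_def] add.commute)
  finally show ?case .
qed

lemma minor_add_diagonal:
  fixes D :: "nat \<Rightarrow> 'a::comm_ring_1"
  shows "minor (\<lambda>i j. X i j + (if i = j then D i else 0)) (rev [1..<n + 1]) (rev [1..<n + 1]) =
    (\<Sum>ys | sorted_wrt (>) ys \<and> set ys \<subseteq> {1..n}. (\<Prod>i\<in>{1..n} - set ys. D i) * minor X ys ys)"
proof -
  have "minor (\<lambda>i j. X i j + (if i = j then D i else 0)) (rev [1..<n + 1]) (rev [1..<n + 1]) =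
        minor (\<lambda>i j. X i j + (if i = j \<and> i \<le> n then D i else 0)) (rev [1..<n + 1]) (rev [1..<n + 1])"
    by (rule minor_cong) auto
  then show ?thesis using minor_add_diagonal_aux[of "[]" n X D] by simp
qed

text \<open>The one-step transfer matrices: on decreasing lists, horizontal strips interlace and vertical
  strips raise every entry by at most one; each such pair contributes a single monomial.\<close>

lemma minor_geometric:
  fixes x :: "'a::comm_ring_1"
  assumes "sorted_wrt (>) xs" "sorted_wrt (>) ys" "length xs = length ys"
  shows "minor (\<lambda>a b. if b \<le> a then x ^ (a - b) else 0) xs ys =
    (if (\<forall>i<length xs. ys ! i \<le> xs ! i) \<and> (\<forall>i. Suc i < length xs \<longrightarrow> xs ! Suc i < ys ! i)
     then x ^ (sum_list xs - sum_list ys) else 0)"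
    (is "minor ?X _ _ = (if ?P xs ys then _ else 0)")
  using assms
proof (induction xs arbitrary: ys)
  case (Cons a xs)
  obtain b zs where ys: "ys = b # zs" using Cons.prems by (cases ys) auto
  have len: "length xs = length zs" using Cons.prems ys by simp
  show ?case
  proof (cases "b \<le> a")
    case False
    then have "minor ?X (a # xs) ys = 0"
      by (intro minor_zero_col[of b]) (use ys Cons.prems in auto)
    then show ?thesis using False ys by auto
  next
    case ba: True
    show ?thesis
    proof (cases "xs \<noteq> [] \<and> b \<le> hd xs")
      case True
      then obtain a' xs' where xs: "xs = a' # xs'" by (cases xs) auto
      \<comment> \<open>All columns are at most \<open>b\<close>, hence at most \<open>a'\<close>;
        on them the first row is \<open>x ^ (a - a')\<close> times the second.\<close>
      have "minor ?X (a # xs) ys = 0" unfolding xs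
      proof (rule minor_proportional_rows)
        show "length ys = Suc (Suc (length xs'))" using Cons.prems xs by simp
        fix y assume "y \<in> set ys"
        then have "y \<le> a'" "a' \<le> a" using Cons.prems ys True xs by auto
        then show "?X a y = x ^ (a - a') * ?X a' y" by (simp add: power_add[symmetric])
      qed
      moreover have "\<not> ?P (a # xs) ys" using True xs ys by force
      ultimately show ?thesis by (subst if_not_P)
    next
      case False
      \<comment> \<open>All rows after the first lie below \<open>b\<close>, so the first column is
        zero under its top entry.\<close>
      have lt: "a' < b" if "a' \<in> set xs" for a' using that False Cons.prems by (cases xs) auto
      have "minor ?X (a # xs) ys = ?X a b * minor ?X xs zs"
        unfolding ys by (rule minor_Cons_col) (use len lt in \<open>auto dest: leD\<close>)
      also have "minor ?X xs zs = (if ?P xs zs then x ^ (sum_list xs - sum_list zs) else 0)"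
        by (rule Cons.IH) (use Cons.prems ys in auto)
      also have "?P (a # xs) ys \<longleftrightarrow> ?P xs zs"
      proof -
        have "?P (a # xs) ys \<longleftrightarrow> b \<le> a \<and> (xs \<noteq> [] \<longrightarrow> xs ! 0 < b) \<and> ?P xs zs"
          unfolding ys by (auto simp: All_less_Suc2 nth_Cons split: nat.splits)
        then show ?thesis using ba lt by auto
      qed
      moreover have "sum_list zs \<le> sum_list xs" if "?P xs zs"
        unfolding sum_list_sum_nth len[symmetric] by (rule sum_mono) (use that in auto)
      ultimately show ?thesis using ba ys by (auto simp: power_add[symmetric])
    qed
  qed
qed auto

lemma minor_shift:
  fixes f :: "nat \<Rightarrow> nat \<Rightarrow> 'a::comm_ring_1"
  assumes "sorted_wrt (>) xs" "sorted_wrt (>) ys" "length xs = length ys"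
  shows "minor (\<lambda>a b. if b = a \<or> b = Suc a then f a b else 0) xs ys =
    (if \<forall>i<length xs. ys ! i = xs ! i \<or> ys ! i = Suc (xs ! i)
     then \<Prod>i<length xs. f (xs ! i) (ys ! i) else 0)"
    (is "minor ?X _ _ = (if ?P xs ys then _ else 0)")
  using assms
proof (induction xs arbitrary: ys)
  case (Cons a xs)
  obtain b zs where ys: "ys = b # zs" using Cons.prems by (cases ys) auto
  have len: "length xs = length zs" using Cons.prems ys by simp
  have P: "?P (a # xs) ys \<longleftrightarrow> (b = a \<or> b = Suc a) \<and> ?P xs zs"
    unfolding ys by (auto simp: All_less_Suc2)
  \<comment> \<open>The remaining columns lie below \<open>b\<close> and the remaining rows below
    \<open>a\<close>. So for \<open>b = a\<close> the first row, and for \<open>b = Suc a\<close>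
    the first column, is zero except for its corner entry.\<close>
  consider "b < a" | "b = a" | "b = Suc a" | "b > Suc a" by linarith
  then show ?case
  proof cases
    case 1
    then have "minor ?X (a # xs) ys = 0"
      by (intro minor_zero_row[of a]) (use ys Cons.prems in auto)
    then show ?thesis using 1 P by auto
  next
    case 4
    then have "minor ?X (a # xs) ys = 0"
      by (intro minor_zero_col[of b]) (use ys Cons.prems in auto)
    then show ?thesis using 4 P by auto
  next
    case 2
    have "minor ?X (a # xs) ys = ?X a b * minor ?X xs zs"
      unfolding ys by (rule minor_Cons_row) (use len 2 Cons.prems ys in auto)
    then show ?thesis
      using 2 P Cons.IH[of zs] Cons.prems ys by (auto simp: prod.lessThan_Suc_shift simp del: prod.lessThan_Suc)
  next
    case 3
    have "minor ?X (a # xs) ys = ?X a b * minor ?X xs zs"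
      unfolding ys by (rule minor_Cons_col) (use len 3 Cons.prems ys in auto)
    then show ?thesis
      using 3 P Cons.IH[of zs] Cons.prems ys by (auto simp: prod.lessThan_Suc_shift simp del: prod.lessThan_Suc)
  qed
qed auto

text \<open>The sign of the reversal occurs once for the rows and once for the columns.\<close>

lemma minor_rev:
  assumes "length xs = length ys"
  shows "minor A (rev xs) (rev ys) = minor A xs ys"
proof -
  define d where "d = length xs"
  define p where "p i = (if i < d then d - 1 - i else i)" for i
  have p: "p permutes {0..<d}"
  proof (rule bij_imp_permutes)
    show "bij_betw p {0..<d} {0..<d}"
      by (rule bij_betw_byWitness[where f' = p]) (auto simp: p_def)
  qed (auto simp: p_def)
  have rev: "rev zs = map (\<lambda>i. zs ! p i) [0..<d]" if "length zs = d" for zs :: "'d list"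
    using that by (intro nth_equalityI) (auto simp: rev_nth p_def)
  have len: "length xs = d" "length ys = d" using assms by (auto simp: d_def)
  have "minor A (rev xs) (rev ys) = signof p * minor A xs (rev ys)"
    using minor_permute_rows[of xs d "rev ys" p A] rev[of xs] len p by simp
  also have "minor A xs (rev ys) = minor (\<lambda>y x. A x y) (rev ys) xs"
    by (rule minor_transpose) (simp add: len)
  also have "\<dots> = signof p * minor (\<lambda>y x. A x y) ys xs"
    using minor_permute_rows[of ys d xs p "\<lambda>y x. A x y"] rev[of ys] len p by simp
  also have "minor (\<lambda>y x. A x y) ys xs = minor A xs ys"
    by (rule minor_transpose) (simp add: len)
  finally show ?thesis by (simp add: sign_def)
qed

section \<open>Minors with an extra index 0, and unimodular factors\<close>

definition bordered :: "(nat \<Rightarrow> nat \<Rightarrow> 'a::comm_ring_1) \<Rightarrow> nat \<Rightarrow> nat \<Rightarrow> 'a" where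
  "bordered A a b = (if a = 0 \<and> b = 0 then 1 else if a = 0 \<or> b = 0 then 0 else A a b)"

lemma bordered_0_0 [simp]: "bordered A 0 0 = 1"
  and bordered_0_left: "b \<noteq> 0 \<Longrightarrow> bordered A 0 b = 0"
  and bordered_0_right: "a \<noteq> 0 \<Longrightarrow> bordered A a 0 = 0"
  and bordered_pos: "a \<noteq> 0 \<Longrightarrow> b \<noteq> 0 \<Longrightarrow> bordered A a b = A a b"
  by (simp_all add: bordered_def)

lemma dec_list_zero_last:
  assumes "sorted_wrt (>) xs" "(0::nat) \<in> set xs"
  obtains us where "xs = us @ [0]" "0 \<notin> set us" "sorted_wrt (>) us"
proof -
  have "xs \<noteq> []" using assms by auto
  then obtain us x where xs: "xs = us @ [x]" by (metis rev_exhaust)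
  then have "x = 0" "0 \<notin> set us" using assms by (auto simp: sorted_wrt_append)
  then show thesis using that[of us] xs assms by (auto simp: sorted_wrt_append)
qed

lemma minor_bordered_disagree:
  assumes "length xs = length ys" "(0 \<in> set xs) \<noteq> (0 \<in> set ys)"
  shows "minor (bordered A) xs ys = 0"
proof (cases "0 \<in> set xs")
  case True
  then have "0 \<notin> set ys" using assms by simp
  then have "bordered A 0 y = 0" if "y \<in> set ys" for y using that bordered_0_left by metis
  then show ?thesis using minor_zero_row[OF True _ assms(1)] by blast
next
  case False
  then have "bordered A x 0 = 0" if "x \<in> set xs" for x using that bordered_0_right by metis
  moreover have "0 \<in> set ys" using False assms by simp
  ultimately show ?thesis using minor_zero_col[OF _ _ assms(1)] by blast
qed

lemma minor_bordered_pos: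
  assumes "length xs = length ys" "0 \<notin> set xs" "0 \<notin> set ys"
  shows "minor (bordered A) xs ys = minor A xs ys"
  by (rule minor_cong[OF assms(1)]) (metis assms bordered_pos)

lemma minor_bordered_snoc:
  assumes "length xs = length ys" "0 \<notin> set xs" "0 \<notin> set ys"
  shows "minor (bordered A) (xs @ [0]) (ys @ [0]) = minor A xs ys"
proof -
  have "minor (bordered A) (xs @ [0]) (ys @ [0]) = minor (bordered A) (0 # rev xs) (0 # rev ys)"
    using minor_rev[of "0 # rev xs" "0 # rev ys" "bordered A"] assms by simp
  also have "\<dots> = bordered A 0 0 * minor (bordered A) (rev xs) (rev ys)"
  proof (rule minor_Cons_row)
    show "bordered A 0 y = 0" if "y \<in> set (rev ys)" for y
      using that assms(3) bordered_0_left[of y A] by (cases y) auto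
  qed (use assms in simp)
  also have "minor (bordered A) (rev xs) (rev ys) = minor A (rev xs) (rev ys)"
    by (rule minor_bordered_pos) (use assms in auto)
  finally show ?thesis using minor_rev[of xs ys A] assms by simp
qed

text \<open>The expansion runs along the rows of \<open>us\<close>, so the entries of the other rows
  in the columns \<open>us\<close> are arbitrary. This allows a determinant of size \<open>n\<close>
  to be enlarged to size \<open>n + k\<close>.\<close>

lemma minor_identity_rows:
  assumes "length xs = length ys" "distinct us" "set us \<inter> set ys = {}"
    "\<And>x y. x \<in> set us \<Longrightarrow> y \<in> set us \<union> set ys \<Longrightarrow> A x y = (if x = y then 1 else 0)"
  shows "minor A (us @ xs) (us @ ys) = minor A xs ys"
  using assms(2-)
proof (induction us)
  case (Cons u us)
  have "minor A ((u # us) @ xs) ((u # us) @ ys) = A u u * minor A (us @ xs) (us @ ys)"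
    unfolding append_Cons by (rule minor_Cons_row) (use Cons.prems assms(1) in auto)
  then show ?case using Cons by simp
qed auto

text \<open>Cauchy--Binet with a single summand, since \<open>{1..n}\<close> has only one subset of
  size \<open>n\<close>.\<close>

lemma minor_mult:
  fixes A B :: "nat \<Rightarrow> nat \<Rightarrow> 'a::comm_ring_1"
  shows "minor (\<lambda>x y. \<Sum>z = 1..n. A x z * B z y) [1..<n + 1] [1..<n + 1] =
    minor A [1..<n + 1] [1..<n + 1] * minor B [1..<n + 1] [1..<n + 1]"
proof -
  let ?L = "[1..<n + 1]"
  have srt: "sorted_wrt (>) (rev ?L)" by (simp add: sorted_wrt_rev del: upt_Suc)
  have st: "set (rev ?L) = {1..n}" by auto
  have "zs \<in> dec_lists {1..n} n \<longleftrightarrow> zs = rev ?L" for zs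
  proof
    assume "zs \<in> dec_lists {1..n} n"
    then have zs: "sorted_wrt (>) zs" "set zs \<subseteq> {1..n}" "length zs = n" by (auto simp: dec_lists_def)
    have "card (set zs) = n" using zs dec_list_distinct distinct_card by force
    then have "set zs = {1..n}" using zs(2) by (intro card_subset_eq) auto
    then show "zs = rev ?L" using dec_list_unique[OF zs(1) srt] st by argo
  next
    assume "zs = rev ?L"
    then show "zs \<in> dec_lists {1..n} n" using srt st by (simp add: dec_lists_def del: upt_Suc)
  qed
  then have "dec_lists {1..n} n = {rev ?L}" by blast
  moreover have "minor C ?L ?L = minor C (rev ?L) (rev ?L)" for C :: "nat \<Rightarrow> nat \<Rightarrow> 'a"
    by (rule minor_rev[symmetric]) simp
  ultimately show ?thesis
    using cauchy_binet[of "{1..n}" "rev ?L" "rev ?L" A B] by (simp del: upt_Suc)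
qed

text \<open>The signs \<open>(-1)\<^sup>j\<close> compensate the sign of the order-reversing permutation.\<close>

lemma det_signed_antitriangular:
  assumes "f 0 = (1 :: 'a::comm_ring_1)"
  shows "det (mat n n (\<lambda>(i, j). if i + j < n then (-1) ^ j * f (n - 1 - i - j) else 0)) = 1"
proof (induction n)
  case (Suc n)
  define M where "M n = mat n n (\<lambda>(i, j). if i + j < n then (-1) ^ j * f (n - 1 - i - j) else 0)" for n
  have "det (M (Suc n)) = (\<Sum>j<Suc n. M (Suc n) $$ (n, j) * cofactor (M (Suc n)) n j)"
    by (rule laplace_expansion_row) (auto simp: M_def)
  also have "\<dots> = cofactor (M (Suc n)) n 0"
    using assms by (subst sum.lessThan_Suc_shift) (simp add: M_def)
  \<comment> \<open>Deleting the first column shifts \<open>j\<close> by one and so flips every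
    sign; over the \<open>n\<close> rows this gives \<open>(-1) ^ n\<close>, which cancels the sign
    of the cofactor.\<close>
  also have "mat_delete (M (Suc n)) n 0 = (-1) \<cdot>\<^sub>m M n"
    by (rule eq_matI) (auto simp: mat_delete_def M_def)
  then have "cofactor (M (Suc n)) n 0 = (-1) ^ n * ((-1) ^ n * det (M n))"
    by (simp add: cofactor_def M_def)
  also have "\<dots> = det (M n)" by (simp add: mult.assoc[symmetric] power_add[symmetric])
  finally show ?case using Suc by (simp add: M_def)
qed simp

section \<open>Shifted diagrams and Frobenius notation\<close>

text \<open>The shifted Young diagram of a strict partition: row \<open>i\<close> begins on the
  diagonal. An ordinary diagram, cut along its diagonal, falls into two of these.\<close>

definition shifted_diagram :: "nat list \<Rightarrow> (nat \<times> nat) set" where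
  "shifted_diagram cs = {(i, j). 1 \<le> i \<and> i \<le> length cs \<and> i \<le> j \<and> j < i + cs ! (i - 1)}"

definition shifted_ideal :: "(nat \<times> nat) set \<Rightarrow> bool" where
  "shifted_ideal A \<longleftrightarrow> finite A \<and> (\<forall>i j. (i, j) \<in> A \<longrightarrow> 1 \<le> i \<and> i \<le> j) \<and>
     (\<forall>i j. (i, Suc j) \<in> A \<and> i \<le> j \<longrightarrow> (i, j) \<in> A) \<and>
     (\<forall>i j. (Suc i, j) \<in> A \<and> 1 \<le> i \<longrightarrow> (i, j) \<in> A)"

lemma shifted_idealI:
  assumes "finite A" "\<And>i j. (i, j) \<in> A \<Longrightarrow> 1 \<le> i \<and> i \<le> j"
    "\<And>i j. (i, Suc j) \<in> A \<Longrightarrow> i \<le> j \<Longrightarrow> (i, j) \<in> A"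
    "\<And>i j. (Suc i, j) \<in> A \<Longrightarrow> 1 \<le> i \<Longrightarrow> (i, j) \<in> A"
  shows "shifted_ideal A"
  unfolding shifted_ideal_def by (metis assms)

lemma
  assumes "shifted_ideal A"
  shows shifted_ideal_finite: "finite A"
    and shifted_ideal_pos: "(i, j) \<in> A \<Longrightarrow> 1 \<le> i \<and> i \<le> j"
    and shifted_ideal_row: "(i, Suc j) \<in> A \<Longrightarrow> i \<le> j \<Longrightarrow> (i, j) \<in> A"
    and shifted_ideal_col: "(Suc i, j) \<in> A \<Longrightarrow> 1 \<le> i \<Longrightarrow> (i, j) \<in> A"
  using assms unfolding shifted_ideal_def by blast+

lemma mem_shifted_diagram:
  "(Suc k, j) \<in> shifted_diagram cs \<longleftrightarrow> k < length cs \<and> k < j \<and> j < Suc k + cs ! k"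
  by (auto simp: shifted_diagram_def)

lemma shifted_diagram_pos: "(i, j) \<in> shifted_diagram cs \<Longrightarrow> 1 \<le> i \<and> i \<le> j \<and> i \<le> length cs"
  by (auto simp: shifted_diagram_def)

lemma finite_shifted_diagram [simp]: "finite (shifted_diagram cs)"
proof (rule finite_subset)
  show "shifted_diagram cs \<subseteq> (SIGMA i:{1..length cs}. {i..<i + cs ! (i - 1)})"
    by (auto simp: shifted_diagram_def)
qed simp

lemma shifted_ideal_shifted_diagram:
  assumes "sorted_wrt (>) cs"
  shows "shifted_ideal (shifted_diagram cs)"
proof -
  have "(i, j) \<in> shifted_diagram cs" if ij: "(Suc i, j) \<in> shifted_diagram cs" "1 \<le> i" for i j
  proof -
    obtain k where k: "i = Suc k" using ij(2) by (cases i) auto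
    have "cs ! Suc k < cs ! k" if "Suc k < length cs"
      using assms that sorted_wrt_nth_less[of "(>)" cs k "Suc k"] by simp
    then show ?thesis using ij unfolding k mem_shifted_diagram by auto
  qed
  moreover have "(i, j) \<in> shifted_diagram cs" if "(i, Suc j) \<in> shifted_diagram cs" "i \<le> j" for i j
    using that by (auto simp: shifted_diagram_def)
  ultimately show ?thesis
    using shifted_idealI[OF finite_shifted_diagram] shifted_diagram_pos by metis
qed

text \<open>Reads off row and column lengths from sets of cells that are known only to be closed
  under predecessors.\<close>

lemma initial_segment:
  assumes "finite R" "\<And>j. j \<in> R \<Longrightarrow> i \<le> j" "\<And>j. Suc j \<in> R \<Longrightarrow> i \<le> j \<Longrightarrow> j \<in> R"
  shows "R = {i..<i + card R}"
proof (cases "R = {}")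
  case False
  define m where "m = Max R"
  have m: "m \<in> R" "\<And>j. j \<in> R \<Longrightarrow> j \<le> m" using False assms(1) by (auto simp: m_def)
  have in_R: "j \<in> R" if "i \<le> j" "j \<le> m" for j
    using that(2,1) by (induction rule: inc_induct) (use m(1) assms(3) in simp_all)
  have "j \<in> R \<longleftrightarrow> j \<in> {i..m}" for j using in_R[of j] m(2)[of j] assms(2)[of j] by auto
  then have "R = {i..m}" by blast
  then show ?thesis using assms(2)[OF m(1)] by (simp add: atLeastLessThanSuc_atLeastAtMost)
qed simp

lemma shifted_ideal_row_down:
  assumes "shifted_ideal A" "(i, j) \<in> A" "i \<le> j'" "j' \<le> j"
  shows "(i, j') \<in> A"
  using assms(4,3) by (induction rule: inc_induct) (use assms(2) shifted_ideal_row[OF assms(1)] in simp_all)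

text \<open>The diagonal cells are required only below \<open>d\<close>, so row \<open>d\<close> may
  be empty; it then becomes a final 0. The row lengths decrease strictly because each row starts one
  column further to the right but is still covered by the row above it.\<close>

lemma ex_shifted_diagram:
  assumes A: "shifted_ideal A" and le: "\<And>i. (i, i) \<in> A \<Longrightarrow> i \<le> d"
    and ge: "\<And>i. 1 \<le> i \<Longrightarrow> i < d \<Longrightarrow> (i, i) \<in> A"
  shows "\<exists>cs. sorted_wrt (>) cs \<and> length cs = d \<and> shifted_diagram cs = A"
proof -
  define R where "R i = {j. (i, j) \<in> A}" for i
  define cs where "cs = map (\<lambda>i. card (R i)) [1..<d + 1]"
  have len: "length cs = d" by (simp add: cs_def)
  have nth: "cs ! k = card (R (Suc k))" if "k < d" for k
    using that unfolding cs_def by (subst nth_map) (auto simp del: upt_Suc)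
  have fin: "finite (R i)" for i
    by (rule finite_subset[of _ "snd ` A"]) (use shifted_ideal_finite[OF A] in \<open>force simp: R_def\<close>)+
  have R: "R i = {i..<i + card (R i)}" for i
    by (rule initial_segment[OF fin]) (use shifted_ideal_pos[OF A] shifted_ideal_row[OF A] in \<open>auto simp: R_def\<close>)
  have "card (R (Suc (Suc k))) < card (R (Suc k))" if "Suc k < d" for k
  proof (rule psubset_card_mono[OF fin])
    have "Suc k \<in> R (Suc k)" using ge[of "Suc k"] that by (simp add: R_def)
    moreover have "Suc k \<notin> R (Suc (Suc k))" using shifted_ideal_pos[OF A] by (force simp: R_def)
    moreover have "R (Suc (Suc k)) \<subseteq> R (Suc k)"
      unfolding R_def using shifted_ideal_col[OF A, of "Suc k"] by auto
    ultimately show "R (Suc (Suc k)) \<subset> R (Suc k)" by blast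
  qed
  then have "sorted_wrt (>) cs"
    by (subst sorted_wrt_iff_nth_Suc_transp) (simp_all add: len nth transp_def)
  moreover have "(i, j) \<in> shifted_diagram cs \<longleftrightarrow> (i, j) \<in> A" for i j
  proof (cases "1 \<le> i \<and> i \<le> d")
    case True
    then have "i - 1 < d" "Suc (i - 1) = i" by auto
    then have "cs ! (i - 1) = card (R i)" using nth[of "i - 1"] by simp
    then have "(i, j) \<in> shifted_diagram cs \<longleftrightarrow> j \<in> {i..<i + card (R i)}"
      using True len by (auto simp: shifted_diagram_def)
    also have "\<dots> \<longleftrightarrow> j \<in> R i" by (subst R[of i]) (rule refl)
    finally show ?thesis by (simp add: R_def)
  next
    case False
    moreover have "1 \<le> i" "i \<le> d" if "(i, j) \<in> A"
    proof -
      have ij: "1 \<le> i" "i \<le> j" using shifted_ideal_pos[OF A that] by auto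
      show "1 \<le> i" by (fact ij)
      show "i \<le> d" using le[OF shifted_ideal_row_down[OF A that]] ij by simp
    qed
    ultimately show ?thesis using len by (auto simp: shifted_diagram_def)
  qed
  ultimately show ?thesis using len by auto
qed

lemma shifted_diagram_subset_iff:
  assumes "length cs' = length cs"
  shows "shifted_diagram cs' \<subseteq> shifted_diagram cs \<longleftrightarrow> (\<forall>k<length cs. cs' ! k \<le> cs ! k)"
proof
  assume sub: "shifted_diagram cs' \<subseteq> shifted_diagram cs"
  show "\<forall>k<length cs. cs' ! k \<le> cs ! k"
  proof (intro allI impI)
    fix k assume k: "k < length cs"
    show "cs' ! k \<le> cs ! k"
    proof (cases "cs' ! k")
      case (Suc c)
      then have "(Suc k, Suc k + c) \<in> shifted_diagram cs'" using k assms by (simp add: mem_shifted_diagram)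
      then have "(Suc k, Suc k + c) \<in> shifted_diagram cs" using sub by blast
      then show ?thesis using Suc unfolding mem_shifted_diagram by simp
    qed simp
  qed
next
  assume le: "\<forall>k<length cs. cs' ! k \<le> cs ! k"
  have "(i, j) \<in> shifted_diagram cs" if ij: "(i, j) \<in> shifted_diagram cs'" for i j
  proof -
    obtain k where "i = Suc k" using shifted_diagram_pos[OF ij] by (cases i) auto
    then show ?thesis using ij le assms by (force simp: mem_shifted_diagram)
  qed
  then show "shifted_diagram cs' \<subseteq> shifted_diagram cs" by auto
qed

lemma shifted_diagram_inject:
  assumes "length cs = length cs'" "shifted_diagram cs = shifted_diagram cs'"
  shows "cs = cs'"
  using assms shifted_diagram_subset_iff[of cs cs'] shifted_diagram_subset_iff[of cs' cs]
  by (intro nth_equalityI) (auto intro: antisym)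

text \<open>Pushing \<open>cs\<close> one cell to the left must land in \<open>cs'\<close>. Together
  with containment this means that each row loses at most its last cell.\<close>

lemma shifted_diagram_shrink_row_iff:
  assumes "length cs' = length cs"
  shows "(\<forall>i j. (i, Suc j) \<in> shifted_diagram cs \<and> i \<le> j \<longrightarrow> (i, j) \<in> shifted_diagram cs') \<longleftrightarrow>
    (\<forall>k<length cs. cs ! k \<le> Suc (cs' ! k))" (is "?L \<longleftrightarrow> ?R")
proof
  assume L: ?L
  show ?R
  proof (intro allI impI)
    fix k assume k: "k < length cs"
    show "cs ! k \<le> Suc (cs' ! k)"
    proof (cases "cs ! k \<le> 1")
      case False
      then obtain c where c: "cs ! k = Suc (Suc c)" by (metis One_nat_def not0_implies_Suc not_less_eq_eq order_refl le0 le_SucI)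
      then have "(Suc k, Suc (Suc k + c)) \<in> shifted_diagram cs" using k by (simp add: mem_shifted_diagram)
      then have "(Suc k, Suc k + c) \<in> shifted_diagram cs'" using L by (meson le_add1)
      then show ?thesis using c unfolding mem_shifted_diagram by simp
    qed simp
  qed
next
  assume R: ?R
  show ?L
  proof (intro allI impI)
    fix i j assume ij: "(i, Suc j) \<in> shifted_diagram cs \<and> i \<le> j"
    then obtain k where "i = Suc k" using shifted_diagram_pos by (cases i) force+
    then show "(i, j) \<in> shifted_diagram cs'" using ij R assms by (force simp: mem_shifted_diagram)
  qed
qed

text \<open>The cell above any cell of \<open>cs\<close> must survive in \<open>cs'\<close>, so no
  column loses two cells. The inequality is strict because consecutive rows are shifted against each
  other by one.\<close>

lemma shifted_diagram_shrink_col_iff: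
  assumes "length cs' = length cs" "0 \<notin> set cs"
  shows "(\<forall>i j. (Suc i, j) \<in> shifted_diagram cs \<and> 1 \<le> i \<longrightarrow> (i, j) \<in> shifted_diagram cs') \<longleftrightarrow>
    (\<forall>k. Suc k < length cs \<longrightarrow> cs ! Suc k < cs' ! k)" (is "?L \<longleftrightarrow> ?R")
proof
  assume L: ?L
  show ?R
  proof (intro allI impI)
    fix k assume k: "Suc k < length cs"
    have "cs ! Suc k \<noteq> 0" using assms(2) nth_mem[OF k] by metis
    then obtain c where c: "cs ! Suc k = Suc c" using not0_implies_Suc by blast
    then have "(Suc (Suc k), Suc (Suc k) + c) \<in> shifted_diagram cs" using k by (simp add: mem_shifted_diagram)
    then have "(Suc k, Suc (Suc k) + c) \<in> shifted_diagram cs'" using L by simp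
    then show "cs ! Suc k < cs' ! k" using c unfolding mem_shifted_diagram by simp
  qed
next
  assume R: ?R
  show ?L
  proof (intro allI impI)
    fix i j assume ij: "(Suc i, j) \<in> shifted_diagram cs \<and> 1 \<le> i"
    then obtain k where "i = Suc k" by (cases i) auto
    then show "(i, j) \<in> shifted_diagram cs'" using ij R assms by (force simp: mem_shifted_diagram)
  qed
qed

lemma card_shifted_diagram: "card (shifted_diagram cs) = sum_list cs"
proof -
  have "shifted_diagram cs = (SIGMA i:{1..length cs}. {i..<i + cs ! (i - 1)})"
    by (auto simp: shifted_diagram_def)
  then have "card (shifted_diagram cs) = (\<Sum>i = 1..length cs. cs ! (i - 1))" by simp
  also have "\<dots> = (\<Sum>k<length cs. cs ! k)"
    by (rule sum.reindex_bij_witness[where i = Suc and j = "\<lambda>i. i - 1"]) auto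
  finally show ?thesis by (simp add: sum_list_sum_nth atLeast0LessThan)
qed

text \<open>In a strictly decreasing list only the last entry can be 0, so only the last diagonal
  cell can be missing.\<close>

lemma diag_shifted_diagram_iff:
  assumes "sorted_wrt (>) cs"
  shows "(i, i) \<in> shifted_diagram cs \<longleftrightarrow> 1 \<le> i \<and> i \<le> length cs \<and> (i = length cs \<longrightarrow> 0 \<notin> set cs)"
proof (cases "1 \<le> i \<and> i \<le> length cs")
  case True
  then obtain k where k: "i = Suc k" "k < length cs" by (cases i) auto
  have "cs ! k \<noteq> 0 \<longleftrightarrow> (i = length cs \<longrightarrow> 0 \<notin> set cs)"
  proof (cases "i = length cs")
    case True
    have "0 \<in> set cs \<longleftrightarrow> cs ! k = 0"
    proof
      assume "0 \<in> set cs"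
      then obtain us where "cs = us @ [0]" using dec_list_zero_last[OF assms] by metis
      then show "cs ! k = 0" using True k by simp
    qed (use k in \<open>metis nth_mem\<close>)
    then show ?thesis using True by simp
  next
    case False
    then have "cs ! k > cs ! Suc k" using sorted_wrt_nth_less[OF assms, of k "Suc k"] k by simp
    then show ?thesis using False by simp
  qed
  then show ?thesis using True k by (simp add: mem_shifted_diagram)
qed (auto simp: shifted_diagram_def)

section \<open>Young diagrams cut along the diagonal\<close>

definition young :: "(nat \<times> nat) set \<Rightarrow> bool" where
  "young D \<longleftrightarrow> finite D \<and> (\<forall>i j. (i, j) \<in> D \<longrightarrow> 1 \<le> i \<and> 1 \<le> j) \<and>
     (\<forall>i j. (i, Suc j) \<in> D \<and> 1 \<le> j \<longrightarrow> (i, j) \<in> D) \<and>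
     (\<forall>i j. (Suc i, j) \<in> D \<and> 1 \<le> i \<longrightarrow> (i, j) \<in> D)"

lemma youngI:
  assumes "finite D" "\<And>i j. (i, j) \<in> D \<Longrightarrow> 1 \<le> i \<and> 1 \<le> j"
    "\<And>i j. (i, Suc j) \<in> D \<Longrightarrow> 1 \<le> j \<Longrightarrow> (i, j) \<in> D"
    "\<And>i j. (Suc i, j) \<in> D \<Longrightarrow> 1 \<le> i \<Longrightarrow> (i, j) \<in> D"
  shows "young D"
  unfolding young_def by (metis assms)

lemma
  assumes "young D"
  shows young_finite: "finite D"
    and young_pos: "(i, j) \<in> D \<Longrightarrow> 1 \<le> i \<and> 1 \<le> j"
    and young_row: "(i, Suc j) \<in> D \<Longrightarrow> 1 \<le> j \<Longrightarrow> (i, j) \<in> D"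
    and young_col: "(Suc i, j) \<in> D \<Longrightarrow> 1 \<le> i \<Longrightarrow> (i, j) \<in> D"
  using assms unfolding young_def by blast+

text \<open>The Young diagram with Frobenius notation \<open>(cs\<^sub>1 - 1, \<dots> | es\<^sub>1 - 1, \<dots>)\<close>: its cells on or above the
  diagonal and its transposed cells on or below the diagonal are shifted diagrams.  A final 0 in both
  lists has no effect.\<close>

definition frob_diagram :: "nat list \<Rightarrow> nat list \<Rightarrow> (nat \<times> nat) set" where
  "frob_diagram cs es = {(i, j). (i, j) \<in> shifted_diagram cs \<or> (j, i) \<in> shifted_diagram es}"

text \<open>Both halves of a diagram contain its diagonal, so their last rows must be empty
  simultaneously.\<close>

definition frob_pair :: "nat list \<Rightarrow> nat list \<Rightarrow> bool" where
  "frob_pair cs es \<longleftrightarrow> sorted_wrt (>) cs \<and> sorted_wrt (>) es \<and> length cs = length es \<and>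
     (0 \<in> set cs \<longleftrightarrow> 0 \<in> set es)"

lemma frob_pair_diag:
  "frob_pair cs es \<Longrightarrow> (i, i) \<in> shifted_diagram cs \<longleftrightarrow> (i, i) \<in> shifted_diagram es"
  by (simp add: frob_pair_def diag_shifted_diagram_iff)

lemma frob_diagram_upper:
  "frob_pair cs es \<Longrightarrow> i \<le> j \<Longrightarrow> (i, j) \<in> frob_diagram cs es \<longleftrightarrow> (i, j) \<in> shifted_diagram cs"
  using shifted_diagram_pos[of j i es] frob_pair_diag[of cs es i] by (auto simp: frob_diagram_def)

lemma frob_diagram_lower:
  "frob_pair cs es \<Longrightarrow> j \<le> i \<Longrightarrow> (i, j) \<in> frob_diagram cs es \<longleftrightarrow> (j, i) \<in> shifted_diagram es"
  using shifted_diagram_pos[of i j cs] frob_pair_diag[of cs es i] by (auto simp: frob_diagram_def)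

text \<open>The assumption on the lengths excludes that the two pairs differ just by a final
  0.\<close>

lemma frob_diagram_eq_iff:
  assumes "frob_pair cs es" "frob_pair cs' es'" "length cs = length cs'"
  shows "frob_diagram cs es = frob_diagram cs' es' \<longleftrightarrow> cs = cs' \<and> es = es'"
proof
  assume eq: "frob_diagram cs es = frob_diagram cs' es'"
  have "(i, j) \<in> shifted_diagram cs \<longleftrightarrow> (i, j) \<in> shifted_diagram cs'" for i j
    using eq frob_diagram_upper[OF assms(1), of i j] frob_diagram_upper[OF assms(2), of i j]
      shifted_diagram_pos by (cases "i \<le> j") blast+
  moreover have "(i, j) \<in> shifted_diagram es \<longleftrightarrow> (i, j) \<in> shifted_diagram es'" for i j
    using eq frob_diagram_lower[OF assms(1), of i j] frob_diagram_lower[OF assms(2), of i j]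
      shifted_diagram_pos by (cases "i \<le> j") blast+
  ultimately have "shifted_diagram cs = shifted_diagram cs'" "shifted_diagram es = shifted_diagram es'"
    by auto
  then show "cs = cs' \<and> es = es'"
    using shifted_diagram_inject[of cs cs'] shifted_diagram_inject[of es es'] assms
    by (simp add: frob_pair_def)
qed simp

lemma young_frob_diagram:
  assumes "frob_pair cs es"
  shows "young (frob_diagram cs es)"
proof -
  have c: "shifted_ideal (shifted_diagram cs)" and e: "shifted_ideal (shifted_diagram es)"
    using assms by (auto simp: frob_pair_def intro: shifted_ideal_shifted_diagram)
  have "finite (frob_diagram cs es)"
    by (rule finite_subset[of _ "shifted_diagram cs \<union> (\<lambda>(i, j). (j, i)) ` shifted_diagram es"])
       (auto simp: frob_diagram_def image_iff)
  moreover have "(i, j) \<in> frob_diagram cs es" if "(i, Suc j) \<in> frob_diagram cs es" "1 \<le> j" for i j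
  proof (cases "i \<le> j")
    case True
    then show ?thesis using that shifted_ideal_row[OF c] by (simp add: frob_diagram_upper[OF assms])
  next
    case False
    then show ?thesis using that shifted_ideal_col[OF e] by (simp add: frob_diagram_lower[OF assms])
  qed
  moreover have "(i, j) \<in> frob_diagram cs es" if "(Suc i, j) \<in> frob_diagram cs es" "1 \<le> i" for i j
  proof (cases "j \<le> i")
    case True
    then show ?thesis using that shifted_ideal_row[OF e] by (simp add: frob_diagram_lower[OF assms])
  next
    case False
    then show ?thesis using that shifted_ideal_col[OF c] by (simp add: frob_diagram_upper[OF assms])
  qed
  moreover have "1 \<le> i \<and> 1 \<le> j" if "(i, j) \<in> frob_diagram cs es" for i j
    using that shifted_diagram_pos[of i j cs] shifted_diagram_pos[of j i es] by (auto simp: frob_diagram_def)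
  ultimately show ?thesis by (intro youngI)
qed

text \<open>As for shifted diagrams, \<open>d\<close> may exceed the number of diagonal cells by
  one. Both lists then end in 0.\<close>

lemma ex_frob_diagram:
  assumes D: "young D" and le: "\<And>i. (i, i) \<in> D \<Longrightarrow> i \<le> d"
    and ge: "\<And>i. 1 \<le> i \<Longrightarrow> i < d \<Longrightarrow> (i, i) \<in> D"
  shows "\<exists>cs es. frob_pair cs es \<and> length cs = d \<and> frob_diagram cs es = D"
proof -
  note fin = young_finite[OF D] and pos = young_pos[OF D] and row = young_row[OF D] and col = young_col[OF D]
  define U where "U = {(i, j) \<in> D. i \<le> j}"
  define L where "L = {(i, j). (j, i) \<in> D \<and> i \<le> j}"
  have "finite U" by (rule finite_subset[OF _ fin]) (auto simp: U_def)
  then have U: "shifted_ideal U"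
  proof (rule shifted_idealI)
    show "1 \<le> i \<and> i \<le> j" if "(i, j) \<in> U" for i j using that pos[of i j] unfolding U_def by simp
    show "(i, j) \<in> U" if "(i, Suc j) \<in> U" "i \<le> j" for i j
      using that row[of i j] pos[of i "Suc j"] unfolding U_def by simp
    show "(i, j) \<in> U" if "(Suc i, j) \<in> U" "1 \<le> i" for i j
      using that col[of i j] unfolding U_def by simp
  qed
  have "finite L"
    by (rule finite_subset[of _ "(\<lambda>(i, j). (j, i)) ` D"]) (use fin in \<open>auto simp: L_def image_iff\<close>)
  then have L: "shifted_ideal L"
  proof (rule shifted_idealI)
    show "1 \<le> i \<and> i \<le> j" if "(i, j) \<in> L" for i j using that pos[of j i] unfolding L_def by simp
    show "(i, j) \<in> L" if "(i, Suc j) \<in> L" "i \<le> j" for i j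
      using that col[of j i] pos[of "Suc j" i] unfolding L_def by simp
    show "(i, j) \<in> L" if "(Suc i, j) \<in> L" "1 \<le> i" for i j
      using that row[of j i] unfolding L_def by simp
  qed
  have "\<exists>cs. sorted_wrt (>) cs \<and> length cs = d \<and> shifted_diagram cs = U"
  proof (rule ex_shifted_diagram[OF U])
    show "i \<le> d" if "(i, i) \<in> U" for i using that le[of i] by (simp add: U_def)
    show "(i, i) \<in> U" if "1 \<le> i" "i < d" for i using that ge[of i] by (simp add: U_def)
  qed
  then obtain cs where cs: "sorted_wrt (>) cs" "length cs = d" "shifted_diagram cs = U" by blast
  have "\<exists>es. sorted_wrt (>) es \<and> length es = d \<and> shifted_diagram es = L"
  proof (rule ex_shifted_diagram[OF L])
    show "i \<le> d" if "(i, i) \<in> L" for i using that le[of i] by (simp add: L_def)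
    show "(i, i) \<in> L" if "1 \<le> i" "i < d" for i using that ge[of i] by (simp add: L_def)
  qed
  then obtain es where es: "sorted_wrt (>) es" "length es = d" "shifted_diagram es = L" by blast
  have "0 \<in> set cs \<longleftrightarrow> 0 \<in> set es"
  proof (cases "d = 0")
    case False
    have "(d, d) \<in> U \<longleftrightarrow> (d, d) \<in> L" by (auto simp: U_def L_def)
    then show ?thesis
      using diag_shifted_diagram_iff[OF cs(1), of d] diag_shifted_diagram_iff[OF es(1), of d] cs es False
      by simp
  qed (use cs es in simp)
  moreover have "frob_diagram cs es = D"
    using cs es by (auto simp: frob_diagram_def U_def L_def)
  ultimately have "frob_pair cs es \<and> length cs = d \<and> frob_diagram cs es = D"
    using cs es by (simp add: frob_pair_def)
  then show ?thesis by blast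
qed

text \<open>The diagonal is counted with \<open>cs\<close>, so each row of \<open>es\<close>
  contributes one cell less. For a final 0, truncated subtraction gives the right value 0.\<close>

lemma card_frob_diagram:
  assumes "frob_pair cs es"
  shows "card (frob_diagram cs es) = sum_list cs + (\<Sum>e\<leftarrow>es. e - 1)"
proof -
  let ?es = "map (\<lambda>e. e - 1) es"
  \<comment> \<open>The rows of \<open>es\<close> without their diagonal cells; \<open>?g\<close>
    transposes them and puts them strictly below the diagonal.\<close>
  have eq: "frob_diagram cs es = shifted_diagram cs \<union> (\<lambda>(i, j). (Suc j, i)) ` shifted_diagram ?es" (is "_ = _ \<union> ?g ` _")
  proof (intro equalityI subsetI)
    fix x assume x: "x \<in> frob_diagram cs es"
    obtain i j where ij: "x = (i, j)" by (cases x)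
    show "x \<in> shifted_diagram cs \<union> ?g ` shifted_diagram ?es"
    proof (cases "i \<le> j")
      case True
      then show ?thesis using x ij assms by (simp add: frob_diagram_upper)
    next
      case False
      then have mem: "(j, i) \<in> shifted_diagram es" using x ij assms by (simp add: frob_diagram_lower)
      then obtain k where k: "j = Suc k" using shifted_diagram_pos by (cases j) force+
      have "(j, i - 1) \<in> shifted_diagram ?es" using mem False unfolding k mem_shifted_diagram by auto
      moreover have "x = ?g (j, i - 1)" using ij False by simp
      ultimately show ?thesis by blast
    qed
  next
    fix x assume "x \<in> shifted_diagram cs \<union> ?g ` shifted_diagram ?es"
    then consider "x \<in> shifted_diagram cs" | i j where "(i, j) \<in> shifted_diagram ?es" "x = (Suc j, i)" by auto
    then show "x \<in> frob_diagram cs es"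
    proof cases
      case 2
      then obtain k where k: "i = Suc k" using shifted_diagram_pos by (cases i) force+
      have "(i, Suc j) \<in> shifted_diagram es" using 2(1) unfolding k mem_shifted_diagram by auto
      then show ?thesis using 2 by (simp add: frob_diagram_def)
    qed (auto simp: frob_diagram_def)
  qed
  have "card (?g ` shifted_diagram ?es) = sum_list ?es"
    by (subst card_image) (auto simp: inj_on_def card_shifted_diagram)
  moreover have "shifted_diagram cs \<inter> ?g ` shifted_diagram ?es = {}"
    by (auto dest!: shifted_diagram_pos)
  ultimately show ?thesis
    unfolding eq by (subst card_Un_disjoint) (auto simp: card_shifted_diagram)
qed

section \<open>Partitions as Young diagrams, conjugation and Frobenius notation\<close>

lemma diagram_iff: "(i, j) \<in> diagram \<mu> \<longleftrightarrow> 1 \<le> i \<and> 1 \<le> j \<and> j \<le> part \<mu> i"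
  by (auto simp: diagram_def part_def split: if_splits)

lemma part_antimono:
  assumes "is_partition \<mu>" "1 \<le> i" "i \<le> i'"
  shows "part \<mu> i' \<le> part \<mu> i"
proof (cases "i = i' \<or> length \<mu> < i'")
  case False
  then show ?thesis
    using assms sorted_wrt_nth_less[of "(\<ge>)" \<mu> "i - 1" "i' - 1"] by (auto simp: part_def is_partition_def)
qed (auto simp: part_def)

lemma part_pos_iff:
  assumes "is_partition \<mu>" "1 \<le> i"
  shows "1 \<le> part \<mu> i \<longleftrightarrow> i \<le> length \<mu>"
proof (cases "i \<le> length \<mu>")
  case True
  then have "\<mu> ! (i - 1) \<in> set \<mu>" using assms(2) by (intro nth_mem) linarith
  then have "\<mu> ! (i - 1) \<noteq> 0" using assms(1) by (metis is_partition_def)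
  then show ?thesis using True assms(2) by (simp add: part_def)
qed (simp add: part_def)

lemma young_diagram:
  assumes "is_partition \<mu>"
  shows "young (diagram \<mu>)"
proof (rule youngI)
  show "finite (diagram \<mu>)"
    by (rule finite_subset[of _ "SIGMA i:{1..length \<mu>}. {1..part \<mu> i}"]) (auto simp: diagram_def)
  show "(i, j) \<in> diagram \<mu>" if "(Suc i, j) \<in> diagram \<mu>" "1 \<le> i" for i j
    using that part_antimono[OF assms, of i "Suc i"] by (auto simp: diagram_iff)
qed (auto simp: diagram_iff)

lemma diagram_inject:
  assumes "is_partition \<mu>" "is_partition \<nu>" "diagram \<mu> = diagram \<nu>"
  shows "\<mu> = \<nu>"
proof -
  have part: "part \<mu> i = part \<nu> i" if "1 \<le> i" for i
  proof -
    have "j \<le> part \<mu> i \<longleftrightarrow> j \<le> part \<nu> i" if "1 \<le> j" for j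
      using that \<open>1 \<le> i\<close> diagram_iff[of i j \<mu>] diagram_iff[of i j \<nu>] assms(3) by simp
    then show ?thesis by (metis One_nat_def Suc_leI antisym le_zero_eq linorder_not_le nle_le not_gr_zero)
  qed
  have "i \<le> length \<mu> \<longleftrightarrow> i \<le> length \<nu>" if "1 \<le> i" for i
    using part_pos_iff[OF assms(1) that] part_pos_iff[OF assms(2) that] part[OF that] by simp
  then have len: "length \<mu> = length \<nu>" by (metis One_nat_def Suc_leI antisym le_zero_eq linorder_not_le nle_le not_gr_zero)
  show ?thesis
  proof (rule nth_equalityI[OF len])
    fix k assume "k < length \<mu>"
    then show "\<mu> ! k = \<nu> ! k" using part[of "Suc k"] len by (simp add: part_def)
  qed
qed

lemma ex_partition:
  assumes "young D"
  shows "\<exists>\<mu>. is_partition \<mu> \<and> diagram \<mu> = D"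
proof -
  define R where "R i = {j. (i, j) \<in> D}" for i
  define C where "C = {i. (i, 1) \<in> D}"
  define \<mu> where "\<mu> = map (\<lambda>i. card (R i)) [1..<card C + 1]"
  have finR: "finite (R i)" for i
    by (rule finite_subset[of _ "snd ` D"]) (use young_finite[OF assms] in \<open>force simp: R_def\<close>)+
  have finC: "finite C"
    by (rule finite_subset[of _ "fst ` D"]) (use young_finite[OF assms] in \<open>force simp: C_def\<close>)+
  have "R i = {1..<1 + card (R i)}" for i
    by (rule initial_segment[OF finR])
       (use young_pos[OF assms, of i] young_row[OF assms, of i] in \<open>auto simp: R_def\<close>)
  then have R: "(i, j) \<in> D \<longleftrightarrow> 1 \<le> j \<and> j \<le> card (R i)" for i j
    by (metis (no_types) R_def atLeastLessThan_iff less_Suc_eq_le mem_Collect_eq plus_1_eq_Suc)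
  have "C = {1..<1 + card C}"
    by (rule initial_segment[OF finC]) (use young_pos[OF assms, of _ 1] young_col[OF assms, of _ 1] in \<open>auto simp: C_def\<close>)
  then have C: "i \<in> C \<longleftrightarrow> 1 \<le> i \<and> i \<le> card C" for i
    by (metis atLeastLessThan_iff less_Suc_eq_le plus_1_eq_Suc)
  have C': "i \<in> C \<longleftrightarrow> 1 \<le> card (R i)" for i using R[of i 1] by (simp add: C_def)
  have len: "length \<mu> = card C" by (simp add: \<mu>_def)
  have nth: "\<mu> ! k = card (R (Suc k))" if "k < card C" for k
    using that unfolding \<mu>_def by (subst nth_map) (auto simp del: upt_Suc)
  have mono: "card (R (Suc i)) \<le> card (R i)" if "1 \<le> i" for i
    by (rule card_mono[OF finR]) (use young_col[OF assms, of i] that in \<open>auto simp: R_def\<close>)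
  have "sorted_wrt (\<ge>) \<mu>"
    by (subst sorted_wrt_iff_nth_Suc_transp) (simp_all add: len nth mono transp_def)
  moreover have "0 \<notin> set \<mu>"
  proof
    assume "0 \<in> set \<mu>"
    then obtain k where "k < card C" "card (R (Suc k)) = 0"
      using nth len by (metis in_set_conv_nth)
    then show False using C[of "Suc k"] C'[of "Suc k"] by simp
  qed
  ultimately have p: "is_partition \<mu>" by (simp add: is_partition_def)
  have "(i, j) \<in> diagram \<mu> \<longleftrightarrow> (i, j) \<in> D" for i j
  proof (cases "1 \<le> i \<and> i \<le> card C")
    case True
    then have "i - 1 < card C" "Suc (i - 1) = i" by auto
    then have "\<mu> ! (i - 1) = card (R i)" using nth[of "i - 1"] by simp
    then show ?thesis using True len R[of i j] by (simp add: diagram_def part_def)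
  next
    case False
    then have "i \<notin> C" using C by blast
    then have "(i, j) \<notin> D" using C'[of i] R[of i j] by auto
    then show ?thesis using False len by (auto simp: diagram_def)
  qed
  then show ?thesis using p by auto
qed

text \<open>The partition with the transposed diagram exists abstractly; comparing lengths and parts
  identifies it with the list that defines the conjugate.\<close>

lemma conj_partition_diagram:
  assumes \<mu>: "is_partition \<mu>"
  shows "is_partition (conj_partition \<mu>)" "diagram (conj_partition \<mu>) = {(i, j). (j, i) \<in> diagram \<mu>}"
proof -
  let ?D = "{(i, j). (j, i) \<in> diagram \<mu>}"
  have y: "young (diagram \<mu>)" by (rule young_diagram[OF \<mu>])
  have "young ?D"
  proof (rule youngI)
    show "finite ?D"
      by (rule finite_subset[of _ "(\<lambda>(i, j). (j, i)) ` diagram \<mu>"])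
         (use young_finite[OF y] in \<open>auto simp: image_iff\<close>)
    show "(i, j) \<in> ?D" if "(i, Suc j) \<in> ?D" "1 \<le> j" for i j
      using that young_col[OF y, of j i] by simp
    show "(i, j) \<in> ?D" if "(Suc i, j) \<in> ?D" "1 \<le> i" for i j
      using that young_row[OF y, of j i] by simp
  qed (auto simp: diagram_iff)
  then obtain \<nu> where \<nu>: "is_partition \<nu>" "diagram \<nu> = ?D" using ex_partition by metis
  have part: "part \<nu> j = card {i. 1 \<le> i \<and> i \<le> length \<mu> \<and> j \<le> part \<mu> i}" if "1 \<le> j" for j
  proof -
    have "{i. (j, i) \<in> diagram \<nu>} = {1..part \<nu> j}" using that by (auto simp: diagram_iff)
    moreover have "{i. (j, i) \<in> diagram \<nu>} = {i. 1 \<le> i \<and> i \<le> length \<mu> \<and> j \<le> part \<mu> i}"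
      unfolding \<nu>(2) using that by (auto simp: diagram_def)
    ultimately show ?thesis by (metis card_atLeastAtMost diff_Suc_1 plus_1_eq_Suc One_nat_def)
  qed
  have len: "length \<nu> = part \<mu> 1"
  proof -
    have "i \<le> length \<nu> \<longleftrightarrow> i \<le> part \<mu> 1" if "1 \<le> i" for i
    proof -
      have "i \<le> length \<nu> \<longleftrightarrow> (i, 1) \<in> diagram \<nu>"
        using part_pos_iff[OF \<nu>(1) that] that by (simp add: diagram_iff)
      also have "\<dots> \<longleftrightarrow> i \<le> part \<mu> 1" unfolding \<nu>(2) using that by (simp add: diagram_iff)
      finally show ?thesis .
    qed
    then show ?thesis by (metis One_nat_def Suc_leI antisym le_zero_eq linorder_not_le nle_le not_gr_zero)
  qed
  have "conj_partition \<mu> = \<nu>"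
  proof (rule nth_equalityI)
    fix k assume "k < length (conj_partition \<mu>)"
    then have k: "k < part \<mu> 1" by (simp add: conj_partition_def del: upt_Suc)
    then have "conj_partition \<mu> ! k = part \<nu> (Suc k)"
      unfolding conj_partition_def part[of "Suc k", simplified] by (subst nth_map) (auto simp del: upt_Suc)
    then show "conj_partition \<mu> ! k = \<nu> ! k" using k len by (simp add: part_def)
  qed (simp add: conj_partition_def len del: upt_Suc)
  then show "is_partition (conj_partition \<mu>)" "diagram (conj_partition \<mu>) = ?D" using \<nu> by auto
qed

lemma frob_pair_sym: "frob_pair cs es \<Longrightarrow> frob_pair es cs"
  by (auto simp: frob_pair_def)

lemma frob_diagram_transpose: "{(i, j). (j, i) \<in> frob_diagram cs es} = frob_diagram es cs"
  by (auto simp: frob_diagram_def)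

text \<open>Row \<open>Suc k\<close> has \<open>k\<close> cells to the left of the diagonal; the
  remaining ones are counted by \<open>cs ! k\<close>.\<close>

lemma part_frob_diagram:
  assumes "frob_pair cs es" "0 \<notin> set cs" "diagram \<mu> = frob_diagram cs es" "k < length cs"
  shows "part \<mu> (Suc k) = k + cs ! k"
proof -
  have "cs ! k \<noteq> 0" using assms(2,4) by (metis nth_mem)
  then have "(Suc k, k + cs ! k) \<in> diagram \<mu>" "(Suc k, Suc k + cs ! k) \<notin> diagram \<mu>"
    unfolding assms(3) using assms(4)
    by (simp_all add: frob_diagram_upper[OF assms(1)] mem_shifted_diagram)
  then show ?thesis by (auto simp: diagram_iff)
qed

lemma frobenius_frob_diagram:
  assumes \<mu>: "is_partition \<mu>" and p: "frob_pair cs es" "0 \<notin> set cs" and D: "diagram \<mu> = frob_diagram cs es"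
  shows "frobenius \<mu> = (map (\<lambda>c. c - 1) cs, map (\<lambda>e. e - 1) es)"
proof -
  have len: "length cs = length es" and es: "0 \<notin> set es" using p by (auto simp: frob_pair_def)
  \<comment> \<open>The Durfee condition at \<open>d\<close> says that the cell (\<open>d\<close>,
    \<open>d\<close>) is present. It holds for \<open>d = 0\<close> as well, so the maximum is taken
    over a nonempty set.\<close>
  have "d \<le> length \<mu> \<and> d \<le> part \<mu> d \<longleftrightarrow> d \<le> length cs" for d
  proof (cases "d = 0")
    case False
    have "d \<le> length \<mu> \<and> d \<le> part \<mu> d \<longleftrightarrow> (d, d) \<in> diagram \<mu>"
      using False part_pos_iff[OF \<mu>, of d] by (auto simp: diagram_iff)
    also have "\<dots> \<longleftrightarrow> d \<le> length cs"
      unfolding D using False p by (simp add: frob_diagram_upper diag_shifted_diagram_iff frob_pair_def)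
    finally show ?thesis .
  qed simp
  then have "durfee \<mu> = Max {..length cs}" unfolding durfee_def by (intro arg_cong[of _ _ Max]) auto
  also have "\<dots> = length cs" by (rule Max_eqI) auto
  finally have d: "durfee \<mu> = length cs" .
  have "diagram (conj_partition \<mu>) = frob_diagram es cs"
    using conj_partition_diagram(2)[OF \<mu>] D frob_diagram_transpose by simp
  then have pc: "part (conj_partition \<mu>) (Suc k) = k + es ! k" if "k < length es" for k
    using part_frob_diagram[OF frob_pair_sym[OF p(1)] es] that by simp
  have pm: "part \<mu> (Suc k) = k + cs ! k" if "k < length cs" for k
    by (rule part_frob_diagram[OF p D that])
  have "map (\<lambda>i. part \<mu> i - i) [1..<length cs + 1] = map (\<lambda>c. c - 1) cs"
    by (rule nth_equalityI) (simp_all add: pm del: upt_Suc)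
  moreover have "map (\<lambda>i. part (conj_partition \<mu>) i - i) [1..<length cs + 1] = map (\<lambda>e. e - 1) es"
    by (rule nth_equalityI) (simp_all add: pc len del: upt_Suc)
  ultimately show ?thesis by (simp add: frobenius_def d del: upt_Suc)
qed

lemma partition_frob_pair:
  assumes "is_partition \<mu>"
  obtains cs es where "frob_pair cs es" "0 \<notin> set cs" "diagram \<mu> = frob_diagram cs es"
proof -
  have y: "young (diagram \<mu>)" by (rule young_diagram[OF assms])
  define C where "C = {i. (i, i) \<in> diagram \<mu>}"
  have "finite C" by (rule finite_subset[of _ "fst ` diagram \<mu>"]) (use young_finite[OF y] in \<open>force simp: C_def\<close>)+
  then have "C = {1..<1 + card C}"
  proof (rule initial_segment)
    show "1 \<le> j" if "j \<in> C" for j using that young_pos[OF y, of j j] by (simp add: C_def)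
    show "j \<in> C" if "Suc j \<in> C" "1 \<le> j" for j
      using that young_row[OF y, of "Suc j" j] young_col[OF y, of j j] by (simp add: C_def)
  qed
  then have C: "(i, i) \<in> diagram \<mu> \<longleftrightarrow> 1 \<le> i \<and> i \<le> card C" for i
    by (metis (no_types) C_def atLeastLessThan_iff less_Suc_eq_le mem_Collect_eq plus_1_eq_Suc)
  obtain cs es where p: "frob_pair cs es" "length cs = card C" "frob_diagram cs es = diagram \<mu>"
    using ex_frob_diagram[OF y, of "card C"] C by (metis less_imp_le)
  have "0 \<notin> set cs"
  proof (cases "card C = 0")
    case False
    then have "(card C, card C) \<in> shifted_diagram cs"
      using C[of "card C"] p by (simp add: frob_diagram_upper[OF p(1), symmetric])
    then show ?thesis using p by (simp add: diag_shifted_diagram_iff frob_pair_def)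
  qed (use p in simp)
  then show thesis using that p by metis
qed

lemma frob_pair_pred_inject:
  assumes "map (\<lambda>c. c - 1) cs = map (\<lambda>c. c - 1) (cs' :: nat list)" "0 \<notin> set cs" "0 \<notin> set cs'"
  shows "cs = cs'"
proof (rule map_inj_on[OF assms(1)])
  show "inj_on (\<lambda>c. c - 1) (set cs \<union> set cs')"
    using assms by (intro inj_onI) (metis UnE diff_Suc_1 not0_implies_Suc)
qed

text \<open>Resolves the definite description: the diagram built from the coordinates belongs to
  some partition, and the coordinates of any other candidate determine the same diagram.\<close>

lemma of_frobenius_diagram:
  assumes p: "frob_pair cs es" "0 \<notin> set cs"
  shows "is_partition (of_frobenius (map (\<lambda>c. c - 1) cs) (map (\<lambda>e. e - 1) es))"
    "diagram (of_frobenius (map (\<lambda>c. c - 1) cs) (map (\<lambda>e. e - 1) es)) = frob_diagram cs es"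
proof -
  obtain \<mu> where \<mu>: "is_partition \<mu>" "diagram \<mu> = frob_diagram cs es"
    using ex_partition[OF young_frob_diagram[OF p(1)]] by blast
  have "of_frobenius (map (\<lambda>c. c - 1) cs) (map (\<lambda>e. e - 1) es) = \<mu>"
    unfolding of_frobenius_def
  proof (rule the_equality)
    show "is_partition \<mu> \<and> frobenius \<mu> = (map (\<lambda>c. c - 1) cs, map (\<lambda>e. e - 1) es)"
      using \<mu> frobenius_frob_diagram[OF \<mu>(1) p \<mu>(2)] by simp
    fix \<nu> assume \<nu>: "is_partition \<nu> \<and> frobenius \<nu> = (map (\<lambda>c. c - 1) cs, map (\<lambda>e. e - 1) es)"
    then obtain cs' es' where p': "frob_pair cs' es'" "0 \<notin> set cs'" "diagram \<nu> = frob_diagram cs' es'"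
      using partition_frob_pair by metis
    have "frobenius \<nu> = (map (\<lambda>c. c - 1) cs', map (\<lambda>e. e - 1) es')"
      using frobenius_frob_diagram \<nu> p' by blast
    then have "cs' = cs" "es' = es"
      using \<nu> p p' frob_pair_pred_inject[of cs' cs] frob_pair_pred_inject[of es' es]
      by (simp_all add: frob_pair_def)
    then show "\<nu> = \<mu>" using diagram_inject \<nu> \<mu> p' by simp
  qed
  then show "is_partition (of_frobenius (map (\<lambda>c. c - 1) cs) (map (\<lambda>e. e - 1) es))"
    "diagram (of_frobenius (map (\<lambda>c. c - 1) cs) (map (\<lambda>e. e - 1) es)) = frob_diagram cs es"
    using \<mu> by auto
qed

section \<open>Schur functions and Giambelli's formula\<close>

lemma mvps_coeff_simps [simp]:
  "mvps_coeff (0 :: 'a::comm_ring_1 mvps) M = 0"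
  "mvps_coeff (f + g) M = mvps_coeff f M + mvps_coeff (g :: 'a mvps) M"
  by (transfer; simp)+

lemma mvps_coeff_1: "mvps_coeff (1 :: 'a::comm_ring_1 mvps) M = (if M = {#} then 1 else 0)"
  by transfer simp

lemma mvps_coeff_mult:
  "mvps_coeff (f * g :: 'a::comm_ring_1 mvps) M = (\<Sum>N | N \<subseteq># M. mvps_coeff f N * mvps_coeff g (M - N))"
  by transfer simp

lemma mvps_coeff_sum: "mvps_coeff (\<Sum>x\<in>A. f x :: 'a::comm_ring_1 mvps) M = (\<Sum>x\<in>A. mvps_coeff (f x) M)"
  by (induction A rule: infinite_finite_induct) simp_all

lemma mvps_coeff_Abs [simp]: "mvps_coeff (Abs_mvps f) = f"
  by (simp add: Abs_mvps_inverse)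

lift_definition mvps_monom :: "nat multiset \<Rightarrow> 'a::comm_ring_1 mvps" is "\<lambda>M N. if N = M then 1 else 0" .

lemma mvps_coeff_monom: "mvps_coeff (mvps_monom M) N = (if N = M then 1 else 0)"
  by transfer simp

lemma mvps_coeff_monom_mult:
  "mvps_coeff (mvps_monom M * f :: 'a::comm_ring_1 mvps) N = (if M \<subseteq># N then mvps_coeff f (N - M) else 0)"
proof -
  have "mvps_coeff (mvps_monom M * f) N = (\<Sum>K | K \<subseteq># N. if K = M then mvps_coeff f (N - M) else 0)"
    unfolding mvps_coeff_mult by (intro sum.cong) (auto simp: mvps_coeff_monom)
  then show ?thesis by (simp add: sum.delta finite_submultisets)
qed

lemma mvps_monom_add: "mvps_monom (M + N) = (mvps_monom M * mvps_monom N :: 'a::comm_ring_1 mvps)"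
  unfolding mvps_eq_iff mvps_coeff_monom_mult mvps_coeff_monom
  by (auto simp: subset_mset.add_diff_inverse)

lemma mvps_monom_empty: "mvps_monom {#} = (1 :: 'a::comm_ring_1 mvps)"
  by (simp add: mvps_eq_iff mvps_coeff_monom mvps_coeff_1)

lemma mvps_monom_replicate: "mvps_monom (replicate_mset k m) = (mvps_monom {#m#} ^ k :: 'a::comm_ring_1 mvps)"
proof (induction k)
  case (Suc k)
  have "mvps_monom (replicate_mset (Suc k) m) = (mvps_monom ({#m#} + replicate_mset k m) :: 'a mvps)" by simp
  then show ?case using Suc by (simp only: mvps_monom_add power_Suc)
qed (simp add: mvps_monom_empty)

text \<open>Specialization of the variables with index at least \<open>m\<close> to 0.\<close>

lift_definition mvps_trunc :: "nat \<Rightarrow> 'a::comm_ring_1 mvps \<Rightarrow> 'a mvps"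
  is "\<lambda>m f M. if set_mset M \<subseteq> {..<m} then f M else 0" .

lemma mvps_coeff_trunc: "mvps_coeff (mvps_trunc m f) M = (if set_mset M \<subseteq> {..<m} then mvps_coeff f M else 0)"
  by transfer simp

text \<open>Each coefficient involves only finitely many variables.\<close>

lemma mvps_eqI_trunc:
  assumes "\<And>m. mvps_trunc m f = mvps_trunc m g"
  shows "f = g"
  unfolding mvps_eq_iff
proof
  fix M :: "nat multiset"
  \<comment> \<open>For the empty monomial \<open>Max\<close> is unspecified, but then the inclusion
    is trivial.\<close>
  have "set_mset M \<subseteq> {..<Suc (Max (set_mset M))}" by (auto simp: less_Suc_eq_le)
  then show "mvps_coeff f M = mvps_coeff g M"
    using assms[of "Suc (Max (set_mset M))"] mvps_coeff_trunc by metis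
qed

interpretation mvps_trunc: comm_ring_hom "mvps_trunc m :: 'a::comm_ring_1 mvps \<Rightarrow> 'a mvps"
proof
  fix f g :: "'a mvps"
  show "mvps_trunc m (f * g) = mvps_trunc m f * mvps_trunc m g"
    unfolding mvps_eq_iff
  proof
    fix M
    show "mvps_coeff (mvps_trunc m (f * g)) M = mvps_coeff (mvps_trunc m f * mvps_trunc m g) M"
    proof (cases "set_mset M \<subseteq> {..<m}")
      case True
      then have "set_mset N \<subseteq> {..<m}" "set_mset (M - N) \<subseteq> {..<m}" if "N \<subseteq># M" for N
        using set_mset_mono[OF that] in_diffD[of _ M N] by auto
      then show ?thesis using True
        by (auto simp: mvps_coeff_trunc mvps_coeff_mult intro!: sum.cong)
    next
      case False
      \<comment> \<open>A forbidden variable of a product monomial occurs in one of its two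
        factors.\<close>
      have "mvps_coeff (mvps_trunc m f) N * mvps_coeff (mvps_trunc m g) (M - N) = 0" if "N \<subseteq># M" for N
      proof -
        have "set_mset M = set_mset N \<union> set_mset (M - N)"
          using that by (metis set_mset_union subset_mset.add_diff_inverse)
        then have "\<not> set_mset N \<subseteq> {..<m} \<or> \<not> set_mset (M - N) \<subseteq> {..<m}" using False by blast
        then show ?thesis by (auto simp: mvps_coeff_trunc)
      qed
      then show ?thesis using False by (simp add: mvps_coeff_trunc mvps_coeff_mult)
    qed
  qed
qed (simp_all add: mvps_eq_iff mvps_coeff_trunc mvps_coeff_1)

text \<open>Indexed by sets of cells instead of partitions, because the recursion on the number of
  variables cuts down the set of cells. The entries are \<open>0, ..., m - 1\<close>.\<close>

definition tableaux :: "nat \<Rightarrow> (nat \<times> nat) set \<Rightarrow> (nat \<times> nat \<Rightarrow> nat) set" where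
  "tableaux m D = {T \<in> extensional D. (\<forall>c\<in>D. T c < m) \<and>
     (\<forall>i j. (i, j) \<in> D \<and> (i, j + 1) \<in> D \<longrightarrow> T (i, j) \<le> T (i, j + 1)) \<and>
     (\<forall>i j. (i, j) \<in> D \<and> (i + 1, j) \<in> D \<longrightarrow> T (i, j) < T (i + 1, j))}"

definition schur_poly :: "nat \<Rightarrow> (nat \<times> nat) set \<Rightarrow> 'a::comm_ring_1 mvps" where
  "schur_poly m D = (\<Sum>T\<in>tableaux m D. mvps_monom (image_mset T (mset_set D)))"

lemma finite_tableaux: "finite D \<Longrightarrow> finite (tableaux m D)"
  by (rule finite_subset[OF _ finite_PiE[of D "\<lambda>_. {..<m}"]]) (auto simp: tableaux_def PiE_def)

lemma finite_diagram: "finite (diagram \<mu>)"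
  by (rule finite_subset[of _ "SIGMA i:{1..length \<mu>}. {1..part \<mu> i}"]) (auto simp: diagram_def)

lemma mvps_trunc_schur: "mvps_trunc m (schur \<mu> :: 'a::comm_ring_1 mvps) = schur_poly m (diagram \<mu>)"
  unfolding mvps_eq_iff
proof
  fix M
  let ?D = "diagram \<mu>"
  let ?c = "\<lambda>T. image_mset T (mset_set ?D)"
  have "mvps_coeff (schur_poly m ?D :: 'a mvps) M = (\<Sum>T\<in>tableaux m ?D. if M = ?c T then 1 else 0)"
    by (simp add: schur_poly_def mvps_coeff_sum mvps_coeff_monom)
  also have "\<dots> = of_nat (card {T \<in> tableaux m ?D. M = ?c T})"
    by (simp add: finite_tableaux finite_diagram sum.If_cases Int_def)
  also have "\<dots> = mvps_coeff (mvps_trunc m (schur \<mu>)) M"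
  proof (cases "set_mset M \<subseteq> {..<m}")
    case True
    have "T c < m" if "?c T = M" "c \<in> ?D" for T c
    proof -
      have "T c \<in># ?c T" using that(2) finite_diagram by auto
      then show ?thesis using True that(1) by auto
    qed
    then have "{T \<in> tableaux m ?D. M = ?c T} = {T \<in> ssyt \<mu>. ssyt_content \<mu> T = M}"
      by (auto simp: tableaux_def ssyt_def ssyt_content_def)
    then show ?thesis using True by (simp add: mvps_coeff_trunc schur_def)
  next
    case False
    have "M \<noteq> ?c T" if "T \<in> tableaux m ?D" for T
      using False that finite_diagram by (auto simp: tableaux_def)
    then have "{T \<in> tableaux m ?D. M = ?c T} = {}" by blast
    then have "card {T \<in> tableaux m ?D. M = ?c T} = 0" by (metis card.empty)
    then show ?thesis using False by (simp add: mvps_coeff_trunc del: card_eq_0_iff)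
  qed
  finally show "mvps_coeff (mvps_trunc m (schur \<mu> :: 'a mvps)) M = mvps_coeff (schur_poly m ?D) M" by simp
qed

lemma schur_poly_empty [simp]: "schur_poly m {} = 1"
proof -
  have "tableaux m {} = {\<lambda>_. undefined}" by (auto simp: tableaux_def)
  then show ?thesis by (simp add: schur_poly_def mvps_monom_empty)
qed

lemma schur_poly_0:
  assumes "D \<noteq> {}"
  shows "schur_poly 0 D = 0"
proof -
  have "tableaux 0 D = {}" using assms by (auto simp: tableaux_def)
  then show ?thesis by (simp add: schur_poly_def)
qed

text \<open>The diagrams obtained by removing a horizontal strip: whatever lies directly above a
  cell of \<open>D\<close> must stay, so no two removed cells share a column.\<close>

definition strips :: "(nat \<times> nat) set \<Rightarrow> (nat \<times> nat) set set" where
  "strips D = {D'. D' \<subseteq> D \<and> young D' \<and> (\<forall>i j. (Suc i, j) \<in> D \<and> 1 \<le> i \<longrightarrow> (i, j) \<in> D')}"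

text \<open>The branching rule. Columns increase strictly, so the cells carrying the largest entry
  \<open>m\<close> form a horizontal strip; the other cells form a tableau with smaller
  entries.\<close>

lemma schur_poly_Suc:
  assumes "young D"
  shows "schur_poly (Suc m) D =
    (\<Sum>D'\<in>strips D. mvps_monom {#m#} ^ card (D - D') * (schur_poly m D' :: 'a::comm_ring_1 mvps))"
proof -
  have finD: "finite D" by (rule young_finite[OF assms])
  have "strips D \<subseteq> Pow D" by (auto simp: strips_def)
  then have fin: "finite (strips D)" using finD by (simp add: finite_subset)
  have fin': "finite (tableaux m D')" if "D' \<in> strips D" for D'
    using that finD by (auto simp: strips_def intro: finite_tableaux finite_subset)
  let ?low = "\<lambda>T. {c \<in> D. T c < m}"
  \<comment> \<open>The inverse map fills the strip with \<open>m\<close>; off the diagram the value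
    is \<open>undefined\<close>, as tableaux are extensional.\<close>
  let ?ext = "\<lambda>(D', T') c. if c \<in> D' then T' c else if c \<in> D then m else undefined"
  have "schur_poly (Suc m) D = (\<Sum>(D', T')\<in>(SIGMA D':strips D. tableaux m D').
      mvps_monom {#m#} ^ card (D - D') * mvps_monom (image_mset T' (mset_set D')) :: 'a mvps)"
    unfolding schur_poly_def
  proof (rule sum.reindex_bij_witness[where i = ?ext and j = "\<lambda>T. (?low T, restrict T (?low T))"])
    fix T assume T: "T \<in> tableaux (Suc m) D"
    have TD: "T c \<le> m" if "c \<in> D" for c using T that by (auto simp: tableaux_def less_Suc_eq_le)
    have row: "T (i, j) \<le> T (i, Suc j)" if "(i, Suc j) \<in> D" "1 \<le> j" for i j
      using T that young_row[OF assms that] by (auto simp: tableaux_def)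
    have col: "T (i, j) < T (Suc i, j)" if "(Suc i, j) \<in> D" "1 \<le> i" for i j
      using T that young_col[OF assms that] by (auto simp: tableaux_def)
    show "?ext (?low T, restrict T (?low T)) = T"
      using T TD by (auto simp: tableaux_def extensional_def fun_eq_iff not_less intro: antisym)
    have "young (?low T)"
    proof (rule youngI)
      show "finite (?low T)" using finD by simp
      show "1 \<le> i \<and> 1 \<le> j" if "(i, j) \<in> ?low T" for i j using that young_pos[OF assms, of i j] by simp
      show "(i, j) \<in> ?low T" if "(i, Suc j) \<in> ?low T" "1 \<le> j" for i j
        using that young_row[OF assms, of i j] row[of i j] by simp
      show "(i, j) \<in> ?low T" if "(Suc i, j) \<in> ?low T" "1 \<le> i" for i j
        using that young_col[OF assms, of i j] col[of i j] by simp
    qed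
    moreover have "(i, j) \<in> ?low T" if "(Suc i, j) \<in> D" "1 \<le> i" for i j
      using that young_col[OF assms that] col[OF that] TD[of "(Suc i, j)"] by simp
    ultimately have "?low T \<in> strips D" by (auto simp: strips_def)
    moreover have "restrict T (?low T) \<in> tableaux m (?low T)"
      using T by (auto simp: tableaux_def)
    ultimately show "(?low T, restrict T (?low T)) \<in> (SIGMA D':strips D. tableaux m D')" by simp
    have "mset_set D = mset_set (?low T) + mset_set (D - ?low T)"
      using finD by (subst mset_set_Union[symmetric]) (auto intro!: arg_cong[of _ _ mset_set])
    then have "image_mset T (mset_set D) =
        image_mset T (mset_set (D - ?low T)) + image_mset T (mset_set (?low T))" by simp
    also have "image_mset T (mset_set (D - ?low T)) = image_mset (\<lambda>_. m) (mset_set (D - ?low T))"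
      using TD finD by (intro image_mset_cong) (auto simp: not_less intro: antisym)
    also have "\<dots> = replicate_mset (card (D - ?low T)) m" using finD by (simp add: image_mset_const_eq)
    also have "image_mset T (mset_set (?low T)) = image_mset (restrict T (?low T)) (mset_set (?low T))"
      using finD by (intro image_mset_cong) auto
    finally show "(case (?low T, restrict T (?low T)) of (D', T') \<Rightarrow>
        (mvps_monom {#m#} ^ card (D - D') * mvps_monom (image_mset T' (mset_set D')) :: 'a mvps)) =
      mvps_monom (image_mset T (mset_set D))"
      by (simp only: prod.case mvps_monom_add mvps_monom_replicate)
  next
    fix y assume "y \<in> (SIGMA D':strips D. tableaux m D')"
    then obtain D' T' where y: "y = (D', T')" and D': "D' \<in> strips D" and T': "T' \<in> tableaux m D'" by auto
    have st: "(i, j) \<in> D'" if "(Suc i, j) \<in> D" "1 \<le> i" for i j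
      using D' that unfolding strips_def by blast
    have sub: "D' \<subseteq> D" and yD': "young D'" using D' by (auto simp: strips_def)
    have lt: "T' c < m" if "c \<in> D'" for c using T' that by (auto simp: tableaux_def)
    have low: "?low (?ext y) = D'" using sub lt by (auto simp: y)
    then show "(?low (?ext y), restrict (?ext y) (?low (?ext y))) = y"
      using T' by (auto simp: y tableaux_def extensional_def fun_eq_iff)
    have T'row: "T' (i, j) \<le> T' (i, j + 1)" if "(i, j) \<in> D'" "(i, j + 1) \<in> D'" for i j
      using T' that by (simp add: tableaux_def)
    have T'col: "T' (i, j) < T' (i + 1, j)" if "(i, j) \<in> D'" "(i + 1, j) \<in> D'" for i j
      using T' that by (simp add: tableaux_def)
    have "?ext y (i, j) \<le> ?ext y (i, j + 1)" if "(i, j) \<in> D" "(i, j + 1) \<in> D" for i j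
    proof (cases "(i, j + 1) \<in> D'")
      case True
      then have "(i, j) \<in> D'" using young_row[OF yD', of i j] young_pos[OF assms that(1)] by simp
      then show ?thesis using True T'row by (simp add: y)
    next
      case False
      then show ?thesis using that lt[of "(i, j)"] by (simp add: y less_imp_le)
    qed
    moreover have "?ext y (i, j) < ?ext y (i + 1, j)" if "(i, j) \<in> D" "(i + 1, j) \<in> D" for i j
    proof -
      have "(i, j) \<in> D'" using st[of i j] that young_pos[OF assms that(1)] by simp
      then show ?thesis using T'col[of i j] lt[of "(i, j)"] that by (simp add: y)
    qed
    moreover have "?ext y c < Suc m" if "c \<in> D" for c
      using lt[of c] that by (simp add: y less_Suc_eq)
    moreover have "?ext y \<in> extensional D" using sub by (auto simp: y extensional_def)
    ultimately show "?ext y \<in> tableaux (Suc m) D" unfolding tableaux_def by blast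
  qed
  also have "\<dots> = (\<Sum>D'\<in>strips D. mvps_monom {#m#} ^ card (D - D') * schur_poly m D')"
    using fin fin' by (simp add: sum.Sigma[symmetric] schur_poly_def sum_distrib_left)
  finally show ?thesis .
qed

text \<open>Above the diagonal the strip condition reads along the columns of the shifted diagram of
  \<open>I\<close> and yields interlacing. The lower half is stored transposed, so there it reads
  along the rows of the shifted diagram of \<open>J\<close>, each of which loses at most one
  cell.\<close>

lemma frob_diagram_strip_iff:
  assumes p: "frob_pair I J" "0 \<notin> set I" and p': "frob_pair I' J'" and len: "length I' = length I"
  shows "frob_diagram I' J' \<in> strips (frob_diagram I J) \<longleftrightarrow>
    (\<forall>k<length I. I' ! k \<le> I ! k) \<and> (\<forall>k. Suc k < length I \<longrightarrow> I ! Suc k < I' ! k) \<and>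
    (\<forall>k<length J'. J ! k = J' ! k \<or> J ! k = Suc (J' ! k))"
proof -
  have lenJ: "length J' = length J" "length J = length I" using p p' len by (auto simp: frob_pair_def)
  let ?D = "frob_diagram I J" and ?D' = "frob_diagram I' J'"
  let ?s = shifted_diagram
  note up = frob_diagram_upper[OF p(1)] frob_diagram_upper[OF p'] and lo = frob_diagram_lower[OF p(1)] frob_diagram_lower[OF p']
  have sub: "?D' \<subseteq> ?D \<longleftrightarrow> ?s I' \<subseteq> ?s I \<and> ?s J' \<subseteq> ?s J"
  proof
    assume s: "?D' \<subseteq> ?D"
    have "(i, j) \<in> ?s I" if "(i, j) \<in> ?s I'" for i j
      using s that up[of i j] shifted_diagram_pos[OF that] by blast
    moreover have "(i, j) \<in> ?s J" if "(i, j) \<in> ?s J'" for i j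
      using s that lo[of i j] shifted_diagram_pos[OF that] by blast
    ultimately show "?s I' \<subseteq> ?s I \<and> ?s J' \<subseteq> ?s J" by auto
  qed (auto simp: frob_diagram_def)
  \<comment> \<open>The condition can be checked on each half separately: (\<open>Suc i\<close>,
    \<open>j\<close>) and (\<open>i\<close>, \<open>j\<close>) are both weakly below the diagonal if
    \<open>j \<le> i\<close>, and both weakly above it otherwise.\<close>
  have strip: "(\<forall>i j. (Suc i, j) \<in> ?D \<and> 1 \<le> i \<longrightarrow> (i, j) \<in> ?D') \<longleftrightarrow>
      (\<forall>i j. (Suc i, j) \<in> ?s I \<and> 1 \<le> i \<longrightarrow> (i, j) \<in> ?s I') \<and>
      (\<forall>i j. (i, Suc j) \<in> ?s J \<and> i \<le> j \<longrightarrow> (i, j) \<in> ?s J')" (is "?l \<longleftrightarrow> ?r1 \<and> ?r2")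
  proof
    assume l: ?l
    have ?r1
    proof (intro allI impI)
      fix i j assume ij: "(Suc i, j) \<in> ?s I \<and> 1 \<le> i"
      then have "Suc i \<le> j" using shifted_diagram_pos by blast
      then show "(i, j) \<in> ?s I'" using ij l up(1)[of "Suc i" j] up(2)[of i j] by auto
    qed
    moreover have ?r2
    proof (intro allI impI)
      fix i j assume ij: "(i, Suc j) \<in> ?s J \<and> i \<le> j"
      then have "1 \<le> i" using shifted_diagram_pos by blast
      then have "1 \<le> j" using ij by simp
      then show "(i, j) \<in> ?s J'" using ij l lo(1)[of i "Suc j"] lo(2)[of i j] by auto
    qed
    ultimately show "?r1 \<and> ?r2" by blast
  next
    assume r: "?r1 \<and> ?r2"
    show ?l
    proof (intro allI impI)
      fix i j assume ij: "(Suc i, j) \<in> ?D \<and> 1 \<le> i"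
      show "(i, j) \<in> ?D'"
      proof (cases "j \<le> i")
        case True
        then show ?thesis using ij r lo(1)[of j "Suc i"] lo(2)[of j i] by auto
      next
        case False
        then show ?thesis using ij r up(1)[of "Suc i" j] up(2)[of i j] by auto
      qed
    qed
  qed
  have "?D' \<in> strips ?D \<longleftrightarrow> (?s I' \<subseteq> ?s I \<and> ?s J' \<subseteq> ?s J) \<and>
      (\<forall>i j. (Suc i, j) \<in> ?s I \<and> 1 \<le> i \<longrightarrow> (i, j) \<in> ?s I') \<and>
      (\<forall>i j. (i, Suc j) \<in> ?s J \<and> i \<le> j \<longrightarrow> (i, j) \<in> ?s J')"
    unfolding strips_def mem_Collect_eq sub strip using young_frob_diagram[OF p'] by argo
  moreover have "J ! k = J' ! k \<or> J ! k = Suc (J' ! k) \<longleftrightarrow> J' ! k \<le> J ! k \<and> J ! k \<le> Suc (J' ! k)" for k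
    by auto
  ultimately show ?thesis
    unfolding shifted_diagram_subset_iff[OF len] shifted_diagram_subset_iff[OF lenJ(1)]
      shifted_diagram_shrink_col_iff[OF len p(2)] shifted_diagram_shrink_row_iff[OF lenJ(1)] lenJ
    by blast
qed

text \<open>Below a diagonal cell other than the last there is room: (\<open>i\<close>,
  \<open>Suc i\<close>) lies above the next diagonal cell, so it survives, and with it
  (\<open>i\<close>, \<open>i\<close>). Hence only the last diagonal cell can be lost, and the
  length of the lists is preserved.\<close>

lemma strips_frob_diagram:
  assumes p: "frob_pair I J" "0 \<notin> set I" and D': "D' \<in> strips (frob_diagram I J)"
  shows "\<exists>I' J'. frob_pair I' J' \<and> length I' = length I \<and> D' = frob_diagram I' J'"
proof -
  have y: "young D'" and sub: "D' \<subseteq> frob_diagram I J"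
    and st: "(Suc i, j) \<in> frob_diagram I J \<Longrightarrow> 1 \<le> i \<Longrightarrow> (i, j) \<in> D'" for i j
    using D' unfolding strips_def by blast+
  have diag: "(i, i) \<in> frob_diagram I J \<longleftrightarrow> 1 \<le> i \<and> i \<le> length I" for i
    using p by (simp add: frob_diagram_upper diag_shifted_diagram_iff frob_pair_def)
  have "\<exists>cs es. frob_pair cs es \<and> length cs = length I \<and> frob_diagram cs es = D'"
  proof (rule ex_frob_diagram[OF y])
    show "i \<le> length I" if "(i, i) \<in> D'" for i using that sub diag by blast
    show "(i, i) \<in> D'" if "1 \<le> i" "i < length I" for i
    proof -
      have "(i, Suc i) \<in> D'" using st[of i "Suc i"] diag[of "Suc i"] that by simp
      then show ?thesis using young_row[OF y] that by blast
    qed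
  qed
  then show ?thesis by blast
qed

definition horizontal_matrix :: "'a::comm_ring_1 \<Rightarrow> nat \<Rightarrow> nat \<Rightarrow> 'a" where
  "horizontal_matrix x a b = (if b \<le> a then x ^ (a - b) else 0)"

text \<open>A leg is counted without the diagonal cell; thus a new diagonal cell, which is already counted as
  part of an arm, has weight 1 here (truncated subtraction).\<close>

definition vertical_matrix :: "'a::comm_ring_1 \<Rightarrow> nat \<Rightarrow> nat \<Rightarrow> 'a" where
  "vertical_matrix x a b = (if b = a \<or> b = Suc a then x ^ ((b - 1) - (a - 1)) else 0)"

lemma sum_list_pred_diff:
  assumes "length ys = length xs" "\<forall>k<length xs. ys ! k = xs ! k \<or> ys ! k = Suc (xs ! k)"
  shows "(\<Sum>y\<leftarrow>ys. y - 1) = (\<Sum>x\<leftarrow>xs. x - 1) + (\<Sum>k<length xs. (ys ! k - 1) - (xs ! k - 1 :: nat))"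
proof -
  have "(\<Sum>y\<leftarrow>ys. y - 1) = (\<Sum>k<length xs. (xs ! k - 1) + ((ys ! k - 1) - (xs ! k - 1)))"
    unfolding sum_list_sum_nth using assms
    by (auto simp: atLeast0LessThan intro!: sum.cong)
  also have "\<dots> = (\<Sum>x\<leftarrow>xs. x - 1) + (\<Sum>k<length xs. (ys ! k - 1) - (xs ! k - 1))"
    unfolding sum_list_sum_nth by (simp add: atLeast0LessThan sum.distrib)
  finally show ?thesis .
qed

text \<open>The branching rule in coordinates. For lists that form a \<open>frob_pair\<close>, the
  two transfer minors are nonzero together only at a horizontal strip, as is seen from their
  evaluation; other pairs of lists are suppressed by the middle factor. The bound \<open>B\<close>
  makes the index set finite.\<close>

lemma schur_poly_frob_Suc:
  fixes I J :: "nat list" and m B :: nat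
  assumes p: "frob_pair I J" "0 \<notin> set I" and Z: "\<And>z. z \<in> set I \<union> set J \<Longrightarrow> z \<le> B"
  defines "x \<equiv> mvps_monom {#m#} :: 'a::comm_ring_1 mvps" and "L \<equiv> dec_lists {0..B} (length I)"
  shows "schur_poly (Suc m) (frob_diagram I J) =
    (\<Sum>I'\<in>L. \<Sum>J'\<in>L. minor (horizontal_matrix x) I I' *
       (if frob_pair I' J' then schur_poly m (frob_diagram I' J') else 0) * minor (vertical_matrix x) J' J)"
proof -
  let ?D = "frob_diagram I J"
  define S where "S = {(I', J') \<in> L \<times> L. frob_pair I' J' \<and> frob_diagram I' J' \<in> strips ?D}"
  have lenJ: "length J = length I" and srt: "sorted_wrt (>) I" "sorted_wrt (>) J"
    using p by (auto simp: frob_pair_def)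
  have finL: "finite L" unfolding L_def by auto
  have L: "sorted_wrt (>) K" "length K = length I" if "K \<in> L" for K
    using that by (auto simp: L_def dec_lists_def)
  have bij: "bij_betw (\<lambda>(I', J'). frob_diagram I' J') S (strips ?D)"
  proof (rule bij_betw_imageI)
    show "inj_on (\<lambda>(I', J'). frob_diagram I' J') S"
    proof (rule inj_onI, clarify)
      fix I1 J1 I2 J2 assume a: "(I1, J1) \<in> S" "(I2, J2) \<in> S" "frob_diagram I1 J1 = frob_diagram I2 J2"
      then have "frob_pair I1 J1" "frob_pair I2 J2" "length I1 = length I2" using L(2) by (auto simp: S_def)
      then show "I1 = I2 \<and> J1 = J2" using frob_diagram_eq_iff[of I1 J1 I2 J2] a(3) by blast
    qed
    show "(\<lambda>(I', J'). frob_diagram I' J') ` S = strips ?D"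
    proof (intro equalityI subsetI)
      fix D' assume D': "D' \<in> strips ?D"
      then obtain I' J' where IJ: "frob_pair I' J'" "length I' = length I" "D' = frob_diagram I' J'"
        using strips_frob_diagram[OF p] by blast
      have c: "\<forall>k<length I. I' ! k \<le> I ! k" "\<forall>k<length J'. J ! k = J' ! k \<or> J ! k = Suc (J' ! k)"
        using frob_diagram_strip_iff[OF p IJ(1,2)] D' IJ(3) by auto
      have lenJ': "length J' = length I" using IJ by (simp add: frob_pair_def)
      have "z \<le> B" if z: "z \<in> set I'" for z
      proof -
        obtain k where k: "k < length I" "z = I' ! k" using z \<open>length I' = length I\<close> by (metis in_set_conv_nth)
        have "I ! k \<le> B" using Z[of "I ! k"] nth_mem[OF k(1)] by simp
        then show ?thesis using c(1) k le_trans by blast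
      qed
      moreover have "z \<le> B" if z: "z \<in> set J'" for z
      proof -
        obtain k where k: "k < length J'" "z = J' ! k" using z by (metis in_set_conv_nth)
        have "J ! k \<le> B" using Z[of "J ! k"] nth_mem[of k J] k(1) lenJ lenJ' by simp
        moreover have "z \<le> J ! k" using c(2) k by fastforce
        ultimately show ?thesis by simp
      qed
      ultimately have "I' \<in> L" "J' \<in> L" using IJ lenJ' by (auto simp: L_def dec_lists_def frob_pair_def)
      then have "(I', J') \<in> S" using IJ D' by (simp add: S_def)
      then show "D' \<in> (\<lambda>(I', J'). frob_diagram I' J') ` S" using IJ by force
    qed (auto simp: S_def)
  qed
  \<comment> \<open>The horizontal minor contributes the cells removed from the arms, the vertical
    one those removed from the legs; the exponents add up to the size of the strip.\<close>
  have main: "minor (horizontal_matrix x) I I' *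
       (if frob_pair I' J' then schur_poly m (frob_diagram I' J') else 0) * minor (vertical_matrix x) J' J =
     (if (I', J') \<in> S then x ^ card (?D - frob_diagram I' J') * schur_poly m (frob_diagram I' J') else 0)"
    (is "?lhs = ?rhs") if I': "I' \<in> L" and J': "J' \<in> L" for I' J'
  proof (cases "frob_pair I' J'")
    case True
    let ?D' = "frob_diagram I' J'"
    let ?h = "(\<forall>k<length I. I' ! k \<le> I ! k) \<and> (\<forall>k. Suc k < length I \<longrightarrow> I ! Suc k < I' ! k)"
    let ?v = "\<forall>k<length J'. J ! k = J' ! k \<or> J ! k = Suc (J' ! k)"
    note lI = L(2)[OF I'] and lJ = L(2)[OF J']
    have h: "minor (horizontal_matrix x) I I' = (if ?h then x ^ (sum_list I - sum_list I') else 0)"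
      unfolding horizontal_matrix_def[abs_def] using srt L(1)[OF I'] lI by (intro minor_geometric) auto
    have v: "minor (vertical_matrix x) J' J =
        (if ?v then \<Prod>k<length J'. x ^ ((J ! k - 1) - (J' ! k - 1)) else 0)"
      unfolding vertical_matrix_def[abs_def] using srt L(1)[OF J'] lJ lenJ by (intro minor_shift) auto
    have S: "(I', J') \<in> S \<longleftrightarrow> ?h \<and> ?v"
      using frob_diagram_strip_iff[OF p True lI] I' J' True by (auto simp: S_def)
    show ?thesis
    proof (cases "?h \<and> ?v")
      case True': True
      have "(I', J') \<in> S" using S True' by blast
      then have sub: "?D' \<subseteq> ?D" by (simp add: S_def strips_def)
      have "sum_list I' \<le> sum_list I"
        unfolding sum_list_sum_nth lI by (rule sum_mono) (use True' in auto)
      then have "card ?D - card ?D' = (sum_list I - sum_list I') + (\<Sum>k<length J'. (J ! k - 1) - (J' ! k - 1))"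
        unfolding card_frob_diagram[OF p(1)] card_frob_diagram[OF True]
        using sum_list_pred_diff[of J J'] True' lJ lenJ by simp
      moreover have "card (?D - ?D') = card ?D - card ?D'"
        using sub young_finite[OF young_frob_diagram[OF True]] by (rule card_Diff_subset[rotated])
      ultimately have "x ^ card (?D - ?D') = x ^ (sum_list I - sum_list I') * (\<Prod>k<length J'. x ^ ((J ! k - 1) - (J' ! k - 1)))"
        by (simp add: power_add power_sum)
      moreover have "minor (horizontal_matrix x) I I' = x ^ (sum_list I - sum_list I')"
        unfolding h using True' by (intro if_P) blast
      moreover have "minor (vertical_matrix x) J' J = (\<Prod>k<length J'. x ^ ((J ! k - 1) - (J' ! k - 1)))"
        unfolding v using True' by (intro if_P) blast
      ultimately show ?thesis
        unfolding if_P[OF True] if_P[OF \<open>(I', J') \<in> S\<close>] by (simp only: mult_ac)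
    next
      case False
      then have "minor (horizontal_matrix x) I I' = 0 \<or> minor (vertical_matrix x) J' J = 0"
        unfolding h v by (metis (no_types, lifting))
      moreover have "(I', J') \<notin> S" using S False by blast
      ultimately show ?thesis by auto
    qed
  qed (simp add: S_def)
  have "schur_poly (Suc m) ?D = (\<Sum>D'\<in>strips ?D. x ^ card (?D - D') * schur_poly m D')"
    unfolding x_def by (rule schur_poly_Suc[OF young_frob_diagram[OF p(1)]])
  also have "\<dots> = (\<Sum>(I', J')\<in>S. x ^ card (?D - frob_diagram I' J') * schur_poly m (frob_diagram I' J'))"
    by (subst sum.reindex_bij_betw[OF bij, symmetric]) (simp add: case_prod_unfold)
  also have "\<dots> = (\<Sum>q\<in>L \<times> L. if q \<in> S then x ^ card (?D - frob_diagram (fst q) (snd q)) * schur_poly m (frob_diagram (fst q) (snd q)) else 0)"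
    using finL by (subst sum.inter_restrict[symmetric]) (auto simp: S_def case_prod_unfold intro!: sum.cong)
  also have "\<dots> = (\<Sum>I'\<in>L. \<Sum>J'\<in>L. if (I', J') \<in> S then x ^ card (?D - frob_diagram I' J') * schur_poly m (frob_diagram I' J') else 0)"
    by (subst sum.cartesian_product) (simp add: case_prod_unfold)
  also have "\<dots> = (\<Sum>I'\<in>L. \<Sum>J'\<in>L. minor (horizontal_matrix x) I I' *
       (if frob_pair I' J' then schur_poly m (frob_diagram I' J') else 0) * minor (vertical_matrix x) J' J)"
    by (intro sum.cong refl main[symmetric])
  finally show ?thesis .
qed

lemma shifted_diagram_snoc_0: "shifted_diagram (us @ [0]) = shifted_diagram us"
  by (auto simp: shifted_diagram_def nth_append split: if_splits)

lemma frob_diagram_snoc_0: "frob_diagram (us @ [0]) (vs @ [0]) = frob_diagram us vs"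
  by (simp add: frob_diagram_def shifted_diagram_snoc_0)

abbreviation hook_poly :: "nat \<Rightarrow> nat \<Rightarrow> nat \<Rightarrow> 'a::comm_ring_1 mvps" where
  "hook_poly m a b \<equiv> schur_poly m (frob_diagram [a] [b])"

lemma frob_pair_singleton: "frob_pair [a] [b] \<longleftrightarrow> (a = 0 \<longleftrightarrow> b = 0)"
  by (auto simp: frob_pair_def)

text \<open>For \<open>a = b = 0\<close> the diagram is empty and its Schur polynomial is 1, which
  is the corner entry of \<open>bordered\<close>.\<close>

lemma bordered_hook_poly:
  "bordered (hook_poly m) a b = (if frob_pair [a] [b] then hook_poly m a b else 0)"
proof -
  have "frob_diagram [0] [0] = {}" by (auto simp: frob_diagram_def shifted_diagram_def)
  then show ?thesis unfolding frob_pair_singleton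
    by (cases "a = 0"; cases "b = 0") (simp_all add: bordered_0_left bordered_0_right bordered_pos)
qed

lemma minor_singleton [simp]: "minor A [x] [y] = A x y"
  using minor_Cons_row[of "[]" "[]" A x y] by simp

lemma sum_dec_lists_1: "(\<Sum>zs\<in>dec_lists Z 1. f zs) = (\<Sum>z\<in>Z. f [z])"
  by (rule sum.reindex_bij_witness[where i = "\<lambda>z. [z]" and j = hd])
     (auto simp: dec_lists_def length_Suc_conv)

text \<open>The case \<open>d = 1\<close> of the branching rule, read as a product of three matrices
  to which Cauchy--Binet can be applied.\<close>

lemma hook_poly_Suc:
  fixes a b m B :: nat
  assumes "1 \<le> a" "1 \<le> b" "a \<le> B" "b \<le> B"
  defines "x \<equiv> mvps_monom {#m#} :: 'a::comm_ring_1 mvps"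
  shows "hook_poly (Suc m) a b =
    (\<Sum>a'\<in>{0..B}. \<Sum>b'\<in>{0..B}. horizontal_matrix x a a' * bordered (hook_poly m) a' b' * vertical_matrix x b' b)"
proof -
  have "hook_poly (Suc m) a b =
    (\<Sum>I'\<in>dec_lists {0..B} (length [a]). \<Sum>J'\<in>dec_lists {0..B} (length [a]). minor (horizontal_matrix x) [a] I' *
       (if frob_pair I' J' then schur_poly m (frob_diagram I' J') else 0) * minor (vertical_matrix x) J' [b])"
    unfolding x_def by (rule schur_poly_frob_Suc) (use assms in \<open>auto simp: frob_pair_singleton\<close>)
  also have "length [a] = 1" by simp
  finally show ?thesis unfolding sum_dec_lists_1 minor_singleton bordered_hook_poly .
qed

text \<open>Adding a variable replaces the bordered matrix of hooks by its product with the two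
  transfer matrices. Two applications of Cauchy--Binet turn the minors of this product into exactly
  the recursion of \<open>schur_poly_frob_Suc\<close>.\<close>

theorem giambelli_poly:
  assumes "frob_pair I J" "0 \<notin> set I"
  shows "schur_poly m (frob_diagram I J) = (minor (hook_poly m) I J :: 'a::comm_ring_1 mvps)"
  using assms
proof (induction m arbitrary: I J)
  case 0
  show ?case
  proof (cases I)
    case Nil
    then have "J = []" using 0 by (simp add: frob_pair_def)
    moreover have "frob_diagram [] [] = {}" by (auto simp: frob_diagram_def shifted_diagram_def)
    ultimately show ?thesis using Nil by simp
  next
    case (Cons a I')
    have nonempty: "frob_diagram K K' \<noteq> {}" if "frob_pair K K'" "0 \<notin> set K" "K \<noteq> []" for K K'
    proof -
      have "1 \<le> length K" using that(3) by (cases K) auto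
      moreover have "sorted_wrt (>) K" using that(1) by (simp add: frob_pair_def)
      ultimately have "(1, 1) \<in> shifted_diagram K" using diag_shifted_diagram_iff[of K 1] that(2) by blast
      then show ?thesis by (auto simp: frob_diagram_def)
    qed
    have zJ: "0 \<notin> set J" "length I = length J" using 0 by (auto simp: frob_pair_def)
    have "hook_poly 0 c e = (0 :: 'a mvps)" if "c \<in> set I" "e \<in> set J" for c e
    proof -
      have "c \<noteq> 0" "e \<noteq> 0" using that 0 zJ by metis+
      then show ?thesis by (intro schur_poly_0 nonempty) (auto simp: frob_pair_singleton)
    qed
    then have "minor (hook_poly 0) I J = (0 :: 'a mvps)"
      using Cons zJ by (intro minor_zero_row[of a]) auto
    then show ?thesis using schur_poly_0[OF nonempty[OF 0]] Cons by simp
  qed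
next
  case (Suc m)
  define x where "x = (mvps_monom {#m#} :: 'a mvps)"
  define B where "B = Max (set I \<union> set J)"
  have Z: "z \<le> B" if "z \<in> set I \<union> set J" for z unfolding B_def by (rule Max_ge) (use that in auto)
  define L where "L = dec_lists {0..B} (length I)"
  have len: "length I = length J" and zJ: "0 \<notin> set J" using Suc.prems by (auto simp: frob_pair_def)
  have L: "sorted_wrt (>) K" "length K = length I" if "K \<in> L" for K
    using that by (auto simp: L_def dec_lists_def)
  have IH: "minor (bordered (hook_poly m)) I' J' =
      (if frob_pair I' J' then schur_poly m (frob_diagram I' J') else 0 :: 'a mvps)"
    if "I' \<in> L" "J' \<in> L" for I' J'
  proof -
    note s = L[OF that(1)] L[OF that(2)]
    consider "0 \<in> set I'" "0 \<in> set J'" | "0 \<notin> set I'" "0 \<notin> set J'" | "(0 \<in> set I') \<noteq> (0 \<in> set J')" by blast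
    then show ?thesis
    proof cases
      case 1
      obtain us where us: "I' = us @ [0]" "0 \<notin> set us" "sorted_wrt (>) us" using dec_list_zero_last[OF s(1) 1(1)] .
      obtain vs where vs: "J' = vs @ [0]" "0 \<notin> set vs" "sorted_wrt (>) vs" using dec_list_zero_last[OF s(3) 1(2)] .
      have l: "length us = length vs" using us vs s by simp
      have fp: "frob_pair I' J'" "frob_pair us vs" using s us vs l by (simp_all add: frob_pair_def)
      have "minor (bordered (hook_poly m)) I' J' = (minor (hook_poly m) us vs :: 'a mvps)"
        unfolding us(1) vs(1) by (rule minor_bordered_snoc[OF l us(2) vs(2)])
      also have "\<dots> = schur_poly m (frob_diagram us vs)" by (rule Suc.IH[OF fp(2) us(2), symmetric])
      finally show ?thesis unfolding if_P[OF fp(1)] unfolding us(1) vs(1) frob_diagram_snoc_0 .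
    next
      case 2
      have fp: "frob_pair I' J'" using s 2 by (simp add: frob_pair_def)
      have "minor (bordered (hook_poly m)) I' J' = (minor (hook_poly m) I' J' :: 'a mvps)"
        by (rule minor_bordered_pos) (use s 2 in simp_all)
      also have "\<dots> = schur_poly m (frob_diagram I' J')" by (rule Suc.IH[OF fp 2(1), symmetric])
      finally show ?thesis unfolding if_P[OF fp] .
    next
      case 3
      then have "\<not> frob_pair I' J'" by (auto simp: frob_pair_def)
      moreover have "minor (bordered (hook_poly m)) I' J' = (0 :: 'a mvps)"
        by (rule minor_bordered_disagree) (use s 3 in simp_all)
      ultimately show ?thesis by (subst if_not_P)
    qed
  qed
  let ?G = "\<lambda>a' b. \<Sum>b'\<in>{0..B}. bordered (hook_poly m) a' b' * vertical_matrix x b' b"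
  have "minor (hook_poly (Suc m)) I J = (minor (\<lambda>a b. \<Sum>a'\<in>{0..B}. horizontal_matrix x a a' * ?G a' b) I J :: 'a mvps)"
  proof (rule minor_cong[OF len])
    fix a b assume ab: "a \<in> set I" "b \<in> set J"
    then have "a \<noteq> 0" "b \<noteq> 0" using Suc.prems zJ by metis+
    then show "hook_poly (Suc m) a b = (\<Sum>a'\<in>{0..B}. horizontal_matrix x a a' * ?G a' b :: 'a mvps)"
      using hook_poly_Suc[of a b B m, where 'a = 'a] Z[of a] Z[of b] ab
      by (simp add: x_def sum_distrib_left mult.assoc)
  qed
  also have "\<dots> = (\<Sum>I'\<in>L. minor (horizontal_matrix x) I I' * minor ?G I' J)"
    unfolding L_def by (rule cauchy_binet) (use len in auto)
  also have "\<dots> = (\<Sum>I'\<in>L. minor (horizontal_matrix x) I I' *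
      (\<Sum>J'\<in>L. minor (bordered (hook_poly m)) I' J' * minor (vertical_matrix x) J' J))"
  proof (intro sum.cong refl arg_cong[of _ _ "(*) _"])
    fix I' assume I': "I' \<in> L"
    show "minor ?G I' J = (\<Sum>J'\<in>L. minor (bordered (hook_poly m)) I' J' * minor (vertical_matrix x) J' J)"
      unfolding L_def L(2)[OF I', symmetric]
      by (rule cauchy_binet) (use len L(2)[OF I'] in auto)
  qed
  also have "\<dots> = (\<Sum>I'\<in>L. \<Sum>J'\<in>L. minor (horizontal_matrix x) I I' *
       (if frob_pair I' J' then schur_poly m (frob_diagram I' J') else 0) * minor (vertical_matrix x) J' J)"
    unfolding sum_distrib_left by (intro sum.cong refl) (simp only: IH mult.assoc)
  also have "\<dots> = schur_poly (Suc m) (frob_diagram I J)"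
    unfolding x_def L_def by (rule schur_poly_frob_Suc[OF Suc.prems Z, symmetric])
  finally show ?case by simp
qed

section \<open>Complete and elementary symmetric functions as hooks\<close>

lemma hsym_0: "hsym 0 = 1" and esym_0: "esym 0 = 1"
  by (auto simp: mvps_eq_iff mvps_coeff_1 hsym_def esym_def)

lemma hsym_neg: "k < 0 \<Longrightarrow> hsym k = 0" and esym_neg: "k < 0 \<Longrightarrow> esym k = 0"
  by (auto simp: mvps_eq_iff hsym_def esym_def)

lemma set_mset_lessThan_Suc: "m \<notin># M \<Longrightarrow> set_mset M \<subseteq> {..<Suc m} \<longleftrightarrow> set_mset M \<subseteq> {..<m}"
  by (auto simp: less_Suc_eq subset_iff)

text \<open>A monomial either avoids the last variable or is divisible by it, and the quotient may
  contain that variable again.\<close>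

lemma mvps_trunc_hsym_Suc:
  "mvps_trunc (Suc m) (hsym (int (Suc a))) =
   mvps_trunc m (hsym (int (Suc a))) + mvps_monom {#m#} * mvps_trunc (Suc m) (hsym (int a) :: 'a::comm_ring_1 mvps)"
  unfolding mvps_eq_iff
proof
  fix M :: "nat multiset"
  show "mvps_coeff (mvps_trunc (Suc m) (hsym (int (Suc a)))) M =
    mvps_coeff (mvps_trunc m (hsym (int (Suc a))) + mvps_monom {#m#} * mvps_trunc (Suc m) (hsym (int a)) :: 'a mvps) M"
  proof (cases "m \<in># M")
    case True
    then obtain N where N: "M = add_mset m N" by (metis mset_add)
    show ?thesis by (simp add: N mvps_coeff_trunc mvps_coeff_monom_mult hsym_def)
  next
    case False
    then show ?thesis
      by (simp add: mvps_coeff_trunc mvps_coeff_monom_mult hsym_def set_mset_lessThan_Suc[OF False])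
  qed
qed

text \<open>Here the quotient by the last variable must avoid it, since monomials are squarefree;
  hence \<open>m\<close> instead of \<open>Suc m\<close> in the last factor.\<close>

lemma mvps_trunc_esym_Suc:
  "mvps_trunc (Suc m) (esym (int (Suc b))) =
   mvps_trunc m (esym (int (Suc b))) + mvps_monom {#m#} * mvps_trunc m (esym (int b) :: 'a::comm_ring_1 mvps)"
  unfolding mvps_eq_iff
proof
  fix M :: "nat multiset"
  show "mvps_coeff (mvps_trunc (Suc m) (esym (int (Suc b)))) M =
    mvps_coeff (mvps_trunc m (esym (int (Suc b))) + mvps_monom {#m#} * mvps_trunc m (esym (int b)) :: 'a mvps) M"
  proof (cases "m \<in># M")
    case True
    then obtain N where N: "M = add_mset m N" by (metis mset_add)
    have cnt: "(\<forall>i. count M i \<le> 1) \<longleftrightarrow> m \<notin># N \<and> (\<forall>i. count N i \<le> 1)"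
    proof
      assume M: "\<forall>i. count M i \<le> 1"
      have "count N i \<le> 1" for i
      proof -
        have "count N i \<le> count M i" by (simp add: N)
        then show ?thesis using M by (metis le_trans)
      qed
      moreover have "count N m = 0" using spec[OF M, of m] by (simp add: N)
      ultimately show "m \<notin># N \<and> (\<forall>i. count N i \<le> 1)" by (simp add: not_in_iff)
    next
      assume "m \<notin># N \<and> (\<forall>i. count N i \<le> 1)"
      then show "\<forall>i. count M i \<le> 1" by (simp add: N not_in_iff)
    qed
    have nested: "(if S then if s \<and> q \<and> c then 1 else 0 else 0) = (if T then if s \<and> c then 1 else 0 else 0 :: 'a)"
      if "(S \<and> q) = T" for S T q s c using that by auto
    have "set_mset N \<subseteq> {..<Suc m} \<and> m \<notin># N \<longleftrightarrow> set_mset N \<subseteq> {..<m}"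
      by (auto simp: less_Suc_eq subset_iff)
    moreover have "\<not> set_mset M \<subseteq> {..<m}" "set_mset M \<subseteq> {..<Suc m} \<longleftrightarrow> set_mset N \<subseteq> {..<Suc m}"
      "{#m#} \<subseteq># M" "M - {#m#} = N" "int (size M) = int (Suc b) \<longleftrightarrow> int (size N) = int b"
      by (auto simp: N)
    ultimately show ?thesis
      by (simp only: cnt mvps_coeff_trunc mvps_coeff_monom_mult esym_def mvps_coeff_simps mvps_coeff_Abs if_False if_True add_0) (rule nested)
  next
    case False
    then show ?thesis
      by (simp add: mvps_coeff_trunc mvps_coeff_monom_mult esym_def set_mset_lessThan_Suc[OF False])
  qed
qed

lemma mvps_trunc_0_hsym: "1 \<le> a \<Longrightarrow> mvps_trunc 0 (hsym (int a)) = 0"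
  and mvps_trunc_0_esym: "1 \<le> a \<Longrightarrow> mvps_trunc 0 (esym (int a)) = 0"
  by (auto simp: mvps_eq_iff mvps_coeff_trunc hsym_def esym_def)

text \<open>\<open>K\<close> is the bordered matrix of hooks times the vertical transfer matrix:
  only the legs have been enlarged. The factor 1 for \<open>b = 1\<close> belongs to a new diagonal
  cell, whose variable is supplied by the arm.\<close>

context
  fixes m :: nat and x :: "'a::comm_ring_1 mvps" and K :: "nat \<Rightarrow> nat \<Rightarrow> 'a mvps"
  defines "x \<equiv> mvps_monom {#m#}"
  defines "K \<equiv> \<lambda>a b. bordered (hook_poly m) a b + (if b = 1 then 1 else x) * bordered (hook_poly m) a (b - 1)"
begin

lemma hook_poly_Suc_sum:
  assumes "1 \<le> a" "1 \<le> b"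
  shows "hook_poly (Suc m) a b = (\<Sum>a'\<in>{0..a}. x ^ (a - a') * K a' b)"
proof -
  define B where "B = max a b"
  have inner: "(\<Sum>b'\<in>{0..B}. bordered (hook_poly m) a' b' * vertical_matrix x b' b) = K a' b" for a'
  proof -
    have "(\<Sum>b'\<in>{0..B}. bordered (hook_poly m) a' b' * vertical_matrix x b' b) =
      (\<Sum>b'\<in>{b, b - 1}. bordered (hook_poly m) a' b' * vertical_matrix x b' b)"
    proof (rule sum.mono_neutral_right)
      show "\<forall>i\<in>{0..B} - {b, b - 1}. bordered (hook_poly m) a' i * vertical_matrix x i b = 0"
        by (auto simp: vertical_matrix_def)
    qed (use assms in \<open>auto simp: B_def\<close>)
    also have "\<dots> = K a' b"
    proof (cases "b = 1")
      case True
      then show ?thesis by (simp add: K_def vertical_matrix_def)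
    next
      case False
      then have "b = Suc (Suc (b - 2))" using assms(2) by linarith
      then obtain c where "b = Suc (Suc c)" by blast
      then show ?thesis by (simp add: K_def vertical_matrix_def mult.commute)
    qed
    finally show ?thesis .
  qed
  have "hook_poly (Suc m) a b = (\<Sum>a'\<in>{0..B}. horizontal_matrix x a a' * K a' b)"
    unfolding inner[symmetric] sum_distrib_left mult.assoc[symmetric] x_def
    by (rule hook_poly_Suc) (use assms in \<open>auto simp: B_def\<close>)
  also have "\<dots> = (\<Sum>a'\<in>{0..a}. horizontal_matrix x a a' * K a' b)"
    by (rule sum.mono_neutral_right) (auto simp: B_def horizontal_matrix_def)
  also have "\<dots> = (\<Sum>a'\<in>{0..a}. x ^ (a - a') * K a' b)"
    by (rule sum.cong) (auto simp: horizontal_matrix_def)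
  finally show ?thesis .
qed

lemma K_0: "1 \<le> b \<Longrightarrow> K 0 b = (if b = 1 then 1 else 0)"
  by (cases "b = 1") (auto simp: K_def bordered_0_left)

lemma hook_poly_Suc_1:
  assumes "1 \<le> b"
  shows "hook_poly (Suc m) 1 b = (if b = 1 then x else 0) + K 1 b"
  using hook_poly_Suc_sum[of 1 b] assms K_0[OF assms] by simp

lemma hook_poly_Suc_Suc:
  assumes "1 \<le> a" "1 \<le> b"
  shows "hook_poly (Suc m) (Suc a) b = x * hook_poly (Suc m) a b + K (Suc a) b"
proof -
  have "(\<Sum>a'\<in>{0..a}. x ^ (Suc a - a') * K a' b) = x * (\<Sum>a'\<in>{0..a}. x ^ (a - a') * K a' b)"
    unfolding sum_distrib_left by (intro sum.cong) (auto simp: Suc_diff_le mult.assoc)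
  then show ?thesis using hook_poly_Suc_sum[of "Suc a" b] hook_poly_Suc_sum[of a b] assms by simp
qed

lemma K_1: "1 \<le> a \<Longrightarrow> K a 1 = hook_poly m a 1"
  by (simp add: K_def bordered_0_right bordered_pos)

lemma K_Suc: "1 \<le> a \<Longrightarrow> 1 \<le> b \<Longrightarrow> K a (Suc b) = hook_poly m a (Suc b) + x * hook_poly m a b"
  by (simp add: K_def bordered_pos)

end

text \<open>Induction on the number of variables. The three claims are proved together because the
  step for the third one uses the other two at the ends \<open>b = 1\<close> and
  \<open>a = 1\<close>.\<close>

lemma hook_poly_relations:
  fixes a b :: nat
  assumes "1 \<le> a" "1 \<le> b"
  shows "hook_poly m a 1 = (mvps_trunc m (hsym (int a)) :: 'a::comm_ring_1 mvps) \<and>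
    hook_poly m 1 b = (mvps_trunc m (esym (int b)) :: 'a mvps) \<and>
    hook_poly m a (Suc b) + hook_poly m (Suc a) b = mvps_trunc m (hsym (int a)) * (mvps_trunc m (esym (int b)) :: 'a mvps)"
  using assms
proof (induction m arbitrary: a b)
  case 0
  have "hook_poly 0 a' b' = (0 :: 'a mvps)" if "1 \<le> a'" "1 \<le> b'" for a' b'
  proof (rule schur_poly_0)
    have "(1, 1) \<in> frob_diagram [a'] [b']" using that by (simp add: frob_diagram_def shifted_diagram_def)
    then show "frob_diagram [a'] [b'] \<noteq> {}" by blast
  qed
  then show ?case using 0 by (simp add: mvps_trunc_0_hsym mvps_trunc_0_esym)
next
  case (Suc m)
  define x where "x = (mvps_monom {#m#} :: 'a mvps)"
  define H where "H = (hook_poly m :: nat \<Rightarrow> nat \<Rightarrow> 'a mvps)"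
  define H' where "H' = (hook_poly (Suc m) :: nat \<Rightarrow> nat \<Rightarrow> 'a mvps)"
  define h where "h m a = (mvps_trunc m (hsym (int a)) :: 'a mvps)" for m a
  define e where "e m a = (mvps_trunc m (esym (int a)) :: 'a mvps)" for m a
  define K where "K a b = bordered H a b + (if b = 1 then 1 else x) * bordered H a (b - 1)" for a b
  have h0: "h m 0 = 1" and e0: "e m 0 = 1" for m by (simp_all add: h_def e_def hsym_0 esym_0)
  have hS: "h (Suc m) (Suc a) = h m (Suc a) + x * h (Suc m) a" for a
    unfolding h_def x_def by (rule mvps_trunc_hsym_Suc)
  have eS: "e (Suc m) (Suc b) = e m (Suc b) + x * e m b" for b
    unfolding e_def x_def by (rule mvps_trunc_esym_Suc)
  have I1: "H a 1 = h m a" and I2: "H 1 b = e m b" and I3: "H a (Suc b) + H (Suc a) b = h m a * e m b"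
    if "1 \<le> a" "1 \<le> b" for a b
    using Suc.IH[OF that] by (simp_all add: H_def h_def e_def)
  have R1: "H' 1 b = (if b = 1 then x else 0) + K 1 b" if "1 \<le> b" for b
    unfolding H'_def K_def H_def x_def by (rule hook_poly_Suc_1[OF that])
  have R2: "H' (Suc a) b = x * H' a b + K (Suc a) b" if "1 \<le> a" "1 \<le> b" for a b
    unfolding H'_def K_def H_def x_def by (rule hook_poly_Suc_Suc[OF that])
  have K1: "K a 1 = H a 1" if "1 \<le> a" for a
    unfolding K_def H_def x_def by (rule K_1[OF that])
  have KS: "K a (Suc b) = H a (Suc b) + x * H a b" if "1 \<le> a" "1 \<le> b" for a b
    unfolding K_def H_def x_def by (rule K_Suc[OF that])
  have C1: "H' a 1 = h (Suc m) a" if "1 \<le> a" for a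
    using that
  proof (induction a rule: nat_induct_at_least)
    case base
    then show ?case using R1[of 1] K1[of 1] I1[of 1 1] hS[of 0] h0 by (simp add: add.commute)
  next
    case (Suc a)
    then show ?case using R2[of a 1] K1[of "Suc a"] I1[of "Suc a" 1] hS[of a] by (simp add: add.commute)
  qed
  have C2: "H' 1 b = e (Suc m) b" if b: "1 \<le> b" for b
  proof (cases "b = 1")
    case True
    then show ?thesis using R1[of 1] K1[of 1] I2[of 1 1] eS[of 0] e0 by (simp add: add.commute)
  next
    case False
    then obtain c where c: "b = Suc c" "1 \<le> c" using b by (cases b) auto
    then show ?thesis using R1[of b] KS[of 1 c] I2[of 1 c] I2[of 1 "Suc c"] eS[of c] by simp
  qed
  \<comment> \<open>\<open>K\<close> has acquired the new variable in the legs only, so the product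
    has \<open>h\<close> in \<open>m\<close> and \<open>e\<close> in \<open>Suc m\<close> variables;
    the arms follow in \<open>C3\<close> by induction on \<open>a\<close>.\<close>
  have KK: "K a (Suc b) + K (Suc a) b = h m a * e (Suc m) b" if ab: "1 \<le> a" "1 \<le> b" for a b
  proof (cases "b = 1")
    case True
    have "K a (Suc b) + K (Suc a) b = (H a (Suc 1) + H (Suc a) 1) + x * H a 1"
      using KS[of a 1] K1[of "Suc a"] that True by (simp add: algebra_simps)
    also have "\<dots> = h m a * e m 1 + x * h m a" using I3[of a 1] I1[of a 1] that by simp
    also have "\<dots> = h m a * e (Suc m) b" using eS[of 0] e0 True by (simp add: algebra_simps)
    finally show ?thesis .
  next
    case False
    then obtain c where c: "b = Suc c" "1 \<le> c" using ab by (cases b) auto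
    have "K a (Suc b) + K (Suc a) b = (H a (Suc b) + H (Suc a) b) + x * (H a (Suc c) + H (Suc a) c)"
      using KS[of a b] KS[of "Suc a" c] that c by (simp add: algebra_simps)
    also have "\<dots> = h m a * e m b + x * (h m a * e m c)" using I3[of a b] I3[of a c] that c by simp
    also have "\<dots> = h m a * e (Suc m) b" using eS[of c] c by (simp add: algebra_simps)
    finally show ?thesis .
  qed
  have C3: "H' a (Suc b) + H' (Suc a) b = h (Suc m) a * e (Suc m) b" if "1 \<le> a" "1 \<le> b" for a b
    using that(1)
  proof (induction a rule: nat_induct_at_least)
    case base
    have "H' 1 (Suc b) + H' (Suc 1) b = x * H' 1 b + (K 1 (Suc b) + K (Suc 1) b)"
      using R1[of "Suc b"] R2[of 1 b] that(2) by (simp add: algebra_simps)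
    also have "\<dots> = x * e (Suc m) b + h m 1 * e (Suc m) b" using KK[of 1 b] C2[of b] that(2) by simp
    also have "\<dots> = h (Suc m) 1 * e (Suc m) b" using hS[of 0] h0 by (simp add: algebra_simps)
    finally show ?case .
  next
    case (Suc a)
    have "H' (Suc a) (Suc b) + H' (Suc (Suc a)) b =
      x * (H' a (Suc b) + H' (Suc a) b) + (K (Suc a) (Suc b) + K (Suc (Suc a)) b)"
      using R2[of a "Suc b"] R2[of "Suc a" b] that(2) Suc.hyps by (simp add: algebra_simps)
    also have "\<dots> = x * (h (Suc m) a * e (Suc m) b) + h m (Suc a) * e (Suc m) b"
      using KK[of "Suc a" b] Suc.IH that(2) by simp
    also have "\<dots> = h (Suc m) (Suc a) * e (Suc m) b" using hS[of a] by (simp add: algebra_simps)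
    finally show ?case .
  qed
  show ?case using C1[OF Suc.prems(1)] C2[OF Suc.prems(2)] C3[OF Suc.prems]
    by (simp add: H'_def h_def e_def)
qed

text \<open>Both arguments count the corner cell, like the entries of \<open>cs\<close> and
  \<open>es\<close>.\<close>

definition hook :: "nat \<Rightarrow> nat \<Rightarrow> 'a::comm_ring_1 mvps" where
  "hook a b = schur (of_frobenius [a - 1] [b - 1])"

lemma mvps_trunc_schur_frob:
  assumes "frob_pair cs es" "0 \<notin> set cs"
  shows "mvps_trunc m (schur (of_frobenius (map (\<lambda>c. c - 1) cs) (map (\<lambda>e. e - 1) es))) = schur_poly m (frob_diagram cs es)"
  using of_frobenius_diagram[OF assms] by (simp add: mvps_trunc_schur)

lemma mvps_trunc_hook: "1 \<le> a \<Longrightarrow> 1 \<le> b \<Longrightarrow> mvps_trunc m (hook a b) = hook_poly m a b"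
  using mvps_trunc_schur_frob[of "[a]" "[b]" m] by (simp add: hook_def frob_pair_singleton)

theorem giambelli:
  assumes "frob_pair cs es" "0 \<notin> set cs"
  shows "schur (of_frobenius (map (\<lambda>c. c - 1) cs) (map (\<lambda>e. e - 1) es)) = (minor hook cs es :: 'a::comm_ring_1 mvps)"
proof (rule mvps_eqI_trunc)
  fix m
  have len: "length cs = length es" and es: "0 \<notin> set es" using assms by (auto simp: frob_pair_def)
  have "mvps_trunc m (minor hook cs es) = (minor (\<lambda>a b. mvps_trunc m (hook a b)) cs es :: 'a mvps)"
    by (rule mvps_trunc.hom_minor[OF len])
  also have "\<dots> = minor (hook_poly m) cs es"
  proof (rule minor_cong[OF len])
    fix a b assume "a \<in> set cs" "b \<in> set es"
    then have "a \<noteq> 0" "b \<noteq> 0" using assms(2) es by metis+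
    then show "mvps_trunc m (hook a b) = (hook_poly m a b :: 'a mvps)" by (simp add: mvps_trunc_hook)
  qed
  also have "\<dots> = schur_poly m (frob_diagram cs es)" by (rule giambelli_poly[OF assms, symmetric])
  finally show "mvps_trunc m (schur (of_frobenius (map (\<lambda>c. c - 1) cs) (map (\<lambda>e. e - 1) es))) =
      (mvps_trunc m (minor hook cs es) :: 'a mvps)"
    by (simp only: mvps_trunc_schur_frob[OF assms])
qed

lemma
  fixes a b :: nat
  assumes "1 \<le> a" "1 \<le> b"
  shows hook_right_1: "hook a 1 = (hsym (int a) :: 'a::comm_ring_1 mvps)"
    and hook_left_1: "hook 1 b = (esym (int b) :: 'a mvps)"
    and hook_pieri: "hook a (Suc b) + hook (Suc a) b = hsym (int a) * (esym (int b) :: 'a mvps)"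
proof -
  note r = hook_poly_relations[OF assms, where 'a = 'a]
  show "hook a 1 = (hsym (int a) :: 'a mvps)"
    by (rule mvps_eqI_trunc) (use r assms in \<open>simp add: mvps_trunc_hook\<close>)
  show "hook 1 b = (esym (int b) :: 'a mvps)"
    by (rule mvps_eqI_trunc) (use r assms in \<open>simp add: mvps_trunc_hook\<close>)
  show "hook a (Suc b) + hook (Suc a) b = hsym (int a) * (esym (int b) :: 'a mvps)"
    by (rule mvps_eqI_trunc)
       (use r assms in \<open>simp add: mvps_trunc_hook mvps_trunc.hom_add mvps_trunc.hom_mult\<close>)
qed

section \<open>Totally symmetric plane partitions\<close>

text \<open>A totally symmetric plane partition is determined by its cubes with weakly increasing coordinates.\<close>

definition sorted_ideals :: "nat \<Rightarrow> (nat \<times> nat \<times> nat) set set" where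
  "sorted_ideals n = {P. (\<forall>i j l. (i, j, l) \<in> P \<longrightarrow> 1 \<le> i \<and> i \<le> j \<and> j \<le> l \<and> l \<le> n) \<and>
     (\<forall>i j l. (i, j, Suc l) \<in> P \<and> j \<le> l \<longrightarrow> (i, j, l) \<in> P) \<and>
     (\<forall>i j l. (i, Suc j, l) \<in> P \<and> i \<le> j \<longrightarrow> (i, j, l) \<in> P) \<and>
     (\<forall>i j l. (Suc i, j, l) \<in> P \<and> 1 \<le> i \<longrightarrow> (i, j, l) \<in> P)}"

text \<open>Because of the conjugation in \<open>tspp_diag\<close>, its cell (\<open>i\<close>,
  \<open>j\<close>) stands for the cube (\<open>j\<close>, \<open>j\<close>, \<open>i\<close>).
  Sorting this triple gives (\<open>i\<close>, \<open>j\<close>, \<open>j\<close>) if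
  \<open>i \<le> j\<close> and (\<open>j\<close>, \<open>j\<close>, \<open>i\<close>) otherwise; so
  \<open>low_diag\<close> and \<open>up_diag\<close> are the two halves of its diagram.\<close>

definition low_diag :: "(nat \<times> nat \<times> nat) set \<Rightarrow> (nat \<times> nat) set" where
  "low_diag P = {(i, j). (i, j, j) \<in> P}"

definition up_diag :: "(nat \<times> nat \<times> nat) set \<Rightarrow> (nat \<times> nat) set" where
  "up_diag P = {(i, l). (i, i, l) \<in> P}"

lemma sorted_idealsI:
  assumes "\<And>i j l. (i, j, l) \<in> P \<Longrightarrow> 1 \<le> i \<and> i \<le> j \<and> j \<le> l \<and> l \<le> n"
    "\<And>i j l. (i, j, Suc l) \<in> P \<Longrightarrow> j \<le> l \<Longrightarrow> (i, j, l) \<in> P"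
    "\<And>i j l. (i, Suc j, l) \<in> P \<Longrightarrow> i \<le> j \<Longrightarrow> (i, j, l) \<in> P"
    "\<And>i j l. (Suc i, j, l) \<in> P \<Longrightarrow> 1 \<le> i \<Longrightarrow> (i, j, l) \<in> P"
  shows "P \<in> sorted_ideals n"
  unfolding sorted_ideals_def mem_Collect_eq by (metis assms)

lemma
  assumes "P \<in> sorted_ideals n"
  shows sorted_ideals_bounds: "(i, j, l) \<in> P \<Longrightarrow> 1 \<le> i \<and> i \<le> j \<and> j \<le> l \<and> l \<le> n"
    and sorted_ideals_l: "(i, j, Suc l) \<in> P \<Longrightarrow> j \<le> l \<Longrightarrow> (i, j, l) \<in> P"
    and sorted_ideals_j: "(i, Suc j, l) \<in> P \<Longrightarrow> i \<le> j \<Longrightarrow> (i, j, l) \<in> P"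
    and sorted_ideals_i: "(Suc i, j, l) \<in> P \<Longrightarrow> 1 \<le> i \<Longrightarrow> (i, j, l) \<in> P"
  using assms unfolding sorted_ideals_def mem_Collect_eq by metis+

lemma sorted_ideals_subset: "P \<in> sorted_ideals n \<Longrightarrow> P \<subseteq> {0..n} \<times> {0..n} \<times> {0..n}"
  using sorted_ideals_bounds by fastforce

lemma finite_sorted_ideals: "finite (sorted_ideals n)"
  by (rule finite_subset[of _ "Pow ({0..n} \<times> {0..n} \<times> {0..n})"]) (use sorted_ideals_subset in auto)

lemma sorted_ideals_finite: "P \<in> sorted_ideals n \<Longrightarrow> finite P"
  using sorted_ideals_subset[of P n] by (rule finite_subset) auto

definition ideal_class :: "nat \<Rightarrow> nat list \<Rightarrow> nat list \<Rightarrow> (nat \<times> nat \<times> nat) set set" where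
  "ideal_class n cs es =
     {P \<in> sorted_ideals n. low_diag P = shifted_diagram cs \<and> up_diag P = shifted_diagram es}"

text \<open>Cells with \<open>j < l\<close> stay weakly increasing when \<open>l\<close> is lowered
  by one, and the result fits into a smaller box.\<close>

definition peel :: "(nat \<times> nat \<times> nat) set \<Rightarrow> (nat \<times> nat \<times> nat) set" where
  "peel P = {(i, j, l). j \<le> l \<and> (i, j, Suc l) \<in> P}"

text \<open>The layer \<open>j = l\<close> lost in peeling is the low diagonal, so \<open>cs\<close>
  is enough to restore it.\<close>

definition unpeel :: "nat list \<Rightarrow> (nat \<times> nat \<times> nat) set \<Rightarrow> (nat \<times> nat \<times> nat) set" where
  "unpeel cs P = {(i, j, l). (j = l \<and> (i, j) \<in> shifted_diagram cs) \<or> (j < l \<and> (i, j, l - 1) \<in> P)}"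

lemma peel_sorted_ideals:
  assumes "P \<in> sorted_ideals (Suc n)"
  shows "peel P \<in> sorted_ideals n"
proof (rule sorted_idealsI)
  show "1 \<le> i \<and> i \<le> j \<and> j \<le> l \<and> l \<le> n" if "(i, j, l) \<in> peel P" for i j l
    using that sorted_ideals_bounds[OF assms, of i j "Suc l"] by (simp add: peel_def)
  show "(i, j, l) \<in> peel P" if "(i, j, Suc l) \<in> peel P" "j \<le> l" for i j l
    using that sorted_ideals_l[OF assms, of i j "Suc l"] by (simp add: peel_def)
  show "(i, j, l) \<in> peel P" if "(i, Suc j, l) \<in> peel P" "i \<le> j" for i j l
    using that sorted_ideals_j[OF assms, of i j "Suc l"] by (simp add: peel_def)
  show "(i, j, l) \<in> peel P" if "(Suc i, j, l) \<in> peel P" "1 \<le> i" for i j l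
    using that sorted_ideals_i[OF assms, of i j "Suc l"] by (simp add: peel_def)
qed

lemma shifted_diagram_pred:
  "shifted_diagram (map (\<lambda>e. e - 1) es) = {(i, l). i \<le> l \<and> (i, Suc l) \<in> shifted_diagram es}"
  by (auto simp: shifted_diagram_def)

definition vertical_step :: "nat list \<Rightarrow> nat list \<Rightarrow> bool" where
  "vertical_step cs' cs \<longleftrightarrow> (\<forall>k<length cs'. cs ! k = cs' ! k \<or> cs ! k = Suc (cs' ! k))"

lemma vertical_step_iff:
  assumes "length cs' = length cs"
  shows "vertical_step cs' cs \<longleftrightarrow> shifted_diagram cs' \<subseteq> shifted_diagram cs \<and>
    (\<forall>i j. (i, Suc j) \<in> shifted_diagram cs \<and> i \<le> j \<longrightarrow> (i, j) \<in> shifted_diagram cs')"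
proof -
  have "cs ! k = cs' ! k \<or> cs ! k = Suc (cs' ! k) \<longleftrightarrow> cs' ! k \<le> cs ! k \<and> cs ! k \<le> Suc (cs' ! k)" for k
    by auto
  then show ?thesis
    unfolding vertical_step_def shifted_diagram_subset_iff[OF assms] shifted_diagram_shrink_row_iff[OF assms] assms
    by blast
qed

text \<open>The new low diagonal consists of those (\<open>i\<close>, \<open>j\<close>) with
  (\<open>i\<close>, \<open>j\<close>, \<open>Suc j\<close>) in \<open>P\<close>. It lies within the
  old one, since (\<open>i\<close>, \<open>j\<close>, \<open>j\<close>) is below that cell, and
  contains the old one moved left, since that cell is below (\<open>i\<close>, \<open>Suc j\<close>,
  \<open>Suc j\<close>); this is a vertical step. On the upper diagonal every row loses exactly one
  cell.\<close>

lemma peel_ideal_class: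
  assumes cs: "sorted_wrt (>) cs" "0 \<notin> set cs" and P: "P \<in> ideal_class (Suc n) cs es"
  obtains cs' where "sorted_wrt (>) cs'" "length cs' = length cs" "vertical_step cs' cs"
    "peel P \<in> ideal_class n cs' (map (\<lambda>e. e - 1) es)"
proof -
  have S: "P \<in> sorted_ideals (Suc n)" and low: "low_diag P = shifted_diagram cs" and up: "up_diag P = shifted_diagram es"
    using P by (auto simp: ideal_class_def)
  note b = sorted_ideals_bounds[OF S] and l = sorted_ideals_l[OF S] and j = sorted_ideals_j[OF S] and i = sorted_ideals_i[OF S]
  have S': "peel P \<in> sorted_ideals n" by (rule peel_sorted_ideals[OF S])
  have low_iff: "(i, j) \<in> low_diag (peel P) \<longleftrightarrow> (i, j, Suc j) \<in> P" for i j
    by (simp add: low_diag_def peel_def)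
  have cs_iff: "(i, j) \<in> shifted_diagram cs \<longleftrightarrow> (i, j, j) \<in> P" for i j
    using low by (auto simp: low_diag_def)
  have diag: "(i, i, i) \<in> P \<longleftrightarrow> 1 \<le> i \<and> i \<le> length cs" for i
    using diag_shifted_diagram_iff[OF cs(1), of i] cs(2) unfolding cs_iff by blast
  have "shifted_ideal (low_diag (peel P))"
  proof (rule shifted_idealI)
    show "finite (low_diag (peel P))"
      by (rule finite_subset[of _ "(\<lambda>(i, j, l). (i, j)) ` P"])
         (use sorted_ideals_finite[OF S] in \<open>force simp: low_diag_def peel_def\<close>)+
    show "1 \<le> i' \<and> i' \<le> j'" if "(i', j') \<in> low_diag (peel P)" for i' j'
      using that b[of i' j' "Suc j'"] unfolding low_iff by blast
    show "(i', j') \<in> low_diag (peel P)" if "(i', Suc j') \<in> low_diag (peel P)" "i' \<le> j'" for i' j'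
    proof -
      have "(i', j', Suc (Suc j')) \<in> P" using that j[of i' j' "Suc (Suc j')"] unfolding low_iff by blast
      then show ?thesis using l[of i' j' "Suc j'"] unfolding low_iff by simp
    qed
    show "(i', j') \<in> low_diag (peel P)" if "(Suc i', j') \<in> low_diag (peel P)" "1 \<le> i'" for i' j'
      using that i[of i' j' "Suc j'"] unfolding low_iff by blast
  qed
  then have "\<exists>cs'. sorted_wrt (>) cs' \<and> length cs' = length cs \<and> shifted_diagram cs' = low_diag (peel P)"
  proof (rule ex_shifted_diagram)
    show "k \<le> length cs" if "(k, k) \<in> low_diag (peel P)" for k
      using that l[of k k k] diag[of k] unfolding low_iff by blast
    show "(k, k) \<in> low_diag (peel P)" if "1 \<le> k" "k < length cs" for k
    proof -
      have "(Suc k, Suc k, Suc k) \<in> P" using diag[of "Suc k"] that by simp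
      then have "(k, Suc k, Suc k) \<in> P" using i that by blast
      then show ?thesis using j[of k k "Suc k"] unfolding low_iff by blast
    qed
  qed
  then obtain cs' where cs': "sorted_wrt (>) cs'" "length cs' = length cs" "shifted_diagram cs' = low_diag (peel P)"
    by blast
  have "vertical_step cs' cs"
    unfolding vertical_step_iff[OF cs'(2)] cs'(3)
  proof (intro conjI allI impI subsetI)
    fix p assume p: "p \<in> low_diag (peel P)"
    obtain i' j' where p': "p = (i', j')" by (cases p)
    show "p \<in> shifted_diagram cs" using p l[of i' j' j'] unfolding p' cs_iff low_iff by blast
  next
    fix i' j' assume "(i', Suc j') \<in> shifted_diagram cs \<and> i' \<le> j'"
    then show "(i', j') \<in> low_diag (peel P)" using j[of i' j' "Suc j'"] unfolding cs_iff low_iff by blast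
  qed
  moreover have "up_diag (peel P) = shifted_diagram (map (\<lambda>e. e - 1) es)"
    unfolding shifted_diagram_pred up[symmetric] by (auto simp: up_diag_def peel_def)
  ultimately show thesis using that[OF cs'(1,2)] S' cs'(3) by (simp add: ideal_class_def)
qed

lemma unpeel_ideal_class:
  assumes cs: "sorted_wrt (>) cs" "0 \<notin> set cs" and es: "sorted_wrt (>) es" "0 \<notin> set es" "set es \<subseteq> {1..Suc n}"
    and len: "length cs = length es" "length cs' = length cs" and step: "vertical_step cs' cs"
    and P: "P \<in> ideal_class n cs' (map (\<lambda>e. e - 1) es)"
  shows "unpeel cs P \<in> ideal_class (Suc n) cs es"
proof -
  have S: "P \<in> sorted_ideals n" and low: "low_diag P = shifted_diagram cs'"
    and up: "up_diag P = {(i, l). i \<le> l \<and> (i, Suc l) \<in> shifted_diagram es}"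
    using P unfolding ideal_class_def shifted_diagram_pred by blast+
  note b = sorted_ideals_bounds[OF S] and l = sorted_ideals_l[OF S] and j = sorted_ideals_j[OF S] and i = sorted_ideals_i[OF S]
  have sub: "(i, j) \<in> shifted_diagram cs' \<Longrightarrow> (i, j) \<in> shifted_diagram cs"
    and shrink: "(i, Suc j) \<in> shifted_diagram cs \<Longrightarrow> i \<le> j \<Longrightarrow> (i, j) \<in> shifted_diagram cs'" for i j
    using step unfolding vertical_step_iff[OF len(2)] by blast+
  have cs'_iff: "(i, j) \<in> shifted_diagram cs' \<longleftrightarrow> (i, j, j) \<in> P" for i j
    using low by (auto simp: low_diag_def)
  have es'_iff: "i \<le> l \<and> (i, Suc l) \<in> shifted_diagram es \<longleftrightarrow> (i, i, l) \<in> P" for i l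
    using up by (auto simp: up_diag_def)
  have mem_eq: "(i, j, j) \<in> unpeel cs P \<longleftrightarrow> (i, j) \<in> shifted_diagram cs" for i j by (simp add: unpeel_def)
  have mem_lt: "(i, j, Suc l) \<in> unpeel cs P \<longleftrightarrow> (i, j, l) \<in> P" if "j \<le> l" for i j l
    using that by (auto simp: unpeel_def)
  have ideal: "shifted_ideal (shifted_diagram cs)" by (rule shifted_ideal_shifted_diagram[OF cs(1)])
  \<comment> \<open>The corner cells (\<open>i\<close>, \<open>i\<close>, \<open>i\<close>) do not
    come from \<open>P\<close>; that they fit into the box follows from the number of entries of
    \<open>es\<close>.\<close>
  have "card (set es) \<le> card {1..Suc n}" by (rule card_mono) (use es in auto)
  then have le: "length es \<le> Suc n" using distinct_card[OF dec_list_distinct[OF es(1)]] by simp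
  have le_l: "j' \<le> l'" if "(i', j', l') \<in> unpeel cs P" for i' j' l' using that by (auto simp: unpeel_def)
  have "unpeel cs P \<in> sorted_ideals (Suc n)"
  proof (rule sorted_idealsI)
    fix i' j' l' assume mem: "(i', j', l') \<in> unpeel cs P"
    show "1 \<le> i' \<and> i' \<le> j' \<and> j' \<le> l' \<and> l' \<le> Suc n"
    proof (cases "j' = l'")
      case True
      then have c: "(i', j') \<in> shifted_diagram cs" using mem mem_eq by simp
      note pos = shifted_diagram_pos[OF c]
      have "j' \<le> Suc n"
      proof (cases "i' = j'")
        case True
        then show ?thesis using pos le len by simp
      next
        case False
        then obtain k where k: "j' = Suc k" "i' \<le> k" using pos by (cases j') auto
        then have "(i', k, k) \<in> P" using shrink[of i' k] c cs'_iff by simp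
        then show ?thesis using b[of i' k k] k by simp
      qed
      then show ?thesis using True pos by simp
    next
      case False
      then obtain k where k: "l' = Suc k" "j' \<le> k" using le_l[OF mem] by (cases l') auto
      then have "(i', j', k) \<in> P" using mem mem_lt by simp
      then show ?thesis using b[of i' j' k] k by simp
    qed
  next
    fix i' j' l' assume mem: "(i', j', Suc l') \<in> unpeel cs P" "j' \<le> l'"
    then have m: "(i', j', l') \<in> P" using mem_lt by simp
    show "(i', j', l') \<in> unpeel cs P"
    proof (cases "j' = l'")
      case True
      then show ?thesis using m cs'_iff sub mem_eq by simp
    next
      case False
      then obtain k where "l' = Suc k" "j' \<le> k" using mem(2) by (cases l') auto
      then show ?thesis using m mem_lt l by simp
    qed
  next
    fix i' j' l' assume mem: "(i', Suc j', l') \<in> unpeel cs P" "i' \<le> j'"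
    obtain k where k: "l' = Suc k" "j' \<le> k" using le_l[OF mem(1)] by (cases l') auto
    have "(i', j', k) \<in> P"
    proof (cases "j' = k")
      case True
      then show ?thesis using mem mem_eq shrink cs'_iff k by simp
    next
      case False
      then have "(i', Suc j', k) \<in> P" using mem(1) k mem_lt[of "Suc j'" k i'] by simp
      then show ?thesis using j mem(2) by blast
    qed
    then show "(i', j', l') \<in> unpeel cs P" using k mem_lt by simp
  next
    fix i' j' l' assume mem: "(Suc i', j', l') \<in> unpeel cs P" "1 \<le> i'"
    show "(i', j', l') \<in> unpeel cs P"
    proof (cases "j' = l'")
      case True
      then show ?thesis using mem mem_eq shifted_ideal_col[OF ideal, of i' j'] by simp
    next
      case False
      then obtain k where k: "l' = Suc k" "j' \<le> k" using le_l[OF mem(1)] by (cases l') auto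
      then show ?thesis using mem mem_lt i[of i' j' k] by simp
    qed
  qed
  moreover have "low_diag (unpeel cs P) = shifted_diagram cs"
    by (auto simp: low_diag_def mem_eq)
  moreover have "(i', l') \<in> up_diag (unpeel cs P) \<longleftrightarrow> (i', l') \<in> shifted_diagram es" for i' l'
  proof -
    consider "l' < i'" | "l' = i'" | k where "l' = Suc k" "i' \<le> k"
      by (metis less_Suc_eq_le linorder_neqE_nat not0_implies_Suc not_less0)
    then show ?thesis
    proof cases
      case 1
      then show ?thesis using le_l[of i' i' l'] shifted_diagram_pos[of i' l' es] by (auto simp: up_diag_def)
    next
      case 2
      then show ?thesis
        using diag_shifted_diagram_iff[OF cs(1), of i'] diag_shifted_diagram_iff[OF es(1), of i'] cs es len
        by (simp add: up_diag_def mem_eq)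
    next
      case 3
      then show ?thesis using es'_iff[of i' k] mem_lt[of i' k i'] by (simp add: up_diag_def)
    qed
  qed
  ultimately show ?thesis by (auto simp: ideal_class_def)
qed

lemma ideal_class_disjoint:
  assumes "length cs = length cs'" "cs \<noteq> cs'"
  shows "ideal_class n cs es \<inter> ideal_class n cs' es' = {}"
  using shifted_diagram_inject[of cs cs'] assms unfolding ideal_class_def by blast

lemma finite_ideal_class: "finite (ideal_class n cs es)"
  using finite_sorted_ideals by (auto simp: ideal_class_def)

text \<open>Peeling is a bijection onto a disjoint union, which is indexed by the low diagonals that
  can arise.\<close>

lemma card_ideal_class_Suc:
  assumes cs: "sorted_wrt (>) cs" "0 \<notin> set cs" and es: "sorted_wrt (>) es" "0 \<notin> set es" "set es \<subseteq> {1..Suc n}"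
    and len: "length cs = length es" and C: "\<And>c. c \<in> set cs \<Longrightarrow> c \<le> C"
  shows "card (ideal_class (Suc n) cs es) =
    (\<Sum>cs'\<in>dec_lists {0..C} (length cs). if vertical_step cs' cs then card (ideal_class n cs' (map (\<lambda>e. e - 1) es)) else 0)"
proof -
  let ?es = "map (\<lambda>e. e - 1) es"
  define L where "L = {cs' \<in> dec_lists {0..C} (length cs). vertical_step cs' cs}"
  have finD: "finite (dec_lists {0..C} (length cs))" by (rule finite_dec_lists) simp
  then have finL: "finite L" by (simp add: L_def)
  have lenL: "length cs' = length cs" if "cs' \<in> L" for cs' using that by (simp add: L_def dec_lists_def)
  have "bij_betw peel (ideal_class (Suc n) cs es) (\<Union>cs'\<in>L. ideal_class n cs' ?es)"
  proof (rule bij_betw_byWitness[where f' = "unpeel cs"])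
    show "\<forall>P\<in>ideal_class (Suc n) cs es. unpeel cs (peel P) = P"
    proof
      fix P assume P: "P \<in> ideal_class (Suc n) cs es"
      then have S: "P \<in> sorted_ideals (Suc n)" and low: "low_diag P = shifted_diagram cs" by (auto simp: ideal_class_def)
      have "(i, j, l) \<in> unpeel cs (peel P) \<longleftrightarrow> (i, j, l) \<in> P" for i j l
      proof -
        consider "l < j" | "l = j" | "j < l" by linarith
        then show ?thesis
        proof cases
          case 1
          then show ?thesis using sorted_ideals_bounds[OF S, of i j l] by (auto simp: unpeel_def)
        next
          case 2
          then show ?thesis unfolding unpeel_def low[symmetric] by (simp add: low_diag_def)
        next
          case 3
          then obtain k where "l = Suc k" "j \<le> k" by (cases l) auto
          then show ?thesis by (simp add: unpeel_def peel_def)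
        qed
      qed
      then show "unpeel cs (peel P) = P" by auto
    qed
    show "\<forall>P\<in>\<Union>cs'\<in>L. ideal_class n cs' ?es. peel (unpeel cs P) = P"
    proof
      fix P assume "P \<in> (\<Union>cs'\<in>L. ideal_class n cs' ?es)"
      then have S: "P \<in> sorted_ideals n" by (auto simp: ideal_class_def)
      have "(i, j, l) \<in> peel (unpeel cs P) \<longleftrightarrow> (i, j, l) \<in> P" for i j l
        using sorted_ideals_bounds[OF S, of i j l] by (auto simp: unpeel_def peel_def)
      then show "peel (unpeel cs P) = P" by auto
    qed
    show "peel ` ideal_class (Suc n) cs es \<subseteq> (\<Union>cs'\<in>L. ideal_class n cs' ?es)"
    proof (rule image_subsetI)
      fix P assume P: "P \<in> ideal_class (Suc n) cs es"
      obtain cs' where cs': "sorted_wrt (>) cs'" "length cs' = length cs" "vertical_step cs' cs"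
        "peel P \<in> ideal_class n cs' ?es" by (rule peel_ideal_class[OF cs P])
      have "c \<le> C" if c: "c \<in> set cs'" for c
      proof -
        obtain k where k: "k < length cs'" "c = cs' ! k" using c by (metis in_set_conv_nth)
        have "cs ! k \<le> C" using C[of "cs ! k"] nth_mem[of k cs] k cs'(2) by simp
        moreover have "cs' ! k \<le> cs ! k" using cs'(3) k(1) unfolding vertical_step_def by fastforce
        ultimately show ?thesis using k by simp
      qed
      then have "cs' \<in> L" using cs' by (auto simp: L_def dec_lists_def)
      then show "peel P \<in> (\<Union>cs'\<in>L. ideal_class n cs' ?es)" using cs' by blast
    qed
    show "unpeel cs ` (\<Union>cs'\<in>L. ideal_class n cs' ?es) \<subseteq> ideal_class (Suc n) cs es"
    proof (rule image_subsetI)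
      fix P assume "P \<in> (\<Union>cs'\<in>L. ideal_class n cs' ?es)"
      then obtain cs' where cs': "cs' \<in> L" "P \<in> ideal_class n cs' ?es" by blast
      then show "unpeel cs P \<in> ideal_class (Suc n) cs es"
        using unpeel_ideal_class[OF cs es len lenL[OF cs'(1)] _ cs'(2)] by (simp add: L_def)
    qed
  qed
  then have "card (ideal_class (Suc n) cs es) = card (\<Union>cs'\<in>L. ideal_class n cs' ?es)" by (rule bij_betw_same_card)
  also have "\<dots> = (\<Sum>cs'\<in>L. card (ideal_class n cs' ?es))"
    by (rule card_UN_disjoint) (use finL lenL ideal_class_disjoint in \<open>auto simp: finite_ideal_class\<close>)
  also have "\<dots> = (\<Sum>cs'\<in>dec_lists {0..C} (length cs). if vertical_step cs' cs then card (ideal_class n cs' ?es) else 0)"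
    unfolding L_def by (rule sum.inter_filter[OF finD])
  finally show ?thesis .
qed

section \<open>Counting order ideals by minors of the binomial matrix\<close>

definition binomial_matrix :: "nat \<Rightarrow> nat \<Rightarrow> 'a::comm_ring_1" where
  "binomial_matrix e c = of_nat ((e - 1) choose (c - 1))"

text \<open>Pascal's rule in matrix form. The border supplies the edges of the triangle: for
  \<open>e = 1\<close> the only nonzero entry comes from the corner, and for \<open>c = 1\<close>
  and larger \<open>e\<close> the column 0 contributes nothing.\<close>

lemma binomial_matrix_step:
  assumes "1 \<le> e" "1 \<le> c" "c \<le> C"
  shows "binomial_matrix e c =
    (\<Sum>c'\<in>{0..C}. bordered binomial_matrix (e - 1) c' * (if c = c' \<or> c = Suc c' then 1 else 0 :: 'a::comm_ring_1))"
proof -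
  have "(\<Sum>c'\<in>{0..C}. bordered binomial_matrix (e - 1) c' * (if c = c' \<or> c = Suc c' then 1 else 0 :: 'a)) =
    (\<Sum>c'\<in>{c, c - 1}. bordered binomial_matrix (e - 1) c' * (if c = c' \<or> c = Suc c' then 1 else 0))"
    by (rule sum.mono_neutral_right) (use assms in auto)
  also have "\<dots> = bordered binomial_matrix (e - 1) c + bordered binomial_matrix (e - 1) (c - 1)"
    using assms by simp
  also have "\<dots> = binomial_matrix e c"
  proof (cases "e = 1")
    case True
    show ?thesis
    proof (cases "c = 1")
      case True
      then show ?thesis using \<open>e = 1\<close> by (simp add: bordered_0_left binomial_matrix_def)
    next
      case False
      then have "c - 1 \<noteq> 0" "c \<noteq> 0" using assms by auto
      then show ?thesis using \<open>e = 1\<close> by (simp add: bordered_0_left binomial_matrix_def binomial_eq_0)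
    qed
  next
    case False
    then obtain e' where e: "e = Suc (Suc e')" using assms(1) by (cases e; cases "e - 1") auto
    show ?thesis
    proof (cases "c = 1")
      case True
      then show ?thesis by (simp add: e bordered_pos bordered_0_right binomial_matrix_def)
    next
      case False
      then obtain c' where c: "c = Suc (Suc c')" using assms(2) by (cases c; cases "c - 1") auto
      then show ?thesis by (simp add: e bordered_pos binomial_matrix_def add.commute)
    qed
  qed
  finally show ?thesis by simp
qed

lemma ideal_class_snoc_0: "ideal_class n (us @ [0]) (vs @ [0]) = ideal_class n us vs"
  by (simp add: ideal_class_def shifted_diagram_snoc_0)

text \<open>The cell (\<open>d\<close>, \<open>d\<close>, \<open>d\<close>) lies on both diagonals
  or on neither.\<close>

lemma ideal_class_disagree:
  assumes "sorted_wrt (>) cs" "sorted_wrt (>) es" "length cs = length es" "(0 \<in> set cs) \<noteq> (0 \<in> set es)"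
  shows "ideal_class n cs es = {}"
proof -
  let ?d = "length cs"
  have "1 \<le> ?d" using assms(3,4) by (cases cs; cases es) auto
  then have "(?d, ?d) \<in> shifted_diagram cs \<longleftrightarrow> (?d, ?d) \<notin> shifted_diagram es"
    using diag_shifted_diagram_iff[OF assms(1), of ?d] diag_shifted_diagram_iff[OF assms(2), of ?d] assms(3,4) by auto
  then have "\<not> (low_diag P = shifted_diagram cs \<and> up_diag P = shifted_diagram es)" for P
    by (auto simp: low_diag_def up_diag_def)
  then show ?thesis unfolding ideal_class_def by blast
qed

text \<open>Peeling lowers every entry of \<open>es\<close> by one and lets \<open>cs\<close> arise
  from \<open>cs'\<close> by a vertical step. By Pascal's rule the binomial matrix is the bordered
  one with lowered row index times the matrix of such steps, so Cauchy--Binet gives its minors the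
  same recursion.\<close>

lemma card_ideal_class:
  assumes "sorted_wrt (>) cs" "0 \<notin> set cs" "sorted_wrt (>) es" "0 \<notin> set es" "set es \<subseteq> {1..n}" "length cs = length es"
  shows "of_nat (card (ideal_class n cs es)) = (minor binomial_matrix es cs :: 'a::comm_ring_1)"
  using assms
proof (induction n arbitrary: cs es)
  case 0
  then have "cs = []" "es = []" by auto
  have "ideal_class 0 [] [] = {{}}"
  proof (intro equalityI subsetI)
    fix P assume "P \<in> ideal_class 0 [] []"
    then have "P \<in> sorted_ideals 0" by (simp add: ideal_class_def)
    then have "(i, j, l) \<notin> P" for i j l using sorted_ideals_bounds[of P 0 i j l] by auto
    then show "P \<in> {{}}" by auto
  next
    fix P :: "(nat \<times> nat \<times> nat) set" assume "P \<in> {{}}"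
    then show "P \<in> ideal_class 0 [] []"
      by (auto simp: ideal_class_def sorted_ideals_def low_diag_def up_diag_def shifted_diagram_def)
  qed
  then show ?case using \<open>cs = []\<close> \<open>es = []\<close> by simp
next
  case (Suc n)
  let ?es = "map (\<lambda>e. e - 1) es"
  define C where "C = Max (set cs)"
  have C: "c \<le> C" if "c \<in> set cs" for c using that by (simp add: C_def)
  define L where "L = dec_lists {0..C} (length cs)"
  let ?E = "\<lambda>c' c. if c = c' \<or> c = Suc c' then 1 else 0 :: 'a"
  have L: "sorted_wrt (>) K" "length K = length cs" if "K \<in> L" for K
    using that by (auto simp: L_def dec_lists_def)
  have es_pos: "1 \<le> e" "e \<le> Suc n" if "e \<in> set es" for e using Suc.prems(5) that by auto
  have srt: "sorted_wrt (>) ?es"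
    unfolding sorted_wrt_map using Suc.prems(3)
    by (rule sorted_wrt_mono_rel[rotated]) (use es_pos in fastforce)
  have ges: "set ?es \<subseteq> {0..n}" using es_pos by fastforce
  have IH: "of_nat (card (ideal_class n cs' ?es)) = (minor (bordered binomial_matrix) ?es cs' :: 'a)"
    if "cs' \<in> L" for cs'
  proof -
    note s = L[OF that]
    have l: "length cs' = length ?es" using s Suc.prems(6) by simp
    consider "0 \<in> set cs'" "0 \<in> set ?es" | "0 \<notin> set cs'" "0 \<notin> set ?es" | "(0 \<in> set cs') \<noteq> (0 \<in> set ?es)" by blast
    then show ?thesis
    proof cases
      case 1
      obtain us where us: "cs' = us @ [0]" "0 \<notin> set us" "sorted_wrt (>) us" using dec_list_zero_last[OF s(1) 1(1)] .
      obtain vs where vs: "?es = vs @ [0]" "0 \<notin> set vs" "sorted_wrt (>) vs" using dec_list_zero_last[OF srt 1(2)] .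
      have l': "length us = length vs" using l unfolding us vs by simp
      have sub: "set vs \<subseteq> {1..n}"
      proof
        fix v assume v: "v \<in> set vs"
        then have "v \<noteq> 0" using vs(2) by metis
        moreover have "v \<le> n" using ges v unfolding vs(1) by auto
        ultimately show "v \<in> {1..n}" by simp
      qed
      show ?thesis unfolding us(1) vs(1) ideal_class_snoc_0
        using Suc.IH[OF us(3,2) vs(3,2) sub l'] minor_bordered_snoc[OF l'[symmetric] vs(2) us(2), of "binomial_matrix :: _ \<Rightarrow> _ \<Rightarrow> 'a"] by simp
    next
      case 2
      have sub: "set ?es \<subseteq> {1..n}"
      proof
        fix v assume v: "v \<in> set ?es"
        then have "v \<noteq> 0" using 2(2) by metis
        then show "v \<in> {1..n}" using ges v by auto
      qed
      show ?thesis
        using Suc.IH[OF s(1) 2(1) srt 2(2) sub l] minor_bordered_pos[OF l[symmetric] 2(2,1), of "binomial_matrix :: _ \<Rightarrow> _ \<Rightarrow> 'a"] by simp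
    next
      case 3
      have "minor (bordered binomial_matrix) ?es cs' = (0 :: 'a)"
        by (rule minor_bordered_disagree[OF l[symmetric]]) (use 3 in blast)
      then show ?thesis using ideal_class_disagree[OF s(1) srt l 3] by simp
    qed
  qed
  \<comment> \<open>With all weights equal to 1, the transfer minor is the indicator function of
    vertical steps.\<close>
  have step: "minor ?E cs' cs = (if vertical_step cs' cs then 1 else 0 :: 'a)" if "cs' \<in> L" for cs'
  proof -
    have "minor ?E cs' cs = (if \<forall>i<length cs'. cs ! i = cs' ! i \<or> cs ! i = Suc (cs' ! i)
      then \<Prod>i<length cs'. 1 else 0 :: 'a)"
      by (rule minor_shift) (use L[OF that] Suc.prems in simp_all)
    then show ?thesis unfolding vertical_step_def by simp
  qed
  have "(of_nat (card (ideal_class (Suc n) cs es)) :: 'a) =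
    of_nat (\<Sum>cs'\<in>L. if vertical_step cs' cs then card (ideal_class n cs' ?es) else 0)"
    unfolding L_def using card_ideal_class_Suc[OF Suc.prems(1-6) C] by simp
  also have "\<dots> = (\<Sum>cs'\<in>L. of_nat (card (ideal_class n cs' ?es)) * (if vertical_step cs' cs then 1 else 0))"
    unfolding of_nat_sum by (intro sum.cong) auto
  also have "\<dots> = (\<Sum>cs'\<in>L. minor (bordered binomial_matrix) ?es cs' * minor ?E cs' cs)"
    by (intro sum.cong refl) (simp only: IH step)
  also have "\<dots> = (\<Sum>cs'\<in>L. minor (\<lambda>e c'. bordered binomial_matrix (e - 1) c') es cs' * minor ?E cs' cs)"
  proof (intro sum.cong refl)
    fix cs' assume "cs' \<in> L"
    then have "length es = length cs'" using L(2) Suc.prems(6) by simp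
    then show "minor (bordered binomial_matrix) ?es cs' * minor ?E cs' cs =
      minor (\<lambda>e c'. bordered binomial_matrix (e - 1) c') es cs' * minor ?E cs' cs"
      using minor_map[of es cs' "bordered binomial_matrix :: _ \<Rightarrow> _ \<Rightarrow> 'a" "\<lambda>e. e - 1" id] by simp
  qed
  also have "\<dots> = minor (\<lambda>e c. \<Sum>c'\<in>{0..C}. bordered binomial_matrix (e - 1) c' * ?E c' c) es cs"
    unfolding L_def Suc.prems(6) by (rule cauchy_binet[symmetric]) (use Suc.prems(6) in auto)
  also have "\<dots> = minor binomial_matrix es cs"
  proof (rule minor_cong)
    fix e c assume ec: "e \<in> set es" "c \<in> set cs"
    have "c \<noteq> 0" using ec Suc.prems(2) by metis
    then show "(\<Sum>c'\<in>{0..C}. bordered binomial_matrix (e - 1) c' * ?E c' c) = binomial_matrix e c"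
      by (intro binomial_matrix_step[symmetric] es_pos[OF ec(1)] C[OF ec(2)]) simp
  qed (use Suc.prems(6) in simp)
  finally show ?case .
qed

section \<open>Totally symmetric plane partitions as order ideals\<close>

definition sorted_cubes :: "(nat \<Rightarrow> nat \<Rightarrow> nat) \<Rightarrow> (nat \<times> nat \<times> nat) set" where
  "sorted_cubes T = {(i, j, l). 1 \<le> i \<and> i \<le> j \<and> j \<le> l \<and> l \<le> T i j}"

lemma tspp_zero: "T \<in> tspp n \<Longrightarrow> \<not> (i \<in> {1..n} \<and> j \<in> {1..n}) \<Longrightarrow> T i j = 0"
  by (simp add: tspp_def plane_partitions_def)

lemma tspp_le: "T \<in> tspp n \<Longrightarrow> T i j \<le> n"
  using tspp_zero[of T n i j] by (cases "i \<in> {1..n} \<and> j \<in> {1..n}") (auto simp: tspp_def plane_partitions_def)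

lemma cubes_iff:
  assumes "T \<in> tspp n"
  shows "(i, j, l) \<in> cubes n T \<longleftrightarrow> 1 \<le> l \<and> l \<le> T i j"
proof (cases "i \<in> {1..n} \<and> j \<in> {1..n}")
  case False
  then show ?thesis using tspp_zero[OF assms False] by (auto simp: cubes_def)
qed (auto simp: cubes_def)

lemma cubes_swap:
  assumes "T \<in> tspp n"
  shows "(i, j, l) \<in> cubes n T \<longleftrightarrow> (j, i, l) \<in> cubes n T"
proof -
  have "T i j = T j i"
  proof (cases "i \<in> {1..n} \<and> j \<in> {1..n}")
    case True
    then show ?thesis using assms by (simp add: tspp_def)
  next
    case False
    then show ?thesis using tspp_zero[OF assms, of i j] tspp_zero[OF assms, of j i] by auto
  qed
  then show ?thesis by (simp add: cubes_iff[OF assms])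
qed

lemma cubes_rotate:
  assumes "T \<in> tspp n"
  shows "(i, j, l) \<in> cubes n T \<longleftrightarrow> (j, l, i) \<in> cubes n T"
proof -
  have im: "(\<lambda>(i, j, l). (j, l, i)) ` cubes n T = cubes n T" using assms by (simp add: tspp_def)
  have r: "(j, l, i) \<in> cubes n T" if "(i, j, l) \<in> cubes n T" for i j l
    using imageI[OF that, of "\<lambda>(i, j, l). (j, l, i)"] im by simp
  \<comment> \<open>Three rotations are the identity, so the inclusion can be reversed.\<close>
  show ?thesis using r[of i j l] r[of j l i] r[of l i j] by blast
qed

lemma cubes_down:
  assumes "T \<in> tspp n" "(i, j, Suc l) \<in> cubes n T" "1 \<le> l"
  shows "(i, j, l) \<in> cubes n T"
  using assms by (simp add: cubes_iff)

lemma sorted_cubes_iff: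
  assumes "T \<in> tspp n" "1 \<le> i" "i \<le> j" "j \<le> l"
  shows "(i, j, l) \<in> sorted_cubes T \<longleftrightarrow> (i, j, l) \<in> cubes n T"
  using assms by (simp add: sorted_cubes_def cubes_iff)

text \<open>Only the last coordinate can be lowered by definition; the others are rotated into the
  last place and back.\<close>

lemma sorted_cubes_sorted_ideal:
  assumes T: "T \<in> tspp n"
  shows "sorted_cubes T \<in> sorted_ideals n"
proof (rule sorted_idealsI)
  show "1 \<le> i \<and> i \<le> j \<and> j \<le> l \<and> l \<le> n" if "(i, j, l) \<in> sorted_cubes T" for i j l
    using that tspp_le[OF T, of i j] by (simp add: sorted_cubes_def)
  show "(i, j, l) \<in> sorted_cubes T" if "(i, j, Suc l) \<in> sorted_cubes T" "j \<le> l" for i j l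
    using that by (simp add: sorted_cubes_def)
  show "(i, j, l) \<in> sorted_cubes T" if m: "(i, Suc j, l) \<in> sorted_cubes T" "i \<le> j" for i j l
  proof -
    have b: "1 \<le> i" "Suc j \<le> l" using m by (auto simp: sorted_cubes_def)
    then have "(i, Suc j, l) \<in> cubes n T" using sorted_cubes_iff[OF T, of i "Suc j" l] m by simp
    then have "(l, i, Suc j) \<in> cubes n T" using cubes_rotate[OF T] by blast
    then have "(l, i, j) \<in> cubes n T" using cubes_down[OF T] b m(2) by simp
    then have "(i, j, l) \<in> cubes n T" using cubes_rotate[OF T] by blast
    then show ?thesis using sorted_cubes_iff[OF T, of i j l] b m(2) by simp
  qed
  show "(i, j, l) \<in> sorted_cubes T" if m: "(Suc i, j, l) \<in> sorted_cubes T" "1 \<le> i" for i j l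
  proof -
    have b: "Suc i \<le> j" "j \<le> l" using m by (auto simp: sorted_cubes_def)
    then have "(Suc i, j, l) \<in> cubes n T" using sorted_cubes_iff[OF T, of "Suc i" j l] m by simp
    then have "(j, l, Suc i) \<in> cubes n T" using cubes_rotate[OF T] by blast
    then have "(j, l, i) \<in> cubes n T" using cubes_down[OF T] m(2) by simp
    then have "(i, j, l) \<in> cubes n T" using cubes_rotate[OF T] by blast
    then show ?thesis using sorted_cubes_iff[OF T, of i j l] b m(2) by simp
  qed
qed

definition perm_closure :: "(nat \<times> nat \<times> nat) set \<Rightarrow> (nat \<times> nat \<times> nat) set" where
  "perm_closure P = {(i, j, l). (i, j, l) \<in> P \<or> (i, l, j) \<in> P \<or> (j, i, l) \<in> P \<or>
     (j, l, i) \<in> P \<or> (l, i, j) \<in> P \<or> (l, j, i) \<in> P}"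

lemma cubes_eq_perm_closure:
  assumes T: "T \<in> tspp n"
  shows "cubes n T = perm_closure (sorted_cubes T)"
proof -
  have "(i, j, l) \<in> cubes n T \<longleftrightarrow> (i, j, l) \<in> perm_closure (sorted_cubes T)" for i j l
  proof
    assume c: "(i, j, l) \<in> cubes n T"
    have sc: "(a, b, c) \<in> sorted_cubes T" if "(a, b, c) \<in> cubes n T" "a \<le> b" "b \<le> c" for a b c
      using that sorted_cubes_iff[OF T, of a b c] by (auto simp: cubes_def)
    have p: "(i, l, j) \<in> cubes n T" "(j, i, l) \<in> cubes n T" "(j, l, i) \<in> cubes n T"
      "(l, i, j) \<in> cubes n T" "(l, j, i) \<in> cubes n T"
      using c cubes_rotate[OF T] cubes_swap[OF T] by blast+
    show "(i, j, l) \<in> perm_closure (sorted_cubes T)"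
      unfolding perm_closure_def mem_Collect_eq prod.case
      using sc[OF c] sc[OF p(1)] sc[OF p(2)] sc[OF p(3)] sc[OF p(4)] sc[OF p(5)] nat_le_linear by blast
  next
    have sub: "(a, b, c) \<in> cubes n T" if "(a, b, c) \<in> sorted_cubes T" for a b c
      using that by (auto simp: sorted_cubes_def cubes_iff[OF T])
    assume "(i, j, l) \<in> perm_closure (sorted_cubes T)"
    then have "(i, j, l) \<in> cubes n T \<or> (i, l, j) \<in> cubes n T \<or> (j, i, l) \<in> cubes n T \<or>
     (j, l, i) \<in> cubes n T \<or> (l, i, j) \<in> cubes n T \<or> (l, j, i) \<in> cubes n T"
      unfolding perm_closure_def mem_Collect_eq prod.case using sub by blast
    then show "(i, j, l) \<in> cubes n T" using cubes_rotate[OF T] cubes_swap[OF T] by blast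
  qed
  then show ?thesis by auto
qed

text \<open>Lowering the smallest coordinate first keeps all intermediate triples weakly
  increasing.\<close>

lemma sorted_ideals_down:
  assumes P: "P \<in> sorted_ideals n" and m: "(a, b, c) \<in> P" and "1 \<le> a'" "a' \<le> b'" "b' \<le> c'" "a' \<le> a" "b' \<le> b" "c' \<le> c"
  shows "(a', b', c') \<in> P"
proof -
  note bd = sorted_ideals_bounds[OF P m]
  have 1: "(a', b, c) \<in> P"
    using \<open>a' \<le> a\<close> \<open>1 \<le> a'\<close> by (induction rule: inc_induct) (use m sorted_ideals_i[OF P] in simp_all)
  have 2: "(a', b', c) \<in> P"
    using \<open>b' \<le> b\<close> \<open>a' \<le> b'\<close> by (induction rule: inc_induct) (use 1 sorted_ideals_j[OF P] in simp_all)
  show ?thesis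
    using \<open>c' \<le> c\<close> \<open>b' \<le> c'\<close> by (induction rule: inc_induct) (use 2 sorted_ideals_l[OF P] in simp_all)
qed

lemma perm_closure_down:
  assumes P: "P \<in> sorted_ideals n" and m: "(i, j, Suc l) \<in> perm_closure P" "1 \<le> l"
  shows "(i, j, l) \<in> perm_closure P"
proof -
  note d = sorted_ideals_down[OF P] and b = sorted_ideals_bounds[OF P]
  \<comment> \<open>Lowering \<open>Suc l\<close> may spoil the order of the sorted triple. Then
    \<open>l\<close> moves to the left past \<open>x\<close> or \<open>y\<close>, and the rearranged
    triple is still componentwise below the old one.\<close>
  have *: "(x, y, l) \<in> P \<or> (x, l, y) \<in> P \<or> (l, x, y) \<in> P"
    if "(x, y, Suc l) \<in> P \<or> (x, Suc l, y) \<in> P \<or> (Suc l, x, y) \<in> P" for x y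
    using that
  proof (elim disjE)
    assume p: "(x, y, Suc l) \<in> P"
    show ?thesis using b[OF p] d[OF p, of x y l] d[OF p, of x l y] d[OF p, of l x y] m(2) by linarith
  next
    assume p: "(x, Suc l, y) \<in> P"
    show ?thesis using b[OF p] d[OF p, of x l y] d[OF p, of l x y] m(2) by linarith
  next
    assume p: "(Suc l, x, y) \<in> P"
    show ?thesis using b[OF p] d[OF p, of l x y] m(2) by linarith
  qed
  show ?thesis using m(1) *[of i j] *[of j i] unfolding perm_closure_def mem_Collect_eq prod.case by blast
qed

lemma ex_tspp:
  assumes P: "P \<in> sorted_ideals n"
  shows "\<exists>T\<in>tspp n. sorted_cubes T = P"
proof -
  let ?Q = "perm_closure P"
  \<comment> \<open>The heights of the columns of cubes. By closure under lowering each column is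
    gapless, so \<open>T\<close> has exactly the cubes \<open>?Q\<close>.\<close>
  define T where "T i j = card {l. (i, j, l) \<in> ?Q}" for i j
  note b = sorted_ideals_bounds[OF P]
  have swap: "(i, j, l) \<in> ?Q \<longleftrightarrow> (j, i, l) \<in> ?Q" and rot: "(i, j, l) \<in> ?Q \<longleftrightarrow> (j, l, i) \<in> ?Q" for i j l
    unfolding perm_closure_def by auto
  have box: "1 \<le> i \<and> i \<le> n \<and> 1 \<le> j \<and> j \<le> n \<and> 1 \<le> l \<and> l \<le> n" if "(i, j, l) \<in> ?Q" for i j l
    using that b[of i j l] b[of i l j] b[of j i l] b[of j l i] b[of l i j] b[of l j i]
    unfolding perm_closure_def mem_Collect_eq prod.case by linarith
  have fin: "finite {l. (i, j, l) \<in> ?Q}" for i j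
    by (rule finite_subset[of _ "{1..n}"]) (use box in auto)
  have "{l. (i, j, l) \<in> ?Q} = {1..<1 + card {l. (i, j, l) \<in> ?Q}}" for i j
    by (rule initial_segment[OF fin]) (use box[of i j] perm_closure_down[OF P, of i j] in simp_all)
  then have Q: "(i, j, l) \<in> ?Q \<longleftrightarrow> 1 \<le> l \<and> l \<le> T i j" for i j l
    unfolding T_def by (metis (no_types, lifting) atLeastLessThan_iff less_Suc_eq_le mem_Collect_eq plus_1_eq_Suc)
  have T0: "T i j = 0" if "\<not> (i \<in> {1..n} \<and> j \<in> {1..n})" for i j
  proof (rule ccontr)
    assume "T i j \<noteq> 0"
    then have "(i, j, 1) \<in> ?Q" using Q[of i j 1] by simp
    then show False using box[of i j 1] that by simp
  qed
  have Tn: "T i j \<le> n" for i j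
  proof (cases "T i j = 0")
    case False
    then have "(i, j, T i j) \<in> ?Q" using Q[of i j "T i j"] by simp
    then show ?thesis using box by blast
  qed simp
  have Tsym: "T i j = T j i" for i j unfolding T_def using swap[of i j] by simp
  have Tdec: "T i (j + 1) \<le> T i j" if "1 \<le> j" for i j
  proof (cases "T i (j + 1) = 0")
    case False
    then have "(i, Suc j, T i (j + 1)) \<in> ?Q" using Q[of i "Suc j" "T i (j + 1)"] by simp
    then have "(T i (j + 1), i, Suc j) \<in> ?Q" using rot by blast
    then have "(T i (j + 1), i, j) \<in> ?Q" using perm_closure_down[OF P] that by blast
    then have "(i, j, T i (j + 1)) \<in> ?Q" using rot by blast
    then show ?thesis using Q by blast
  qed simp
  have cubes: "cubes n T = ?Q"
  proof -
    have "(i, j, l) \<in> cubes n T \<longleftrightarrow> (i, j, l) \<in> ?Q" for i j l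
      using Q[of i j l] box[of i j l] by (auto simp: cubes_def)
    then show ?thesis by auto
  qed
  have "T \<in> plane_partitions n"
  proof -
    have "T (i + 1) j \<le> T i j" if "1 \<le> i" for i j
      using Tdec[OF that, of j] Tsym[of "i + 1" j] Tsym[of i j] by simp
    then show ?thesis unfolding plane_partitions_def using T0 Tn Tdec by simp
  qed
  moreover have "(\<lambda>(i, j, l). (j, l, i)) ` ?Q = ?Q"
  proof (intro equalityI subsetI)
    fix p assume "p \<in> (\<lambda>(i, j, l). (j, l, i)) ` ?Q"
    then obtain i j l where "p = (j, l, i)" "(i, j, l) \<in> ?Q" by auto
    then show "p \<in> ?Q" using rot by blast
  next
    fix p assume p: "p \<in> ?Q"
    obtain i j l where "p = (j, l, i)" by (cases p) auto
    then have "(i, j, l) \<in> ?Q" "p = (\<lambda>(i, j, l). (j, l, i)) (i, j, l)" using rot[of i j l] p by auto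
    then show "p \<in> (\<lambda>(i, j, l). (j, l, i)) ` ?Q" by blast
  qed
  ultimately have "T \<in> tspp n" unfolding tspp_def using cubes Tsym by simp
  moreover have "(i, j, l) \<in> sorted_cubes T \<longleftrightarrow> (i, j, l) \<in> P" for i j l
  proof
    assume s: "(i, j, l) \<in> sorted_cubes T"
    then have ijl: "1 \<le> i" "i \<le> j" "j \<le> l" and q: "(i, j, l) \<in> ?Q" using Q[of i j l] by (auto simp: sorted_cubes_def)
    from q show "(i, j, l) \<in> P" unfolding perm_closure_def mem_Collect_eq prod.case
      using ijl b[of i l j] b[of j i l] b[of j l i] b[of l i j] b[of l j i] by (auto dest: le_antisym)
  next
    assume p: "(i, j, l) \<in> P"
    then have "(i, j, l) \<in> ?Q" by (simp add: perm_closure_def)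
    then show "(i, j, l) \<in> sorted_cubes T" using b[OF p] Q[of i j l] by (simp add: sorted_cubes_def)
  qed
  then have "sorted_cubes T = P" by auto
  ultimately show ?thesis by blast
qed

lemma bij_betw_sorted_cubes: "bij_betw sorted_cubes (tspp n) (sorted_ideals n)"
proof (rule bij_betw_imageI)
  show "inj_on sorted_cubes (tspp n)"
  proof (rule inj_onI)
    fix T T' assume T: "T \<in> tspp n" "T' \<in> tspp n" "sorted_cubes T = sorted_cubes T'"
    have "l \<le> T i j \<longleftrightarrow> l \<le> T' i j" if "1 \<le> l" for i j l
      using cubes_iff[OF T(1), of i j l] cubes_iff[OF T(2), of i j l] that
        cubes_eq_perm_closure[OF T(1)] cubes_eq_perm_closure[OF T(2)] T(3) by simp
    then have "T i j = T' i j" for i j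
      by (metis One_nat_def Suc_leI antisym le_zero_eq linorder_not_le nle_le not_gr_zero)
    then show "T = T'" by blast
  qed
  show "sorted_cubes ` tspp n = sorted_ideals n"
    using sorted_cubes_sorted_ideal ex_tspp by blast
qed

section \<open>Frobenius coordinates of the diagonal\<close>

lemma part_filter_nonzero:
  assumes "sorted_wrt (\<ge>) (xs :: nat list)"
  shows "part (filter (\<lambda>p. p \<noteq> 0) xs) (Suc k) = (if k < length xs then xs ! k else 0)"
  using assms
proof (induction xs arbitrary: k)
  case (Cons x xs)
  show ?case
  proof (cases "x = 0")
    case True
    then have z: "y = 0" if "y \<in> set xs" for y using Cons.prems that by auto
    then have "filter (\<lambda>p. p \<noteq> 0) (x # xs) = []" using True by (auto simp: filter_empty_conv)
    moreover have "(x # xs) ! k = 0" if "k < length (x # xs)"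
      using nth_mem[OF that] True z by auto
    ultimately show ?thesis by (auto simp: part_def)
  next
    case False
    show ?thesis
    proof (cases k)
      case 0
      then show ?thesis using False by (simp add: part_def)
    next
      case (Suc k')
      have "part (x # ys) (Suc (Suc k')) = part ys (Suc k')" for ys by (simp add: part_def)
      then show ?thesis using False Suc Cons.IH[of k'] Cons.prems by simp
    qed
  qed
qed (simp add: part_def)

lemma tspp_diag_diagram:
  assumes T: "T \<in> tspp n"
  shows "is_partition (tspp_diag n T)"
    "diagram (tspp_diag n T) = {(i, j). (i, j) \<in> low_diag (sorted_cubes T) \<or> (j, i) \<in> up_diag (sorted_cubes T)}"
proof -
  let ?xs = "map (\<lambda>i. T i i) [1..<n + 1]"
  let ?mu = "filter (\<lambda>p. p \<noteq> 0) ?xs"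
  \<comment> \<open>Both coordinates equal to \<open>Suc i\<close> are lowered in turn, each after a
    rotation into the last place.\<close>
  have dec: "T (Suc i) (Suc i) \<le> T i i" if "1 \<le> i" for i
  proof (cases "T (Suc i) (Suc i) = 0")
    case False
    let ?l = "T (Suc i) (Suc i)"
    have "(Suc i, Suc i, ?l) \<in> cubes n T" using False cubes_iff[OF T, of "Suc i" "Suc i" ?l] by simp
    then have "(?l, Suc i, Suc i) \<in> cubes n T" using cubes_rotate[OF T] by blast
    then have "(?l, Suc i, i) \<in> cubes n T" using cubes_down[OF T] that by blast
    then have "(i, ?l, Suc i) \<in> cubes n T" using cubes_rotate[OF T] by blast
    then have "(i, ?l, i) \<in> cubes n T" using cubes_down[OF T] that by blast
    then have "(i, i, ?l) \<in> cubes n T" using cubes_rotate[OF T] by blast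
    then show ?thesis using cubes_iff[OF T, of i i ?l] by simp
  qed simp
  have srt: "sorted_wrt (\<ge>) ?xs"
    by (subst sorted_wrt_iff_nth_Suc_transp) (simp_all add: transp_def dec del: upt_Suc)
  then have "sorted_wrt (\<ge>) ?mu" by (rule sorted_wrt_filter)
  then have p: "is_partition ?mu" by (simp add: is_partition_def del: upt_Suc)
  have part: "part ?mu i = T i i" if i: "1 \<le> i" for i
  proof -
    obtain k where k: "i = Suc k" using i by (cases i) auto
    have "part ?mu i = (if k < n then ?xs ! k else 0)"
      unfolding k using part_filter_nonzero[OF srt, of k] by (simp del: upt_Suc)
    also have "\<dots> = T i i" using tspp_zero[OF T, of i i] by (simp add: k del: upt_Suc)
    finally show ?thesis .
  qed
  show "is_partition (tspp_diag n T)"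
    unfolding tspp_diag_def by (rule conj_partition_diagram(1)[OF p])
  have "diagram (tspp_diag n T) = {(i, j). (j, i) \<in> diagram ?mu}"
    unfolding tspp_diag_def by (rule conj_partition_diagram(2)[OF p])
  moreover have "(j, i) \<in> diagram ?mu \<longleftrightarrow> (i, j) \<in> low_diag (sorted_cubes T) \<or> (j, i) \<in> up_diag (sorted_cubes T)" for i j
  proof -
    have "(j, i) \<in> diagram ?mu \<longleftrightarrow> 1 \<le> j \<and> 1 \<le> i \<and> i \<le> T j j"
      using part[of j] unfolding diagram_iff by auto
    also have "\<dots> \<longleftrightarrow> (j, j, i) \<in> cubes n T"
      using cubes_iff[OF T, of j j i] by (auto simp: cubes_def)
    also have "\<dots> \<longleftrightarrow> (i, j) \<in> low_diag (sorted_cubes T) \<or> (j, i) \<in> up_diag (sorted_cubes T)"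
    proof
      assume c: "(j, j, i) \<in> cubes n T"
      then have c': "(i, j, j) \<in> cubes n T" using cubes_rotate[OF T] by blast
      have "1 \<le> i" "1 \<le> j" using c by (auto simp: cubes_def)
      then show "(i, j) \<in> low_diag (sorted_cubes T) \<or> (j, i) \<in> up_diag (sorted_cubes T)"
        using c c' sorted_cubes_iff[OF T, of i j j] sorted_cubes_iff[OF T, of j j i]
        by (cases "i \<le> j") (simp_all add: low_diag_def up_diag_def)
    next
      assume "(i, j) \<in> low_diag (sorted_cubes T) \<or> (j, i) \<in> up_diag (sorted_cubes T)"
      then have "(i, j, j) \<in> cubes n T \<or> (j, j, i) \<in> cubes n T"
        using cubes_iff[OF T, of i j j] cubes_iff[OF T, of j j i]
        by (auto simp: low_diag_def up_diag_def sorted_cubes_def)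
      then show "(j, j, i) \<in> cubes n T" using cubes_rotate[OF T] by blast
    qed
    finally show ?thesis .
  qed
  ultimately show "diagram (tspp_diag n T) = {(i, j). (i, j) \<in> low_diag (sorted_cubes T) \<or> (j, i) \<in> up_diag (sorted_cubes T)}"
    by auto
qed

lemma low_diag_le: "P \<in> sorted_ideals n \<Longrightarrow> (i, j) \<in> low_diag P \<Longrightarrow> i \<le> j \<and> j \<le> n"
  using sorted_ideals_bounds[of P n i j j] by (simp add: low_diag_def)

lemma up_diag_le: "P \<in> sorted_ideals n \<Longrightarrow> (i, j) \<in> up_diag P \<Longrightarrow> i \<le> j \<and> j \<le> n"
  using sorted_ideals_bounds[of P n i i j] by (simp add: up_diag_def)

lemma frob_diagram_low_up_iff:
  assumes P: "P \<in> sorted_ideals n" and p: "frob_pair cs es"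
  shows "{(i, j). (i, j) \<in> low_diag P \<or> (j, i) \<in> up_diag P} = frob_diagram cs es \<longleftrightarrow>
    low_diag P = shifted_diagram cs \<and> up_diag P = shifted_diagram es" (is "?D = _ \<longleftrightarrow> _")
proof
  assume eq: "?D = frob_diagram cs es"
  have diag: "(i, i) \<in> low_diag P \<longleftrightarrow> (i, i) \<in> up_diag P" for i by (simp add: low_diag_def up_diag_def)
  have "(i, j) \<in> low_diag P \<longleftrightarrow> (i, j) \<in> shifted_diagram cs" for i j
  proof (cases "i \<le> j")
    case True
    then have "(i, j) \<in> ?D \<longleftrightarrow> (i, j) \<in> low_diag P"
      using up_diag_le[OF P, of j i] diag[of i] by auto
    then show ?thesis using eq frob_diagram_upper[OF p True] by simp
  next
    case False
    then show ?thesis using low_diag_le[OF P, of i j] shifted_diagram_pos[of i j cs] by auto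
  qed
  moreover have "(i, j) \<in> up_diag P \<longleftrightarrow> (i, j) \<in> shifted_diagram es" for i j
  proof (cases "i \<le> j")
    case True
    then have "(j, i) \<in> ?D \<longleftrightarrow> (i, j) \<in> up_diag P"
      using low_diag_le[OF P, of j i] diag[of i] by auto
    then show ?thesis using eq frob_diagram_lower[OF p True] by simp
  next
    case False
    then show ?thesis using up_diag_le[OF P, of i j] shifted_diagram_pos[of i j es] by auto
  qed
  ultimately show "low_diag P = shifted_diagram cs \<and> up_diag P = shifted_diagram es" by auto
qed (auto simp: frob_diagram_def)

lemma shifted_diagram_bounded:
  assumes "\<And>i j. (i, j) \<in> shifted_diagram cs \<Longrightarrow> j \<le> n" "0 \<notin> set cs"
  shows "set cs \<subseteq> {1..n}"
proof
  fix c assume c: "c \<in> set cs"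
  then have "c \<noteq> 0" using assms(2) by metis
  obtain k where k: "k < length cs" "cs ! k = c" using c by (metis in_set_conv_nth)
  have "(Suc k, k + c) \<in> shifted_diagram cs" using k \<open>c \<noteq> 0\<close> by (simp add: mem_shifted_diagram)
  then have "k + c \<le> n" by (rule assms(1))
  then show "c \<in> {1..n}" using \<open>c \<noteq> 0\<close> by simp
qed

lemma tspp_frobenius:
  assumes T: "T \<in> tspp n"
  obtains cs es where "frob_pair cs es" "0 \<notin> set cs" "set cs \<subseteq> {1..n}" "set es \<subseteq> {1..n}"
    "frobenius (tspp_diag n T) = (map (\<lambda>c. c - 1) cs, map (\<lambda>e. e - 1) es)"
proof -
  note d = tspp_diag_diagram[OF T] and P = sorted_cubes_sorted_ideal[OF T]
  obtain cs es where p: "frob_pair cs es" "0 \<notin> set cs" "diagram (tspp_diag n T) = frob_diagram cs es"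
    using partition_frob_pair[OF d(1)] .
  have lu: "low_diag (sorted_cubes T) = shifted_diagram cs" "up_diag (sorted_cubes T) = shifted_diagram es"
    using frob_diagram_low_up_iff[OF P p(1)] d(2) p(3) by auto
  have "set cs \<subseteq> {1..n}"
    by (rule shifted_diagram_bounded[OF _ p(2)]) (use low_diag_le[OF P] lu(1) in blast)
  moreover have "0 \<notin> set es" using p by (simp add: frob_pair_def)
  then have "set es \<subseteq> {1..n}"
    by (rule shifted_diagram_bounded[rotated]) (use up_diag_le[OF P] lu(2) in blast)
  ultimately show thesis
    using that[OF p(1,2)] frobenius_frob_diagram[OF d(1) p] by blast
qed

text \<open>Passing to sorted cubes is a bijection under which prescribing Frobenius coordinates
  means prescribing the two diagonals of the ideal.\<close>

lemma card_tspp_frobenius: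
  assumes p: "frob_pair cs es" "0 \<notin> set cs" and es: "set es \<subseteq> {1..n}"
  shows "of_nat (card {T \<in> tspp n. frobenius (tspp_diag n T) = (map (\<lambda>c. c - 1) cs, map (\<lambda>e. e - 1) es)}) =
    (minor binomial_matrix es cs :: 'a::comm_ring_1)"
proof -
  let ?f = "(map (\<lambda>c. c - 1) cs, map (\<lambda>e. e - 1) es)"
  have "frobenius (tspp_diag n T) = ?f \<longleftrightarrow> sorted_cubes T \<in> ideal_class n cs es" if T: "T \<in> tspp n" for T
  proof -
    note d = tspp_diag_diagram[OF T] and P = sorted_cubes_sorted_ideal[OF T]
    have "frobenius (tspp_diag n T) = ?f \<longleftrightarrow> diagram (tspp_diag n T) = frob_diagram cs es"
    proof
      assume f: "frobenius (tspp_diag n T) = ?f"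
      obtain cs' es' where p': "frob_pair cs' es'" "0 \<notin> set cs'" "diagram (tspp_diag n T) = frob_diagram cs' es'"
        using partition_frob_pair[OF d(1)] .
      then have "cs' = cs" "es' = es"
        using f frobenius_frob_diagram[OF d(1) p'] p frob_pair_pred_inject[of cs' cs] frob_pair_pred_inject[of es' es]
        by (simp_all add: frob_pair_def)
      then show "diagram (tspp_diag n T) = frob_diagram cs es" using p' by simp
    qed (rule frobenius_frob_diagram[OF d(1) p])
    also have "\<dots> \<longleftrightarrow> sorted_cubes T \<in> ideal_class n cs es"
      unfolding d(2) frob_diagram_low_up_iff[OF P p(1)] ideal_class_def using P by simp
    finally show ?thesis .
  qed
  then have eq: "{T \<in> tspp n. frobenius (tspp_diag n T) = ?f} = {T \<in> tspp n. sorted_cubes T \<in> ideal_class n cs es}"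
    by blast
  have bij: "bij_betw sorted_cubes {T \<in> tspp n. sorted_cubes T \<in> ideal_class n cs es} (ideal_class n cs es)"
  proof (rule bij_betw_imageI)
    show "inj_on sorted_cubes {T \<in> tspp n. sorted_cubes T \<in> ideal_class n cs es}"
      using bij_betw_sorted_cubes[of n] by (auto simp: bij_betw_def intro: inj_on_subset)
    show "sorted_cubes ` {T \<in> tspp n. sorted_cubes T \<in> ideal_class n cs es} = ideal_class n cs es"
      using ex_tspp unfolding ideal_class_def by blast
  qed
  have "of_nat (card (ideal_class n cs es)) = (minor binomial_matrix es cs :: 'a)"
    by (rule card_ideal_class) (use p es in \<open>simp_all add: frob_pair_def\<close>)
  then show ?thesis unfolding eq bij_betw_same_card[OF bij] .
qed

lemma finite_tspp: "finite (tspp n)"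
  using bij_betw_finite[OF bij_betw_sorted_cubes] finite_sorted_ideals by blast

section \<open>The four determinants\<close>

lemma mvps_coeff_const: "mvps_coeff (mvps_const c) M = (if M = {#} then c else 0)"
  by transfer simp

lemma mvps_coeff_const_mult: "mvps_coeff (mvps_const c * f) M = c * mvps_coeff f M"
proof -
  have "mvps_coeff (mvps_const c * f) M = (\<Sum>N | N \<subseteq># M. if N = {#} then c * mvps_coeff f M else 0)"
    unfolding mvps_coeff_mult by (intro sum.cong) (auto simp: mvps_coeff_const)
  then show ?thesis by (simp add: sum.delta finite_submultisets)
qed

interpretation mvps_const: comm_ring_hom "mvps_const :: 'a::comm_ring_1 \<Rightarrow> 'a mvps"
  by unfold_locales (simp_all add: mvps_eq_iff mvps_coeff_const_mult mvps_coeff_const mvps_coeff_1)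

lemma det1_minor: "det1 n A = minor (\<lambda>i j. A (int i) (int j)) [1..<n + 1] [1..<n + 1]"
  unfolding det1_def minor_def
  by (intro arg_cong[of _ _ det] eq_matI) (simp_all add: add.commute del: upt_Suc)

text \<open>Stated for abstract \<open>e\<close>, \<open>h\<close> and \<open>f\<close> because it
  is used twice: for the hooks themselves and, with \<open>e\<close> and \<open>h\<close>
  interchanged, for their transposes.\<close>

lemma hook_alternating_sum:
  fixes f :: "nat \<Rightarrow> nat \<Rightarrow> 'a::comm_ring_1"
  assumes e0: "e 0 = 1" and f1: "\<And>a. 1 \<le> a \<Longrightarrow> f a 1 = h a" and f1': "\<And>b. 1 \<le> b \<Longrightarrow> f 1 b = e b"
    and f: "\<And>a b. 1 \<le> a \<Longrightarrow> 1 \<le> b \<Longrightarrow> f a (Suc b) + f (Suc a) b = h a * e b" and "1 \<le> b"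
  shows "(\<Sum>i\<le>a. (-1) ^ i * e (a - i) * f (Suc i) b) = e (a + b)"
proof -
  have base: "(\<Sum>i\<le>a. (-1) ^ i * e (a - i) * h (Suc i)) = e (a + 1)" for a
  proof -
    \<comment> \<open>The hooks of size \<open>a + 1\<close>. By the two-term relation each product
      is a sum of two neighbours, so the alternating sum telescopes; the value 0 at
      \<open>a + 2\<close> covers the last product, which is a single hook.\<close>
    define T where "T i = (if i \<le> a + 1 then f i (a + 2 - i) else 0)" for i
    have step: "e (a - i) * h (Suc i) = T (Suc i) + T (Suc (Suc i))" if "i \<le> a" for i
    proof (cases "i = a")
      case True
      then show ?thesis using e0 f1[of "Suc a"] by (simp add: T_def)
    next
      case False
      then have "a + 2 - Suc i = Suc (a - i)" "a + 2 - Suc (Suc i) = a - i" using that by auto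
      then show ?thesis using f[of "Suc i" "a - i"] False that by (simp add: T_def mult.commute)
    qed
    have "(\<Sum>i\<le>p. (-1) ^ i * e (a - i) * h (Suc i)) = T 1 + (-1) ^ p * T (p + 2)" if "p \<le> a" for p
      using that
    proof (induction p)
      case 0
      then show ?case using step[of 0] by simp
    next
      case (Suc p)
      then show ?case using step[of "Suc p"] by (simp add: mult.assoc algebra_simps)
    qed
    from this[of a] show ?thesis using f1'[of "a + 1"] by (simp add: T_def)
  qed
  show ?thesis
    using \<open>1 \<le> b\<close>
  proof (induction b arbitrary: a rule: nat_induct_at_least)
    case base
    then show ?case using \<open>\<And>a. (\<Sum>i\<le>a. (-1) ^ i * e (a - i) * h (Suc i)) = e (a + 1)\<close>[of a] f1 by simp
  next
    case (Suc b)
    \<comment> \<open>This trades a leg for an arm. The first part is a multiple of the base case;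
      the second is the sum for \<open>Suc a\<close> and \<open>b\<close> without its first term,
      and that term cancels the first part.\<close>
    have eq: "f (Suc i) (Suc b) = h (Suc i) * e b - f (Suc (Suc i)) b" for i
      using f[of "Suc i" b] Suc.hyps by (simp add: algebra_simps)
    have "(\<Sum>i\<le>a. (-1) ^ i * e (a - i) * f (Suc i) (Suc b)) =
      (\<Sum>i\<le>a. (-1) ^ i * e (a - i) * h (Suc i)) * e b + (\<Sum>i\<le>a. (-1) ^ Suc i * e (Suc a - Suc i) * f (Suc (Suc i)) b)"
      unfolding sum_distrib_right sum.distrib[symmetric] eq by (intro sum.cong) (simp_all add: algebra_simps)
    also have "(\<Sum>i\<le>a. (-1) ^ Suc i * e (Suc a - Suc i) * f (Suc (Suc i)) b) =
      (\<Sum>i\<le>Suc a. (-1) ^ i * e (Suc a - i) * f (Suc i) b) - e (Suc a) * f 1 b"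
      by (subst sum.atMost_Suc_shift) simp
    also have "(\<Sum>i\<le>Suc a. (-1) ^ i * e (Suc a - i) * f (Suc i) b) = e (Suc a + b)" by (rule Suc.IH)
    also have "f 1 b = e b" using f1' Suc.hyps by simp
    finally show ?case using \<open>\<And>a. (\<Sum>i\<le>a. (-1) ^ i * e (a - i) * h (Suc i)) = e (a + 1)\<close>[of a] by simp
  qed
qed

lemma sum_esym_hook:
  assumes "1 \<le> b"
  shows "(\<Sum>i\<le>a. (-1) ^ i * esym (int (a - i)) * hook (Suc i) b) = (esym (int (a + b)) :: 'a::comm_ring_1 mvps)"
  by (rule hook_alternating_sum[where h = "\<lambda>a. hsym (int a)" and e = "\<lambda>a. esym (int a)"])
     (use assms in \<open>simp_all add: esym_0 hook_right_1[unfolded One_nat_def] hook_left_1[unfolded One_nat_def] hook_pieri\<close>)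

lemma sum_hsym_hook:
  assumes "1 \<le> a"
  shows "(\<Sum>i\<le>b. (-1) ^ i * hsym (int (b - i)) * hook a (Suc i)) = (hsym (int (b + a)) :: 'a::comm_ring_1 mvps)"
  by (rule hook_alternating_sum[where h = "\<lambda>a. esym (int a)" and e = "\<lambda>a. hsym (int a)" and f = "\<lambda>a b. hook b a"])
     (use assms in \<open>simp_all add: hsym_0 hook_right_1[unfolded One_nat_def] hook_left_1[unfolded One_nat_def] hook_pieri add.commute mult.commute\<close>)

text \<open>The signed binomial matrix inverts the binomial matrix: moving the factor
  \<open>p choose q\<close> out of the product leaves an alternating sum over one row of Pascal's
  triangle.\<close>

lemma alternating_binomial_product:
  "(\<Sum>m = 1..n. of_nat ((i - 1) choose (m - 1)) * ((-1) ^ (m + j) * of_nat ((m - 1) choose (j - 1)))) =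
   (if i = j then 1 else 0 :: 'a::comm_ring_1)" if "1 \<le> i" "i \<le> n" "1 \<le> j"
proof -
  define p q where "p = i - 1" and "q = j - 1"
  have ij: "i = Suc p" "j = Suc q" using that by (auto simp: p_def q_def)
  have "(\<Sum>m = 1..n. of_nat ((i - 1) choose (m - 1)) * ((-1) ^ (m + j) * of_nat ((m - 1) choose (j - 1)))) =
    (\<Sum>m<n. of_nat (p choose m) * ((-1) ^ (m + q) * of_nat (m choose q)) :: 'a)"
    by (simp add: sum.atLeast1_atMost_eq ij)
  also have "\<dots> = (\<Sum>m\<in>{q..p}. of_nat (p choose m) * ((-1) ^ (m + q) * of_nat (m choose q)))"
    by (rule sum.mono_neutral_right) (use that ij in \<open>auto simp: binomial_eq_0 not_le\<close>)
  also have "\<dots> = (if p = q then 1 else 0)"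
  proof (cases "q \<le> p")
    case True
    have "(\<Sum>m\<in>{q..p}. of_nat (p choose m) * ((-1) ^ (m + q) * of_nat (m choose q))) =
      (\<Sum>s\<le>p - q. of_nat (p choose q) * ((-1) ^ s * of_nat ((p - q) choose s)) :: 'a)"
    proof (rule sum.reindex_bij_witness[where i = "\<lambda>s. s + q" and j = "\<lambda>m. m - q"])
      fix m assume m: "m \<in> {q..p}"
      then have "(p choose m) * (m choose q) = (p choose q) * ((p - q) choose (m - q))" using choose_mult[of q m p] by simp
      then have "of_nat (p choose m) * of_nat (m choose q) = (of_nat (p choose q) * of_nat ((p - q) choose (m - q)) :: 'a)"
        by (metis of_nat_mult)
      moreover have "m + q = (m - q) + 2 * q" using m by simp
      then have "(-1) ^ (m + q) = ((-1) ^ (m - q) :: 'a)" by (simp only: power_add power_mult) simp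
      ultimately show "of_nat (p choose q) * ((-1) ^ (m - q) * of_nat ((p - q) choose (m - q))) =
        of_nat (p choose m) * ((-1) ^ (m + q) * of_nat (m choose q) :: 'a)" by (metis mult.left_commute)
    qed (use True in auto)
    also have "\<dots> = of_nat (p choose q) * (\<Sum>s\<le>p - q. (-1) ^ s * of_nat ((p - q) choose s))"
      by (simp add: sum_distrib_left)
    also have "\<dots> = (if p = q then 1 else 0)"
      using True choose_alternating_sum[of "p - q", where 'a = 'a] by (cases "p = q") auto
    finally show ?thesis .
  qed auto
  finally show ?thesis using ij by simp
qed

lemma minor_lower_unitriangular:
  fixes A :: "nat \<Rightarrow> nat \<Rightarrow> 'a::comm_ring_1"
  assumes "\<And>i j. 1 \<le> i \<Longrightarrow> i < j \<Longrightarrow> A i j = 0" "\<And>i. 1 \<le> i \<Longrightarrow> A i i = 1"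
  shows "minor A [1..<n + 1] [1..<n + 1] = 1"
proof -
  let ?M = "mat n n (\<lambda>(i, j). A (Suc i) (Suc j))"
  have "minor A [1..<n + 1] [1..<n + 1] = det ?M"
    unfolding minor_def by (intro arg_cong[of _ _ det] eq_matI) (simp_all del: upt_Suc)
  also have "\<dots> = prod_list (diag_mat ?M)"
    by (rule det_lower_triangular[of n]) (use assms(1) in auto)
  also have "\<dots> = 1" unfolding prod_list_diag_prod by (rule prod.neutral) (use assms(2) in auto)
  finally show ?thesis .
qed

lemma minor_signed_antitriangular:
  fixes f :: "nat \<Rightarrow> 'a::comm_ring_1"
  assumes "f 0 = 1"
  shows "minor (\<lambda>i j. if i + j \<le> n + 1 then (-1) ^ (j - 1) * f (n + 1 - i - j) else 0) [1..<n + 1] [1..<n + 1] = 1"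
proof -
  have "minor (\<lambda>i j. if i + j \<le> n + 1 then (-1) ^ (j - 1) * f (n + 1 - i - j) else 0) [1..<n + 1] [1..<n + 1] =
    det (mat n n (\<lambda>(i, j). if i + j < n then (-1) ^ j * f (n - 1 - i - j) else 0))"
    unfolding minor_def by (intro arg_cong[of _ _ det] eq_matI) (auto simp del: upt_Suc)
  then show ?thesis using det_signed_antitriangular[of f n, OF assms] by simp
qed

lemma minor_conjugate:
  fixes A :: "nat \<Rightarrow> nat \<Rightarrow> 'a::comm_ring_1"
  assumes "\<And>i. f i * g i = 1"
  shows "minor (\<lambda>i j. f i * A i j * g j) xs xs = minor A xs xs"
proof -
  have "(\<Prod>x\<leftarrow>xs. f x) * (\<Prod>x\<leftarrow>xs. g x) = (\<Prod>x\<leftarrow>xs. f x * g x)"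
    by (induction xs) (simp_all add: mult_ac)
  also have "\<dots> = 1" by (induction xs) (simp_all add: assms)
  finally show ?thesis by (simp add: minor_scale)
qed

section \<open>The fourth determinant and its transforms of size \<open>n\<close>\<close>

locale tspp_params =
  fixes r u v w :: "'a::field" and n k :: nat
  assumes u_nonzero: "u \<noteq> 0" and w_nonzero: "w \<noteq> 0"
begin

abbreviation "\<kappa> \<equiv> mvps_const :: 'a \<Rightarrow> 'a mvps"
abbreviation "L \<equiv> [1..<n + 1]"

definition "t = w / u"

lemma t_nonzero: "t \<noteq> 0"
  using u_nonzero w_nonzero by (simp add: t_def)

text \<open>The binomial matrix conjugated by the diagonal matrix of the powers of \<open>t\<close>;
  it is lower unitriangular.\<close>

definition Q :: "nat \<Rightarrow> nat \<Rightarrow> 'a mvps" where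
  "Q i m = \<kappa> (of_nat ((i - 1) choose (m - 1)) * t powi (int i - int m))"

text \<open>The matrix of the fourth determinant, to which all the others are reduced: a diagonal
  matrix plus the product of \<open>Q\<close>, the hooks and a diagonal scaling of the
  columns.\<close>

definition core :: "nat \<Rightarrow> nat \<Rightarrow> 'a mvps" where
  "core i j = \<kappa> (if i = j then v ^ i else 0) + \<kappa> (r * u ^ j) * (\<Sum>m = 1..n. Q i m * hook m (j + k))"

text \<open>\<open>core\<close> with the factor \<open>Q\<close> cancelled on the left. The diagonal
  of \<open>core\<close> becomes a multiple of the signed binomials, which invert \<open>Q\<close>,
  and single hooks remain.\<close>

definition reduced :: "nat \<Rightarrow> nat \<Rightarrow> 'a mvps" where
  "reduced i j = \<kappa> ((-1) ^ (i + j) * v ^ j * of_nat ((i - 1) choose (j - 1)) * t powi (int i - int j)) +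
     \<kappa> (r * u ^ j) * hook i (j + k)"

lemma core_eq_mult:
  assumes "1 \<le> i" "i \<le> n" "1 \<le> j"
  shows "core i j = (\<Sum>m = 1..n. Q i m * reduced m j)"
proof -
  let ?b = "\<lambda>m. (-1) ^ (m + j) * v ^ j * of_nat ((m - 1) choose (j - 1)) * t powi (int m - int j)"
  have "(\<Sum>m = 1..n. Q i m * reduced m j) =
    (\<Sum>m = 1..n. Q i m * \<kappa> (?b m)) + \<kappa> (r * u ^ j) * (\<Sum>m = 1..n. Q i m * hook m (j + k))"
    unfolding sum_distrib_left sum.distrib[symmetric] reduced_def
    by (intro sum.cong) (simp_all add: algebra_simps)
  also have "(\<Sum>m = 1..n. Q i m * \<kappa> (?b m)) =
    \<kappa> (\<Sum>m = 1..n. of_nat ((i - 1) choose (m - 1)) * t powi (int i - int m) * ?b m)"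
    unfolding Q_def mvps_const.hom_sum mvps_const.hom_mult[symmetric] ..
  also have "(\<Sum>m = 1..n. of_nat ((i - 1) choose (m - 1)) * t powi (int i - int m) * ?b m) =
    (\<Sum>m = 1..n. v ^ j * t powi (int i - int j) *
      (of_nat ((i - 1) choose (m - 1)) * ((-1) ^ (m + j) * of_nat ((m - 1) choose (j - 1)))))"
  proof (intro sum.cong refl)
    fix m
    have "t powi (int i - int j) = t powi (int i - int m) * t powi (int m - int j)"
      using t_nonzero by (simp add: power_int_add[symmetric])
    then show "of_nat ((i - 1) choose (m - 1)) * t powi (int i - int m) * ?b m =
      v ^ j * t powi (int i - int j) * (of_nat ((i - 1) choose (m - 1)) * ((-1) ^ (m + j) * of_nat ((m - 1) choose (j - 1))))"
      by (simp only: mult_ac)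
  qed
  also have "\<dots> = v ^ j * t powi (int i - int j) * (if i = j then 1 else 0)"
    unfolding sum_distrib_left[symmetric] alternating_binomial_product[OF assms] ..
  also have "\<dots> = (if i = j then v ^ i else 0)" by simp
  finally show ?thesis by (simp add: core_def)
qed

lemma minor_core_reduced: "minor core L L = minor reduced L L"
proof -
  have "minor core L L = minor (\<lambda>i j. \<Sum>m = 1..n. Q i m * reduced m j) L L"
  proof (rule minor_cong)
    fix i j assume "i \<in> set L" "j \<in> set L"
    then have "1 \<le> i" "i \<le> n" "1 \<le> j" by auto
    then show "core i j = (\<Sum>m = 1..n. Q i m * reduced m j)" by (rule core_eq_mult)
  qed simp
  also have "\<dots> = minor Q L L * minor reduced L L" by (rule minor_mult)
  also have "minor Q L L = 1"
  proof (rule minor_lower_unitriangular)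
    fix i j :: nat assume "1 \<le> i" "i < j"
    then have "(i - 1) choose (j - 1) = 0" by (intro binomial_eq_0) linarith
    then show "Q i j = 0" unfolding Q_def by (simp only: of_nat_0 mult_zero_left mvps_const.hom_zero)
  qed (simp add: Q_def)
  finally show ?thesis by simp
qed

definition hook_form :: "nat \<Rightarrow> nat \<Rightarrow> 'a mvps" where
  "hook_form i j = \<kappa> ((-1) ^ (i + j) * v ^ j * of_nat ((i - 1) choose (j - 1))) +
     \<kappa> (r * u ^ i * w powi (int j - int i)) * hook i (j + k)"

text \<open>Conjugation by powers of \<open>t\<close> removes them from the binomials and, as
  \<open>t = w / u\<close>, turns \<open>u ^ j\<close> into
  \<open>u ^ i * w powi (j - i)\<close>.\<close>

lemma minor_hook_form: "minor hook_form L L = minor core L L"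
proof -
  have pw: "u ^ i * w powi (int j - int i) * t powi (int i - int j) = u ^ j" for i j
  proof -
    have "w powi (int j - int i) * w powi (int i - int j) = 1"
      using w_nonzero by (simp add: power_int_add[symmetric])
    moreover have "u ^ i = u ^ j * u powi (int i - int j)"
      using u_nonzero by (simp add: power_int_diff)
    ultimately show ?thesis using u_nonzero by (simp add: t_def power_int_divide_distrib)
  qed
  have tt: "t powi int i * t powi (- int j) = t powi (int i - int j)" for i j
  proof -
    have "t powi (int i + - int j) = t powi int i * t powi (- int j)"
      by (rule power_int_add) (simp add: t_nonzero)
    then show ?thesis unfolding diff_conv_add_uminus[of "int i"] by (rule sym)
  qed
  have "reduced i j = \<kappa> (t powi int i) * hook_form i j * \<kappa> (t powi (- int j))" for i j
  proof -
    have "\<kappa> (t powi int i) * hook_form i j * \<kappa> (t powi (- int j)) =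
      \<kappa> (t powi int i * t powi (- int j)) * hook_form i j" by (simp add: mvps_const.hom_mult mult_ac)
    also have "\<dots> = \<kappa> (t powi (int i - int j)) * hook_form i j" unfolding tt ..
    also have "\<dots> = \<kappa> ((-1) ^ (i + j) * v ^ j * of_nat ((i - 1) choose (j - 1)) * t powi (int i - int j)) +
        \<kappa> (r * (u ^ i * w powi (int j - int i) * t powi (int i - int j))) * hook i (j + k)"
      unfolding hook_form_def distrib_left mvps_const.hom_mult by (simp only: mult_ac)
    finally show ?thesis unfolding pw reduced_def by simp
  qed
  then have "reduced = (\<lambda>i j. \<kappa> (t powi int i) * hook_form i j * \<kappa> (t powi (- int j)))" by blast
  then have "minor reduced L L = minor hook_form L L"
    using minor_conjugate[of "\<lambda>i. \<kappa> (t powi int i)" "\<lambda>i. \<kappa> (t powi (- int i))" hook_form L] tt t_nonzero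
    by (simp add: mvps_const.hom_mult[symmetric] del: upt_Suc)
  then show ?thesis using minor_core_reduced by simp
qed

definition R :: "nat \<Rightarrow> nat \<Rightarrow> 'a mvps" where
  "R j m = (if j + m \<le> n + 1 then (-1) ^ (m - 1) * esym (int (n + 1 - j - m)) else 0)"

text \<open>The transpose of the product of \<open>R\<close> and \<open>reduced\<close>: in the
  second determinant the powers of \<open>u\<close> and \<open>v\<close> depend on the row, in
  \<open>reduced\<close> on the column.\<close>

definition e_form :: "nat \<Rightarrow> nat \<Rightarrow> 'a mvps" where
  "e_form i j = (\<Sum>m = 1..n. R j m * reduced m i)"

lemma minor_e_form: "minor e_form L L = minor core L L"
proof -
  have "minor e_form L L = minor (\<lambda>j i. \<Sum>m = 1..n. R j m * reduced m i) L L"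
    unfolding e_form_def[abs_def] by (rule minor_transpose) simp
  also have "\<dots> = minor R L L * minor reduced L L" by (rule minor_mult)
  also have "minor R L L = 1"
    unfolding R_def[abs_def] by (rule minor_signed_antitriangular[of "\<lambda>m. esym (int m)"]) (simp add: esym_0)
  finally show ?thesis using minor_core_reduced by simp
qed

lemma sum_R_hook:
  assumes "1 \<le> j" "j \<le> n" "1 \<le> b"
  shows "(\<Sum>m = 1..n. R j m * hook m b) = esym (int (n - j + b))"
proof -
  have "(\<Sum>m = 1..n. R j m * hook m b) = (\<Sum>i<n. R j (Suc i) * hook (Suc i) b)"
    by (simp add: sum.atLeast1_atMost_eq)
  also have "\<dots> = (\<Sum>i\<le>n - j. R j (Suc i) * hook (Suc i) b)"
    by (rule sum.mono_neutral_right) (use assms in \<open>auto simp: R_def\<close>)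
  also have "\<dots> = (\<Sum>i\<le>n - j. (-1) ^ i * esym (int (n - j - i)) * hook (Suc i) b)"
  proof (intro sum.cong refl)
    fix i assume "i \<in> {..n - j}"
    then have "j + Suc i \<le> n + 1" "n + 1 - j - Suc i = n - j - i" using assms by auto
    then show "R j (Suc i) * hook (Suc i) b = (-1) ^ i * esym (int (n - j - i)) * hook (Suc i) b" by (simp add: R_def)
  qed
  also have "\<dots> = esym (int (n - j + b))" by (rule sum_esym_hook[OF assms(3)])
  finally show ?thesis .
qed

lemma e_form_eq:
  assumes "1 \<le> i" "1 \<le> j" "j \<le> n"
  shows "e_form i j = \<kappa> (r * u ^ i) * esym (int (n - j + (i + k))) +
    (\<Sum>m = 1..n. R j m * \<kappa> ((-1) ^ (m + i) * v ^ i * of_nat ((m - 1) choose (i - 1)) * t powi (int m - int i)))"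
proof -
  have "1 \<le> i + k" using assms by simp
  then have "e_form i j = \<kappa> (r * u ^ i) * (\<Sum>m = 1..n. R j m * hook m (i + k)) +
    (\<Sum>m = 1..n. R j m * \<kappa> ((-1) ^ (m + i) * v ^ i * of_nat ((m - 1) choose (i - 1)) * t powi (int m - int i)))"
    unfolding e_form_def reduced_def sum_distrib_left sum.distrib[symmetric]
    by (intro sum.cong) (simp_all add: algebra_simps)
  then show ?thesis using sum_R_hook[OF assms(2,3) \<open>1 \<le> i + k\<close>] by simp
qed

section \<open>The determinant of size \<open>n + k\<close>\<close>

abbreviation "N \<equiv> n + k"
abbreviation "L' \<equiv> [1..<N + 1]"

text \<open>The alternating sum that produces complete symmetric functions starts with legs of
  length 1, whereas the columns of \<open>core\<close> begin with \<open>k + 1\<close>. So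
  \<open>k\<close> identity rows are put on top, and column \<open>j\<close> now belongs to leg
  \<open>j\<close>. The power of \<open>u\<close> is moved from the columns to the rows, so that it
  is not affected by multiplication with \<open>G\<close> from the right.\<close>

definition extended :: "nat \<Rightarrow> nat \<Rightarrow> 'a mvps" where
  "extended c j = (if c \<le> k then (if c = j then 1 else 0)
     else \<kappa> (if c = j then v ^ (c - k) else 0) + \<kappa> (r * u ^ (c - k)) * (\<Sum>m = 1..n. Q (c - k) m * hook m j))"

definition G :: "nat \<Rightarrow> nat \<Rightarrow> 'a mvps" where
  "G c j = (if j + c \<le> N + 1 then (-1) ^ (c - 1) * hsym (int (N + 1 - j - c)) else 0)"

text \<open>The signed reversal of the rows, written as an antitriangular matrix of the same shape
  as \<open>G\<close>. It restores the row order of the matrix \<open>M\<close> in the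
  statement.\<close>

definition S :: "nat \<Rightarrow> nat \<Rightarrow> 'a mvps" where
  "S i c = (if i + c \<le> N + 1 then (-1) ^ (c - 1) * (if N + 1 - i - c = 0 then 1 else 0) else 0)"

definition h_form :: "nat \<Rightarrow> nat \<Rightarrow> 'a mvps" where
  "h_form i j = (\<Sum>c = 1..N. S i c * (\<Sum>c' = 1..N. extended c c' * G c' j))"

text \<open>Expansion along the identity rows leaves a block that is \<open>core\<close> conjugated
  by powers of \<open>u\<close>.\<close>

lemma minor_extended: "minor extended L' L' = minor core L L"
proof -
  let ?f = "\<lambda>i. i + k"
  have L': "L' = [1..<k + 1] @ map ?f L"
  proof -
    have "map ?f L = [1 + k..<n + 1 + k]" 
      by (rule nth_equalityI) (simp_all del: upt_Suc)
    moreover have "[1..<k + 1 + n] = [1..<k + 1] @ [k + 1..<k + 1 + n]" by (rule upt_add_eq_append) simp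
    ultimately show ?thesis by (simp only: add_ac)
  qed
  have "minor extended L' L' = minor extended (map ?f L) (map ?f L)"
    unfolding L' by (rule minor_identity_rows) (auto simp: extended_def simp del: upt_Suc)
  also have "\<dots> = minor (\<lambda>i j. extended (i + k) (j + k)) L L" by (rule minor_map) simp
  also have "\<dots> = minor (\<lambda>i j. \<kappa> (u ^ i) * core i j * \<kappa> (inverse (u ^ j))) L L"
  proof (rule minor_cong)
    fix i j assume "i \<in> set L" "j \<in> set L"
    then have i: "\<not> i + k \<le> k" by auto
    let ?s = "\<Sum>m = 1..n. Q i m * hook m (j + k)"
    have "\<kappa> (u ^ i) * core i j * \<kappa> (inverse (u ^ j)) =
      \<kappa> (u ^ i * inverse (u ^ j) * (if i = j then v ^ i else 0)) + \<kappa> (r * u ^ i * (u ^ j * inverse (u ^ j))) * ?s"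
      unfolding core_def distrib_left distrib_right mvps_const.hom_mult by (simp only: mult_ac)
    also have "u ^ j * inverse (u ^ j) = 1" using u_nonzero by simp
    also have "u ^ i * inverse (u ^ j) * (if i = j then v ^ i else 0) = (if i = j then v ^ i else 0)"
      using u_nonzero by simp
    finally show "extended (i + k) (j + k) = \<kappa> (u ^ i) * core i j * \<kappa> (inverse (u ^ j))"
      using i by (simp add: extended_def)
  qed simp
  also have "\<dots> = minor core L L"
    by (rule minor_conjugate) (use u_nonzero in \<open>simp add: mvps_const.hom_mult[symmetric]\<close>)
  finally show ?thesis .
qed

lemma minor_h_form: "minor h_form L' L' = minor core L L"
proof -
  have "minor h_form L' L' = minor S L' L' * minor (\<lambda>c j. \<Sum>c' = 1..N. extended c c' * G c' j) L' L'"
    unfolding h_form_def[abs_def] by (rule minor_mult)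
  also have "minor (\<lambda>c j. \<Sum>c' = 1..N. extended c c' * G c' j) L' L' = minor extended L' L' * minor G L' L'"
    by (rule minor_mult)
  also have "minor G L' L' = minor (\<lambda>j c. G c j) L' L'" by (rule minor_transpose) simp
  also have "\<dots> = 1"
    unfolding G_def by (rule minor_signed_antitriangular[of "\<lambda>m. hsym (int m)"]) (simp add: hsym_0)
  also have "minor S L' L' = 1"
    unfolding S_def[abs_def] by (rule minor_signed_antitriangular[of "\<lambda>m. if m = 0 then 1 else 0"]) simp
  finally show ?thesis using minor_extended by simp
qed

lemma sum_hook_G:
  assumes "1 \<le> m" "1 \<le> j" "j \<le> N"
  shows "(\<Sum>c = 1..N. hook m c * G c j) = hsym (int (N - j + m))"
proof -
  have "(\<Sum>c = 1..N. hook m c * G c j) = (\<Sum>i<N. hook m (Suc i) * G (Suc i) j)"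
    by (simp add: sum.atLeast1_atMost_eq)
  also have "\<dots> = (\<Sum>i\<le>N - j. hook m (Suc i) * G (Suc i) j)"
    by (rule sum.mono_neutral_right) (use assms in \<open>auto simp: G_def\<close>)
  also have "\<dots> = (\<Sum>i\<le>N - j. (-1) ^ i * hsym (int (N - j - i)) * hook m (Suc i))"
  proof (intro sum.cong refl)
    fix i assume "i \<in> {..N - j}"
    then have "j + Suc i \<le> N + 1" "N + 1 - j - Suc i = N - j - i" using assms by auto
    then show "hook m (Suc i) * G (Suc i) j = (-1) ^ i * hsym (int (N - j - i)) * hook m (Suc i)"
      by (simp add: G_def mult.commute)
  qed
  also have "\<dots> = hsym (int (N - j + m))" by (rule sum_hsym_hook[OF assms(1)])
  finally show ?thesis .
qed

lemma h_form_eq: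
  assumes "1 \<le> i" "i \<le> N" "1 \<le> j" "j \<le> N"
  shows "h_form i j = (if i \<le> n
    then \<kappa> (v ^ (n + 1 - i)) * hsym (int i - int j) +
      \<kappa> ((-1) ^ (N - i) * (r * u ^ (n + 1 - i))) * (\<Sum>m = 1..n. Q (n + 1 - i) m * hsym (int (N - j + m)))
    else hsym (int i - int j))"
proof -
  let ?c = "N + 1 - i"
  let ?D = "\<lambda>c. \<Sum>c' = 1..N. extended c c' * G c' j"
  have c: "1 \<le> ?c" "?c \<le> N" "?c - 1 = N - i" "i + ?c = N + 1" using assms by auto
  \<comment> \<open>Row \<open>i\<close> of \<open>S\<close> has its only nonzero entry in column
    \<open>N + 1 - i\<close>.\<close>
  have "h_form i j = (\<Sum>c\<in>{?c}. S i c * ?D c)"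
    unfolding h_form_def by (rule sum.mono_neutral_right) (use c assms in \<open>auto simp: S_def\<close>)
  also have "\<dots> = (-1) ^ (N - i) * ?D ?c" using c by (simp add: S_def)
  finally have h: "h_form i j = (-1) ^ (N - i) * ?D ?c" .
  \<comment> \<open>The reversal and \<open>G\<close> carry the same sign. For \<open>j > i\<close>
    both sides vanish, the right one because its index is negative.\<close>
  have sgn: "(-1) ^ (N - i) * G ?c j = hsym (int i - int j)"
  proof (cases "j \<le> i")
    case True
    then have "j + ?c \<le> N + 1" "N + 1 - j - ?c = i - j" using assms by auto
    then show ?thesis using c True by (simp add: G_def mult.assoc[symmetric] power_add[symmetric] of_nat_diff)
  next
    case False
    then show ?thesis using c by (simp add: G_def hsym_neg)
  qed
  have one: "(\<Sum>c' = 1..N. (if ?c = c' then a else 0) * G c' j) = a * G ?c j" for a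
  proof -
    have "(\<Sum>c' = 1..N. (if ?c = c' then a else 0) * G c' j) = (\<Sum>c' = 1..N. if ?c = c' then a * G c' j else 0)"
      by (intro sum.cong) auto
    then show ?thesis using c by simp
  qed
  show ?thesis
  proof (cases "i \<le> n")
    case False
    then have "?c \<le> k" by simp
    then have "?D ?c = G ?c j" using one[of 1] by (simp add: extended_def)
    then show ?thesis using False h sgn by simp
  next
    case True
    then have ck: "\<not> ?c \<le> k" "?c - k = n + 1 - i" by auto
    let ?i = "n + 1 - i"
    have ext: "extended ?c c' = (if ?c = c' then \<kappa> (v ^ ?i) else 0) + \<kappa> (r * u ^ ?i) * (\<Sum>m = 1..n. Q ?i m * hook m c')" for c'
      unfolding extended_def if_not_P[OF ck(1)] ck(2) by (cases "?c = c'") simp_all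
    have "?D ?c = (\<Sum>c' = 1..N. (if ?c = c' then \<kappa> (v ^ ?i) else 0) * G c' j) +
      (\<Sum>c' = 1..N. \<kappa> (r * u ^ ?i) * (\<Sum>m = 1..n. Q ?i m * (hook m c' * G c' j)))"
      unfolding sum.distrib[symmetric]
      by (intro sum.cong refl) (simp only: ext distrib_right sum_distrib_right mult.assoc)
    also have "(\<Sum>c' = 1..N. \<kappa> (r * u ^ ?i) * (\<Sum>m = 1..n. Q ?i m * (hook m c' * G c' j))) =
      \<kappa> (r * u ^ ?i) * (\<Sum>m = 1..n. Q ?i m * (\<Sum>c' = 1..N. hook m c' * G c' j))"
      unfolding sum_distrib_left[symmetric] by (subst sum.swap) (simp only: sum_distrib_left)
    also have "(\<Sum>m = 1..n. Q ?i m * (\<Sum>c' = 1..N. hook m c' * G c' j)) = (\<Sum>m = 1..n. Q ?i m * hsym (int (N - j + m)))"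
      by (intro sum.cong refl) (use sum_hook_G assms(3,4) in simp)
    finally have D: "?D ?c = \<kappa> (v ^ ?i) * G ?c j + \<kappa> (r * u ^ ?i) * (\<Sum>m = 1..n. Q ?i m * hsym (int (N - j + m)))"
      unfolding one .
    have "\<kappa> ((-1) ^ (N - i)) = (-1) ^ (N - i)" by (simp add: mvps_const.hom_power mvps_const.hom_uminus)
    then have "h_form i j = \<kappa> (v ^ ?i) * ((-1) ^ (N - i) * G ?c j) +
      \<kappa> ((-1) ^ (N - i) * (r * u ^ ?i)) * (\<Sum>m = 1..n. Q ?i m * hsym (int (N - j + m)))"
      unfolding h D by (simp add: distrib_left mvps_const.hom_mult mult_ac)
    then show ?thesis using True sgn by simp
  qed
qed

end

section \<open>The generating function as a sum of products of minors\<close>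

lemma sum_nth_pred:
  assumes "0 \<notin> set (xs :: nat list)"
  shows "(\<Sum>i<length xs. map (\<lambda>x. x - 1) xs ! i + 1) = sum_list xs"
proof -
  have "(\<Sum>i<length xs. map (\<lambda>x. x - 1) xs ! i + 1) = (\<Sum>i<length xs. xs ! i)"
  proof (intro sum.cong refl)
    fix i assume "i \<in> {..<length xs}"
    then have i: "i < length xs" by simp
    then have "xs ! i \<noteq> 0" using assms nth_mem[OF i] by metis
    then show "map (\<lambda>x. x - 1) xs ! i + 1 = xs ! i" using i by simp
  qed
  then show ?thesis by (simp add: sum_list_sum_nth atLeast0LessThan)
qed

lemma frob_pair_shift:
  assumes "frob_pair cs es" "0 \<notin> set cs"
  shows "frob_pair cs (map (\<lambda>e. e + k) es)"
  using assms by (auto simp: frob_pair_def sorted_wrt_map)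

context tspp_params
begin

text \<open>The weight of a plane partition in the shifted coordinates: the sums of
  \<open>a + 1\<close> and \<open>b + 1\<close> become plain sums of lists, and the differences in
  the exponent of \<open>w\<close> are unchanged.\<close>

definition weight :: "nat list \<Rightarrow> nat list \<Rightarrow> 'a" where
  "weight es cs = r ^ length cs * u ^ sum_list cs * v powi (int ((n + 1) choose 2) - int (sum_list es)) *
     w powi (int (sum_list es) - int (sum_list cs))"

lemma tspp_summand:
  assumes p: "frob_pair cs es" "0 \<notin> set cs"
    and f: "frobenius (tspp_diag n T) = (map (\<lambda>c. c - 1) cs, map (\<lambda>e. e - 1) es)"
  shows "\<kappa> (tspp_weight (n + 1) r u v w T) * schur (tspp_pi n k T) =
    \<kappa> (weight es cs) * minor hook cs (map (\<lambda>e. e + k) es)"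
proof -
  have len: "length es = length cs" and es: "0 \<notin> set es" using p by (auto simp: frob_pair_def)
  have s: "(\<Sum>i<length cs. map (\<lambda>c. c - 1) cs ! i + 1) = sum_list cs" by (rule sum_nth_pred[OF p(2)])
  have se: "(\<Sum>i<length cs. map (\<lambda>e. e - 1) es ! i + 1) = sum_list es" using sum_nth_pred[OF es] len by simp
  have s1: "(\<Sum>i<length cs. int (map (\<lambda>e. e - 1) es ! i) + 1) = int (sum_list es)"
    unfolding se[symmetric] of_nat_sum of_nat_add of_nat_1 ..
  have "(\<Sum>i<length cs. int (map (\<lambda>e. e - 1) es ! i) - int (map (\<lambda>c. c - 1) cs ! i)) =
    (\<Sum>i<length cs. int (map (\<lambda>e. e - 1) es ! i + 1)) - (\<Sum>i<length cs. int (map (\<lambda>c. c - 1) cs ! i + 1))"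
    unfolding sum_subtractf[symmetric] by (intro sum.cong) auto
  also have "\<dots> = int (sum_list es) - int (sum_list cs)"
    unfolding of_nat_sum[symmetric] s se ..
  finally have s2: "(\<Sum>i<length cs. int (map (\<lambda>e. e - 1) es ! i) - int (map (\<lambda>c. c - 1) cs ! i)) =
    int (sum_list es) - int (sum_list cs)" .
  have "tspp_weight (n + 1) r u v w T = weight es cs"
    unfolding tspp_weight_def weight_def add_diff_cancel_right' f prod.case Let_def length_map s s1 s2 ..
  moreover have mp: "map (\<lambda>b. b + k) (map (\<lambda>e. e - 1) es) = map (\<lambda>e. e - 1) (map (\<lambda>e. e + k) es)"
  proof -
    have "e - 1 + k = e + k - 1" if "e \<in> set es" for e
    proof -
      have "e \<noteq> 0" using that es by metis
      then show ?thesis by simp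
    qed
    then show ?thesis by simp
  qed
  moreover have "schur (tspp_pi n k T) = (minor hook cs (map (\<lambda>e. e + k) es) :: 'a mvps)"
    unfolding tspp_pi_def f prod.case mp by (intro giambelli frob_pair_shift p)
  ultimately show ?thesis by simp
qed

abbreviation "DL \<equiv> {ys :: nat list. sorted_wrt (>) ys \<and> set ys \<subseteq> {1..n}}"

text \<open>Plane partitions are grouped by the Frobenius coordinates of their diagonal, on which
  the summand depends alone. Each group is counted by a binomial minor, and Giambelli's formula
  rewrites the Schur function.\<close>

lemma tspp_fun_expansion:
  "tspp_fun (n + 1) k r u v w =
    (\<Sum>es\<in>DL. \<Sum>cs\<in>dec_lists {1..n} (length es).
       minor binomial_matrix es cs * (\<kappa> (weight es cs) * minor hook cs (map (\<lambda>e. e + k) es)))"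
proof -
  define D where "D = (SIGMA es:DL. dec_lists {1..n} (length es))"
  define g where "g T = (map Suc (snd (frobenius (tspp_diag n T))), map Suc (fst (frobenius (tspp_diag n T))))" for T
  define h where "h T = \<kappa> (tspp_weight (n + 1) r u v w T) * schur (tspp_pi n k T)" for T
  have finD: "finite D" unfolding D_def by (intro finite_SigmaI finite_dec_lists_le finite_dec_lists) simp
  have suc_pred: "map Suc (map (\<lambda>c. c - 1) cs) = cs" if "0 \<notin> set cs" for cs
  proof -
    have "Suc (c - 1) = c" if c: "c \<in> set cs" for c
    proof -
      have "c \<noteq> 0" using c \<open>0 \<notin> set cs\<close> by metis
      then show ?thesis by simp
    qed
    then show ?thesis by (simp add: map_idI)
  qed
  have gD: "g ` tspp n \<subseteq> D"
  proof (rule image_subsetI)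
    fix T assume T: "T \<in> tspp n"
    obtain cs es where p: "frob_pair cs es" "0 \<notin> set cs" "set cs \<subseteq> {1..n}" "set es \<subseteq> {1..n}"
      "frobenius (tspp_diag n T) = (map (\<lambda>c. c - 1) cs, map (\<lambda>e. e - 1) es)"
      by (rule tspp_frobenius[OF T])
    have z: "0 \<notin> set es" using p by (simp add: frob_pair_def)
    have "g T = (es, cs)" unfolding g_def p(5) fst_conv snd_conv suc_pred[OF p(2)] suc_pred[OF z] ..
    then show "g T \<in> D" using p by (simp add: D_def dec_lists_def frob_pair_def)
  qed
  have inner: "(\<Sum>T\<in>{T \<in> tspp n. g T = (es, cs)}. h T) =
    minor binomial_matrix es cs * (\<kappa> (weight es cs) * minor hook cs (map (\<lambda>e. e + k) es))"
    if "(es, cs) \<in> D" for es cs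
  proof -
    have d: "sorted_wrt (>) es" "set es \<subseteq> {1..n}" "sorted_wrt (>) cs" "set cs \<subseteq> {1..n}" "length cs = length es"
      using that by (auto simp: D_def dec_lists_def)
    have z: "0 \<notin> set cs" "0 \<notin> set es" using d by auto
    have p: "frob_pair cs es" using d z by (simp add: frob_pair_def)
    let ?F = "(map (\<lambda>c. c - 1) cs, map (\<lambda>e. e - 1) es)"
    have "g T = (es, cs) \<longleftrightarrow> frobenius (tspp_diag n T) = ?F" for T
    proof
      assume "g T = (es, cs)"
      then have "es = map Suc (snd (frobenius (tspp_diag n T)))" "cs = map Suc (fst (frobenius (tspp_diag n T)))"
        by (auto simp: g_def)
      then show "frobenius (tspp_diag n T) = ?F" by (simp add: o_def)
    next
      assume "frobenius (tspp_diag n T) = ?F"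
      then show "g T = (es, cs)" unfolding g_def by (simp only: fst_conv snd_conv suc_pred[OF z(1)] suc_pred[OF z(2)])
    qed
    then have eq: "{T \<in> tspp n. g T = (es, cs)} = {T \<in> tspp n. frobenius (tspp_diag n T) = ?F}" by blast
    have "(\<Sum>T\<in>{T \<in> tspp n. frobenius (tspp_diag n T) = ?F}. h T) =
      (\<Sum>T\<in>{T \<in> tspp n. frobenius (tspp_diag n T) = ?F}. \<kappa> (weight es cs) * minor hook cs (map (\<lambda>e. e + k) es))"
      unfolding h_def by (intro sum.cong refl tspp_summand[OF p z(1)]) simp
    also have "\<dots> = of_nat (card {T \<in> tspp n. frobenius (tspp_diag n T) = ?F}) *
        (\<kappa> (weight es cs) * minor hook cs (map (\<lambda>e. e + k) es))"
      by simp
    finally show ?thesis unfolding eq card_tspp_frobenius[OF p z(1) d(2)] .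
  qed
  have "tspp_fun (n + 1) k r u v w = (\<Sum>T\<in>tspp n. h T)" by (simp add: tspp_fun_def h_def)
  also have "\<dots> = (\<Sum>y\<in>D. \<Sum>T\<in>{T \<in> tspp n. g T = y}. h T)"
    by (rule sum.group[OF finite_tspp finD gD, symmetric])
  also have "\<dots> = (\<Sum>(es, cs)\<in>D. minor binomial_matrix es cs * (\<kappa> (weight es cs) * minor hook cs (map (\<lambda>e. e + k) es)))"
    by (intro sum.cong refl) (auto simp: inner)
  also have "\<dots> = (\<Sum>es\<in>DL. \<Sum>cs\<in>dec_lists {1..n} (length es).
       minor binomial_matrix es cs * (\<kappa> (weight es cs) * minor hook cs (map (\<lambda>e. e + k) es)))"
    unfolding D_def
    by (rule sum.Sigma[symmetric]) (use finite_dec_lists_le finite_dec_lists in auto)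
  finally show ?thesis .
qed

lemma prod_list_powi: "(\<Prod>x\<leftarrow>xs. \<kappa> (t powi (s * int x))) = \<kappa> (t powi (s * int (sum_list xs)))"
  by (induction xs) (simp_all add: mvps_const.hom_mult[symmetric] power_int_add t_nonzero distrib_left)

lemma prod_list_ru: "(\<Prod>x\<leftarrow>xs. \<kappa> (r * u ^ x)) = \<kappa> (r ^ length xs * u ^ sum_list xs)"
  by (induction xs) (simp_all add: mvps_const.hom_mult[symmetric] power_add mult_ac)

text \<open>Since \<open>1 + ... + n\<close> is \<open>(n + 1) choose 2\<close>, the indices left
  out of \<open>es\<close> supply the exponent of \<open>v\<close>. The power of \<open>u\<close> in
  the denominator of \<open>t\<close> lowers \<open>sum_list es\<close> to
  \<open>sum_list cs\<close>.\<close>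

lemma weight_factor:
  assumes "sorted_wrt (>) es" "set es \<subseteq> {1..n}" "length cs = length es"
  shows "(\<Prod>i\<in>{1..n} - set es. v ^ i) * (t powi int (sum_list es) * t powi (- int (sum_list cs))) *
    (r ^ length es * u ^ sum_list es) = weight es cs"
proof -
  have "sum_list es = (\<Sum>i\<in>set es. i)" using dec_list_distinct[OF assms(1)] by (simp add: distinct_sum_list_conv_Sum)
  moreover have "(\<Sum>i\<in>{1..n}. i) = (\<Sum>i\<in>{1..n} - set es. i) + (\<Sum>i\<in>set es. i)"
    using assms(2) by (intro sum.subset_diff) auto
  moreover have "(\<Sum>i\<in>{1..n}. i) = (n + 1) choose 2"
    using gauss_sum_from_Suc_0[of n, where 'a = nat] by (simp add: choose_two mult.commute)
  ultimately have "(n + 1) choose 2 = (\<Sum>i\<in>{1..n} - set es. i) + sum_list es" by simp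
  then have "int ((n + 1) choose 2) - int (sum_list es) = int (\<Sum>i\<in>{1..n} - set es. i)" by simp
  then have v: "(\<Prod>i\<in>{1..n} - set es. v ^ i) = v powi (int ((n + 1) choose 2) - int (sum_list es))"
    by (simp only: power_int_of_nat power_sum)
  have "t powi int (sum_list es) * t powi (- int (sum_list cs)) = t powi (int (sum_list es) + - int (sum_list cs))"
    by (rule power_int_add[symmetric]) (simp add: t_nonzero)
  also have "\<dots> = w powi (int (sum_list es) - int (sum_list cs)) / u powi (int (sum_list es) - int (sum_list cs))"
    by (simp add: t_def power_int_divide_distrib)
  finally have t: "t powi int (sum_list es) * t powi (- int (sum_list cs)) =
    w powi (int (sum_list es) - int (sum_list cs)) / u powi (int (sum_list es) - int (sum_list cs))" .
  have "u powi (int (sum_list es) - int (sum_list cs)) = u ^ sum_list es / u ^ sum_list cs"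
    using u_nonzero by (simp add: power_int_diff)
  then show ?thesis unfolding v t weight_def using u_nonzero assms(3) by (simp add: field_simps)
qed

lemma tspp_fun_eq_core: "tspp_fun (n + 1) k r u v w = minor core L L"
proof -
  let ?B = "\<lambda>m j. hook m (j + k) * \<kappa> (r * u ^ j)"
  let ?X = "\<lambda>i j. \<Sum>m\<in>{1..n}. Q i m * ?B m j"
  have core: "core = (\<lambda>i j. ?X i j + (if i = j then \<kappa> (v ^ i) else 0))"
    by (intro ext) (auto simp: core_def sum_distrib_left mult_ac add.commute)
  \<comment> \<open>Cauchy--Binet separates binomials from hooks; the row and column scalings leave
    the minors as powers of \<open>t\<close> and of \<open>r\<close> and \<open>u\<close>.\<close>
  have X: "minor ?X es es = (\<Sum>cs\<in>dec_lists {1..n} (length es).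
      minor binomial_matrix es cs * (\<kappa> (t powi int (sum_list es) * t powi (- int (sum_list cs)) * (r ^ length es * u ^ sum_list es)) *
        minor hook cs (map (\<lambda>e. e + k) es)))" if "set es \<subseteq> {1..n}" for es
  proof -
    have "minor ?X es es = (\<Sum>cs\<in>dec_lists {1..n} (length es). minor Q es cs * minor ?B cs es)"
      by (rule cauchy_binet) auto
    also have "\<dots> = (\<Sum>cs\<in>dec_lists {1..n} (length es).
      minor binomial_matrix es cs * (\<kappa> (t powi int (sum_list es) * t powi (- int (sum_list cs)) * (r ^ length es * u ^ sum_list es)) *
        minor hook cs (map (\<lambda>e. e + k) es)))"
    proof (intro sum.cong refl)
      fix cs assume "cs \<in> dec_lists {1..n} (length es)"
      then have len: "length cs = length es" by (simp add: dec_lists_def)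
      have "Q i m = \<kappa> (t powi (1 * int i)) * binomial_matrix i m * \<kappa> (t powi (-1 * int m))" for i m
      proof -
        have "t powi (int i + - int m) = t powi int i * t powi (- int m)"
          by (rule power_int_add) (simp add: t_nonzero)
        then have "t powi (int i - int m) = t powi (1 * int i) * t powi (-1 * int m)" by simp
        then show ?thesis unfolding Q_def binomial_matrix_def
          by (simp only: mvps_const.hom_mult mvps_const.hom_of_nat mult_ac)
      qed
      then have "minor Q es cs = minor (\<lambda>i m. \<kappa> (t powi (1 * int i)) * binomial_matrix i m * \<kappa> (t powi (-1 * int m))) es cs"
        by presburger
      also have "\<dots> = (\<Prod>x\<leftarrow>es. \<kappa> (t powi (1 * int x))) * (\<Prod>x\<leftarrow>cs. \<kappa> (t powi (-1 * int x))) * minor binomial_matrix es cs"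
        by (rule minor_scale) (simp add: len)
      also have "\<dots> = \<kappa> (t powi int (sum_list es)) * \<kappa> (t powi (- int (sum_list cs))) * minor binomial_matrix es cs"
        unfolding prod_list_powi by simp
      finally have q: "minor Q es cs = \<kappa> (t powi int (sum_list es)) * \<kappa> (t powi (- int (sum_list cs))) * minor binomial_matrix es cs" .
      have "minor ?B cs es = minor (\<lambda>m j. 1 * hook m (j + k) * \<kappa> (r * u ^ j)) cs es" by simp
      also have "\<dots> = (\<Prod>x\<leftarrow>cs. 1) * (\<Prod>x\<leftarrow>es. \<kappa> (r * u ^ x)) * minor (\<lambda>m j. hook m (j + k)) cs es"
        by (rule minor_scale[OF len])
      also have "(\<Prod>x\<leftarrow>cs. 1) = (1 :: 'a mvps)" by (induction cs) simp_all
      also have "minor (\<lambda>m j. hook m (j + k)) cs es = (minor hook cs (map (\<lambda>e. e + k) es) :: 'a mvps)"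
        using minor_map[OF len, of "hook :: _ \<Rightarrow> _ \<Rightarrow> 'a mvps" id "\<lambda>e. e + k"] by simp
      finally have b: "minor ?B cs es = \<kappa> (r ^ length es * u ^ sum_list es) * minor hook cs (map (\<lambda>e. e + k) es)"
        unfolding prod_list_ru by simp
      show "minor Q es cs * minor ?B cs es = minor binomial_matrix es cs * (\<kappa> (t powi int (sum_list es) * t powi (- int (sum_list cs)) *
         (r ^ length es * u ^ sum_list es)) * minor hook cs (map (\<lambda>e. e + k) es))"
        unfolding q b unfolding mvps_const.hom_mult by (simp only: mult_ac)
    qed
    finally show ?thesis .
  qed
  \<comment> \<open>Reversed, because the expansion into principal minors is stated for decreasing
    lists.\<close>
  have "minor core L L = minor core (rev L) (rev L)" by (rule minor_rev[symmetric]) simp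
  also have "\<dots> = (\<Sum>es\<in>DL. (\<Prod>i\<in>{1..n} - set es. \<kappa> (v ^ i)) * minor ?X es es)"
    unfolding core by (rule minor_add_diagonal)
  also have "\<dots> = tspp_fun (n + 1) k r u v w"
    unfolding tspp_fun_expansion
  proof (intro sum.cong refl)
    fix es assume "es \<in> DL"
    then have es: "sorted_wrt (>) es" "set es \<subseteq> {1..n}" by auto
    show "(\<Prod>i\<in>{1..n} - set es. \<kappa> (v ^ i)) * minor ?X es es =
      (\<Sum>cs\<in>dec_lists {1..n} (length es).
       minor binomial_matrix es cs * (\<kappa> (weight es cs) * minor hook cs (map (\<lambda>e. e + k) es)))"
      unfolding X[OF es(2)] sum_distrib_left
    proof (intro sum.cong refl)
      fix cs assume "cs \<in> dec_lists {1..n} (length es)"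
      then have len: "length cs = length es" by (simp add: dec_lists_def)
      have "\<kappa> (weight es cs) = (\<Prod>i\<in>{1..n} - set es. \<kappa> (v ^ i)) *
        \<kappa> (t powi int (sum_list es) * t powi (- int (sum_list cs)) * (r ^ length es * u ^ sum_list es))"
        unfolding weight_factor[OF es len, symmetric] mvps_const.hom_mult mvps_const.hom_prod by (simp only: mult_ac)
      then show "(\<Prod>i\<in>{1..n} - set es. \<kappa> (v ^ i)) * (minor binomial_matrix es cs *
        (\<kappa> (t powi int (sum_list es) * t powi (- int (sum_list cs)) * (r ^ length es * u ^ sum_list es)) *
        minor hook cs (map (\<lambda>e. e + k) es))) =
        minor binomial_matrix es cs * (\<kappa> (weight es cs) * minor hook cs (map (\<lambda>e. e + k) es))"
        by (simp only: mult_ac)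
    qed
  qed
  finally show ?thesis by simp
qed

end

section \<open>Integer indices and sums over all integers\<close>

lemma ibinom_of_nat: "ibinom (int p) (int q) = of_nat (p choose q)"
  by (simp add: ibinom_def binomial_eq_0)

lemma ibinom_eq:
  assumes "1 \<le> p" "1 \<le> q"
  shows "ibinom (int p - 1) (int q - 1) = of_nat ((p - 1) choose (q - 1))"
  using ibinom_of_nat[of "p - 1" "q - 1"] assms by (simp add: of_nat_diff)

text \<open>Symmetry of binomial coefficients. For \<open>m < i\<close> both sides are 0, on the
  left through the negative lower index.\<close>

lemma ibinom_flip:
  assumes "1 \<le> m" "1 \<le> i"
  shows "ibinom (int m - 1) (int m - int i) = of_nat ((m - 1) choose (i - 1))"
proof (cases "i \<le> m")
  case True
  have "int m - 1 = int (m - 1)" "int m - int i = int (m - i)" using True assms by auto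
  moreover have "(m - 1) choose (m - i) = (m - 1) choose (i - 1)"
    using binomial_symmetric[of "m - i" "m - 1"] True assms by simp
  ultimately show ?thesis by (simp only: ibinom_of_nat)
next
  case False
  then have "(m - 1) choose (i - 1) = 0" using assms by (intro binomial_eq_0) linarith
  then show ?thesis using False by (simp only: ibinom_def) simp
qed

lemma minus_one_powi_diff: "(-1 :: 'a::field) powi (int j - int i) = (-1) ^ (i + j)"
  by (simp add: power_int_diff power_add minus_one_power_iff)

lemma schur_hook_eq: "schur_hook (int i - 1) (int j + int k - 1) = hook i (j + k)"
proof -
  have "nat (int i - 1) = i - 1" "nat (int j + int k - 1) = j + k - 1" by auto
  then show ?thesis by (simp add: schur_hook_def hook_def)
qed

lemma Sum_any_int_eq_sum:
  fixes f :: "int \<Rightarrow> 'a::comm_monoid_add"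
  assumes "\<And>m. m < 1 \<or> m > int n \<Longrightarrow> f m = 0"
  shows "Sum_any f = (\<Sum>m = 1..n. f (int m))"
proof -
  have "Sum_any f = sum f {1..int n}"
    by (rule Sum_any.expand_superset) (use assms in force)+
  also have "\<dots> = (\<Sum>m = 1..n. f (int m))"
    by (rule sum.reindex_bij_witness[where i = int and j = nat]) auto
  finally show ?thesis .
qed

context tspp_params
begin

lemma det1_hook_form:
  "det1 n (\<lambda>i j. \<kappa> ((-1) powi (j - i) * v powi j * ibinom (i - 1) (j - 1)) +
     \<kappa> (r * u powi i * w powi (j - i)) * schur_hook (i - 1) (j + int k - 1)) = minor core L L"
  unfolding det1_minor minor_hook_form[symmetric]
proof (rule minor_cong)
  fix i j assume "i \<in> set L" "j \<in> set L"
  then have "1 \<le> i" "1 \<le> j" by auto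
  then show "\<kappa> ((-1) powi (int j - int i) * v powi int j * ibinom (int i - 1) (int j - 1)) +
     \<kappa> (r * u powi int i * w powi (int j - int i)) * schur_hook (int i - 1) (int j + int k - 1) = hook_form i j"
    by (simp only: hook_form_def minus_one_powi_diff ibinom_eq schur_hook_eq power_int_of_nat)
qed simp

lemma det1_core:
  "det1 n (\<lambda>i j. \<kappa> (if i = j then v powi i else 0) + \<kappa> (r * u powi j) *
     Sum_any (\<lambda>m::int. \<kappa> (ibinom (i - 1) (i - m) * (w / u) powi (i - m)) * schur_hook (m - 1) (j + int k - 1))) =
   minor core L L"
  unfolding det1_minor
proof (rule minor_cong)
  fix i j assume "i \<in> set L" "j \<in> set L"
  then have ij: "1 \<le> i" "i \<le> n" "1 \<le> j" by auto
  \<comment> \<open>The binomial is 0 for \<open>m > i\<close>, where its lower index is negative,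
    and for \<open>m < 1\<close>, where it exceeds the upper one.\<close>
  have "Sum_any (\<lambda>m::int. \<kappa> (ibinom (int i - 1) (int i - m) * (w / u) powi (int i - m)) * schur_hook (m - 1) (int j + int k - 1)) =
    (\<Sum>m = 1..n. \<kappa> (ibinom (int i - 1) (int i - int m) * (w / u) powi (int i - int m)) * schur_hook (int m - 1) (int j + int k - 1))"
    by (rule Sum_any_int_eq_sum) (use ij in \<open>auto simp: ibinom_def\<close>)
  also have "\<dots> = (\<Sum>m = 1..n. Q i m * hook m (j + k))"
    by (intro sum.cong refl) (use ij in \<open>simp only: atLeastAtMost_iff Q_def t_def ibinom_flip schur_hook_eq\<close>)
  finally show "\<kappa> (if int i = int j then v powi int i else 0) + \<kappa> (r * u powi int j) *
     Sum_any (\<lambda>m::int. \<kappa> (ibinom (int i - 1) (int i - m) * (w / u) powi (int i - m)) * schur_hook (m - 1) (int j + int k - 1)) = core i j"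
    by (simp add: core_def)
qed simp

lemma det1_e_form:
  "det1 n (\<lambda>i j. \<kappa> (r * u powi i) * esym (int n + int k + i - j) + \<kappa> ((-1) powi (i - 1) * v powi i) *
     Sum_any (\<lambda>m::int. \<kappa> (ibinom (m - 1) (m - i)) * esym (int n + 1 - j - m) * \<kappa> ((w / u) powi (m - i)))) =
   minor core L L"
  unfolding det1_minor minor_e_form[symmetric]
proof (rule minor_cong)
  fix i j assume "i \<in> set L" "j \<in> set L"
  then have ij: "1 \<le> i" "i \<le> n" "1 \<le> j" "j \<le> n" by auto
  \<comment> \<open>For \<open>m < 1\<close> the binomial is 0, and for \<open>m > n\<close> the
    index of \<open>esym\<close> is negative because \<open>1 \<le> j\<close>.\<close>
  have "Sum_any (\<lambda>m::int. \<kappa> (ibinom (m - 1) (m - int i)) * esym (int n + 1 - int j - m) * \<kappa> ((w / u) powi (m - int i))) =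
    (\<Sum>m = 1..n. \<kappa> (ibinom (int m - 1) (int m - int i)) * esym (int n + 1 - int j - int m) * \<kappa> ((w / u) powi (int m - int i)))"
    by (rule Sum_any_int_eq_sum) (use ij in \<open>auto simp: ibinom_def esym_neg\<close>)
  moreover have "\<kappa> ((-1) powi (int i - 1) * v powi int i) *
      (\<kappa> (ibinom (int m - 1) (int m - int i)) * esym (int n + 1 - int j - int m) * \<kappa> ((w / u) powi (int m - int i))) =
    R j m * \<kappa> ((-1) ^ (m + i) * v ^ i * of_nat ((m - 1) choose (i - 1)) * t powi (int m - int i))"
    if m: "m \<in> {1..n}" for m
  proof (cases "j + m \<le> n + 1")
    case True
    then have e: "int n + 1 - int j - int m = int (n + 1 - j - m)" by simp
    \<comment> \<open>Up to an even number, \<open>m + i\<close> is the sum of \<open>i - 1\<close>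
      and \<open>m - 1\<close>; the sign for \<open>m - 1\<close> cancels the one in
      \<open>R\<close>.\<close>
    have "m + i = (i - 1) + 2 * 1 + (m - 1)" using m ij by auto
    then have s1: "(-1 :: 'a) ^ (m + i) = (-1) ^ (i - 1) * (-1) ^ (m - 1)" by (simp only: power_add power_mult) simp
    have s2: "(-1 :: 'a mvps) ^ (m - 1) = \<kappa> ((-1) ^ (m - 1))" by (simp add: mvps_const.hom_power mvps_const.hom_uminus)
    have s3: "(-1 :: 'a) powi (int i - 1) = (-1) ^ (i - 1)"
      using ij power_int_of_nat[of "-1 :: 'a" "i - 1"] by (simp add: of_nat_diff)
    have s4: "(-1 :: 'a) ^ (m - 1) * (-1) ^ (m - 1) = 1" by (simp add: power_add[symmetric])
    have "R j m * \<kappa> ((-1) ^ (m + i) * v ^ i * of_nat ((m - 1) choose (i - 1)) * t powi (int m - int i)) =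
      \<kappa> (((-1) ^ (m - 1) * (-1) ^ (m - 1)) * ((-1) ^ (i - 1) * v ^ i)) *
      (\<kappa> (of_nat ((m - 1) choose (i - 1))) * esym (int (n + 1 - j - m)) * \<kappa> (t powi (int m - int i)))"
      unfolding R_def if_P[OF True] s1 s2 mvps_const.hom_mult by (simp only: mult_ac)
    then show ?thesis
      using m ij by (simp only: s4 s3 e t_def ibinom_flip atLeastAtMost_iff power_int_of_nat mult_1)
  next
    case False
    then have "int n + 1 - int j - int m < 0" by simp
    then show ?thesis using False by (simp add: R_def esym_neg)
  qed
  moreover have "int n + int k + int i - int j = int (n - j + (i + k))" using ij by simp
  ultimately show "\<kappa> (r * u powi int i) * esym (int n + int k + int i - int j) + \<kappa> ((-1) powi (int i - 1) * v powi int i) *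
     Sum_any (\<lambda>m::int. \<kappa> (ibinom (m - 1) (m - int i)) * esym (int n + 1 - int j - m) * \<kappa> ((w / u) powi (m - int i))) = e_form i j"
    unfolding e_form_eq[OF ij(1,3,4)] by (simp only: sum_distrib_left power_int_of_nat cong: sum.cong)
qed simp

lemma det1_h_form:
  "det1 (n + k) (\<lambda>i j. if i \<le> int n then
      \<kappa> (v powi (int n - i + 1)) * hsym (i - j) + \<kappa> ((-1) powi (int k + int n - i) * r * u powi (int n - i + 1)) *
        Sum_any (\<lambda>m::int. \<kappa> (ibinom (int n - i) (m - i)) * hsym (int k + 1 + 2 * int n - m - j) * \<kappa> ((w / u) powi (m - i)))
      else hsym (i - j)) = minor core L L"
  unfolding det1_minor minor_h_form[symmetric]
proof (rule minor_cong)
  fix i j assume "i \<in> set L'" "j \<in> set L'"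
  then have ij: "1 \<le> i" "i \<le> N" "1 \<le> j" "j \<le> N" by auto
  show "(if int i \<le> int n then
      \<kappa> (v powi (int n - int i + 1)) * hsym (int i - int j) + \<kappa> ((-1) powi (int k + int n - int i) * r * u powi (int n - int i + 1)) *
        Sum_any (\<lambda>m::int. \<kappa> (ibinom (int n - int i) (m - int i)) * hsym (int k + 1 + 2 * int n - m - int j) * \<kappa> ((w / u) powi (m - int i)))
      else hsym (int i - int j)) = h_form i j"
  proof (cases "i \<le> n")
    case True
    let ?i = "n + 1 - i"
    let ?f = "\<lambda>m. \<kappa> (ibinom (int n - int i) (m - int i)) * hsym (int k + 1 + 2 * int n - m - int j) * \<kappa> ((w / u) powi (m - int i))"
    have "Sum_any ?f = (\<Sum>m = 1..n. ?f (int m))"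
      by (rule Sum_any_int_eq_sum) (use ij in \<open>auto simp: ibinom_def\<close>)
    \<comment> \<open>Row \<open>i\<close> of the stated matrix uses row \<open>n + 1 - i\<close> of
      \<open>Q\<close>, so \<open>m\<close> has to be reversed as well: both index differences then
      agree.\<close>
    also have "\<dots> = (\<Sum>m = 1..n. ?f (int (n + 1 - m)))" by (rule sum.atLeastAtMost_rev)
    also have "\<dots> = (\<Sum>m = 1..n. Q ?i m * hsym (int (N - j + m)))"
    proof (intro sum.cong refl)
      fix m assume m: "m \<in> {1..n}"
      have 1: "int n - int i = int ?i - 1" "int (n + 1 - m) - int i = int ?i - int m"
        "int k + 1 + 2 * int n - int (n + 1 - m) - int j = int (N - j + m)"
        using True m ij by auto
      have "ibinom (int ?i - 1) (int ?i - int m) = (of_nat ((?i - 1) choose (m - 1)) :: 'a)"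
        by (rule ibinom_flip) (use True m in auto)
      then show "?f (int (n + 1 - m)) = Q ?i m * hsym (int (N - j + m))"
        unfolding 1 Q_def t_def mvps_const.hom_mult by (simp only: mult_ac)
    qed
    finally have f: "Sum_any ?f = (\<Sum>m = 1..n. Q ?i m * hsym (int (N - j + m)))" .
    have e: "int n - int i + 1 = int ?i" "int k + int n - int i = int (N - i)" using True by auto
    show ?thesis
      unfolding h_form_eq[OF ij] if_P[OF True] f e power_int_of_nat using True by (simp add: mult.assoc)
  next
    case False
    then show ?thesis unfolding h_form_eq[OF ij] by simp
  qed
qed simp

end

theorem theorem1p1:
  fixes n k :: nat
  assumes "n \<ge> 1"
  shows
    "tspp_fun (n + 1) k indet_r indet_u indet_v indet_w =
       det1 n (\<lambda>i j. mvps_const ((-1) powi (j - i) * indet_v powi j * ibinom (i - 1) (j - 1))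
                   + mvps_const (indet_r * indet_u powi i * indet_w powi (j - i)) * schur_hook (i - 1) (j + int k - 1))
     \<and>
     tspp_fun (n + 1) k indet_r indet_u indet_v indet_w =
       det1 n (\<lambda>i j. mvps_const (indet_r * indet_u powi i) * esym (int n + int k + i - j)
                   + mvps_const ((-1) powi (i - 1) * indet_v powi i) *
                     Sum_any (\<lambda>m::int. mvps_const (ibinom (m - 1) (m - i)) * esym (int n + 1 - j - m)
                                      * mvps_const ((indet_w / indet_u) powi (m - i))))
     \<and>
     tspp_fun (n + 1) k indet_r indet_u indet_v indet_w =
       det1 (n + k) (\<lambda>i j.
         if i \<le> int n then
           mvps_const (indet_v powi (int n - i + 1)) * hsym (i - j)
           + mvps_const ((-1) powi (int k + int n - i) * indet_r * indet_u powi (int n - i + 1)) *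
             Sum_any (\<lambda>m::int. mvps_const (ibinom (int n - i) (m - i)) * hsym (int k + 1 + 2 * int n - m - j)
                              * mvps_const ((indet_w / indet_u) powi (m - i)))
         else hsym (i - j))
     \<and>
     tspp_fun (n + 1) k indet_r indet_u indet_v indet_w =
       det1 n (\<lambda>i j. mvps_const (if i = j then indet_v powi i else 0)
                   + mvps_const (indet_r * indet_u powi j) *
                     Sum_any (\<lambda>m::int. mvps_const (ibinom (i - 1) (i - m) * (indet_w / indet_u) powi (i - m))
                                      * schur_hook (m - 1) (j + int k - 1)))"
proof -
  interpret tspp_params indet_r indet_u indet_v indet_w n k
    by unfold_locales (simp_all add: indet_u_def indet_w_def eq_fract Zero_fract_def)
  show ?thesis
    by (intro conjI; simp only: tspp_fun_eq_core det1_hook_form det1_e_form det1_h_form det1_core)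
qed

end
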